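(* Let $\Omega\subset\mathbb{R}^d$ be an open bounded domain, let $\mathcal{A}=\sum_{l=1}^dA^l\partial_l$ with $A^l\in\mathbb{R}^{k\times m}$ be a linear homogeneous first-order constant-coefficient differential operator with the constant rank property and $k\ge d$, and let $1\le p<\infty$. Let $\bar z_1,\bar z_2\in L^\infty(\Omega,\mathbb{R}^m)$ be such that $\bar z_2(x)-\bar z_1(x)\notin\Lambda_{\mathcal{A}}$ for $x$ in a set $A\subset\Omega$ of positive measure. Let $z_n:\Omega\to\mathbb{R}^m$ be an equi-integrable family with $\|z_n\|_{L^p(\Omega,\mathbb{R}^m)}\le c<\infty$ and $\mathcal{A}z_n\to0$ in $W^{-1,r}(\Omega,\mathbb{R}^k)$ for some $r\in(1,\tfrac{d}{d-1})$. Assume $(z_n)$ generates a compactly supported Young measure $\nu$ with $\operatorname{supp}(\nu_x)\subset\{\lambda\bar z_1(x)+(1-\lambda)\bar z_2(x):\lambda\in[0,1]\}$ for a.e. $x\in\Omega$. Then for a.e. $x\in A$ one has $\nu_x=\delta_{w(x)}$ for some $w\in L^1(A,\mathbb{R}^m)$, and $z_n\to w$ in $L^1(A,\mathbb{R}^m)$.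
   Context: $\mathcal{A}$ has the constant rank property if $\operatorname{rank}\sum_{l=1}^d\xi_lA^l$ is the same for all unit vectors $\xi\in\mathbb{R}^d$. The wave cone is $\Lambda_{\mathcal{A}}:=\{\bar z\in\mathbb{R}^m\setminus\{0\}:\exists\xi\in\mathbb{R}^d\setminus\{0\}$ with $\mathcal{A}(h(x\cdot\xi)\bar z)=0$ in $\mathcal{D}'$ for all $h\in L^1_{loc}(\mathbb{R},\mathbb{R})\}$. A Young measure is a weakly*-measurable map $x\mapsto\nu_x$ into probability measures on $\mathbb{R}^m$; $(z_n)\subset L^1(\Omega,\mathbb{R}^m)$ generates $\nu$ if $\int_\Omega\varphi f(z_n)\,dx\to\int_\Omega\varphi\int f\,d\nu_x\,dx$ for all $\varphi\in L^1(\Omega)$, $f\in C_0(\mathbb{R}^m)$. It is compactly supported if all $\nu_x$ are supported in a common compact set. *)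

theory Defs
  imports "HOL-Analysis.Analysis" "HOL-Probability.Probability"
begin

definition partial :: "'a::euclidean_space \<Rightarrow> ('a \<Rightarrow> 'b::real_normed_vector) \<Rightarrow> 'a \<Rightarrow> 'b" where
  "partial b f x = frechet_derivative f (at x) b"

fun Cn :: "nat \<Rightarrow> ('a::euclidean_space \<Rightarrow> 'b::real_normed_vector) \<Rightarrow> bool" where
  "Cn 0 f = continuous_on UNIV f"
| "Cn (Suc n) f = ((\<forall>x. f differentiable (at x)) \<and> continuous_on UNIV f \<and>
                   (\<forall>b\<in>Basis. Cn n (partial b f)))"

definition smooth :: "('a::euclidean_space \<Rightarrow> 'b::real_normed_vector) \<Rightarrow> bool" where
  "smooth f \<longleftrightarrow> (\<forall>n. Cn n f)"

definition test_fun :: "'a::euclidean_space set \<Rightarrow> ('a \<Rightarrow> 'b::real_normed_vector) \<Rightarrow> bool" where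
  "test_fun U \<phi> \<longleftrightarrow> smooth \<phi> \<and> compact (closure {x. \<phi> x \<noteq> 0}) \<and> closure {x. \<phi> x \<noteq> 0} \<subseteq> U"

text \<open>The operator A = sum_l A^l d_l, with A^l given by A l (a k x m matrix).
  Distributional pairing  <A u, phi> = - int sum_l (A^l u) . d_l phi.\<close>
definition op_pairing :: "('d::finite \<Rightarrow> real^'m^'k) \<Rightarrow> (real^'d \<Rightarrow> real^'m) \<Rightarrow> (real^'d \<Rightarrow> real^'k) \<Rightarrow> real" where
  "op_pairing A u \<phi> = - (LINT x|lebesgue. (\<Sum>l\<in>UNIV. (A l *v u x) \<bullet> partial (axis l 1) \<phi> x))"

definition symbol :: "('d::finite \<Rightarrow> real^'m^'k) \<Rightarrow> real^'d \<Rightarrow> real^'m^'k" where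
  "symbol A \<xi> = (\<Sum>l\<in>UNIV. (\<xi> $ l) *\<^sub>R A l)"

definition constant_rank :: "('d::finite \<Rightarrow> real^'m^'k) \<Rightarrow> bool" where
  "constant_rank A \<longleftrightarrow> (\<forall>\<xi> \<eta>. norm \<xi> = 1 \<longrightarrow> norm \<eta> = 1 \<longrightarrow> rank (symbol A \<xi>) = rank (symbol A \<eta>))"

definition locally_integrable :: "(real \<Rightarrow> real) \<Rightarrow> bool" where
  "locally_integrable h \<longleftrightarrow> (\<forall>K. compact K \<longrightarrow> set_integrable lebesgue K h)"

definition wave_cone :: "('d::finite \<Rightarrow> real^'m^'k) \<Rightarrow> (real^'m) set" where
  "wave_cone A = {z. z \<noteq> 0 \<and> (\<exists>\<xi>::real^'d. \<xi> \<noteq> 0 \<and>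
      (\<forall>h. locally_integrable h \<longrightarrow>
         (\<forall>\<phi>::real^'d \<Rightarrow> real^'k. test_fun UNIV \<phi> \<longrightarrow> op_pairing A (\<lambda>x. h (x \<bullet> \<xi>) *\<^sub>R z) \<phi> = 0)))}"

definition W1_norm :: "real \<Rightarrow> (real^'d::finite \<Rightarrow> real^'k) \<Rightarrow> real" where
  "W1_norm q \<phi> = ((LINT x|lebesgue. norm (\<phi> x) powr q
       + (\<Sum>l\<in>UNIV. norm (partial (axis l 1) \<phi> x) powr q)) powr (1/q))"

text \<open>Norm of the distribution A u in W^{-1,r}(Omega) = dual of W_0^{1,r'}(Omega),
  computed on the dense subspace of test functions (possibly infinite).\<close>
definition Wm1_norm :: "('d::finite \<Rightarrow> real^'m^'k) \<Rightarrow> (real^'d) set \<Rightarrow> real \<Rightarrow> (real^'d \<Rightarrow> real^'m) \<Rightarrow> ereal" where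
  "Wm1_norm A \<Omega> r u = (SUP \<phi>\<in>{\<phi>. test_fun \<Omega> \<phi> \<and> W1_norm (r/(r-1)) \<phi> \<le> 1}.
        ereal \<bar>op_pairing A u \<phi>\<bar>)"

definition in_Lp :: "real \<Rightarrow> (real^'d::finite) set \<Rightarrow> (real^'d \<Rightarrow> real^'m) \<Rightarrow> bool" where
  "in_Lp p \<Omega> f \<longleftrightarrow> set_borel_measurable lebesgue \<Omega> f \<and>
                     set_integrable lebesgue \<Omega> (\<lambda>x. norm (f x) powr p)"

definition Lp_norm :: "real \<Rightarrow> (real^'d::finite) set \<Rightarrow> (real^'d \<Rightarrow> real^'m) \<Rightarrow> real" where
  "Lp_norm p \<Omega> f = (LINT x:\<Omega>|lebesgue. norm (f x) powr p) powr (1/p)"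

definition in_Linf :: "(real^'d::finite) set \<Rightarrow> (real^'d \<Rightarrow> real^'m) \<Rightarrow> bool" where
  "in_Linf \<Omega> f \<longleftrightarrow> set_borel_measurable lebesgue \<Omega> f \<and>
                     (\<exists>M. AE x in lebesgue. x \<in> \<Omega> \<longrightarrow> norm (f x) \<le> M)"

definition equi_integrable :: "(real^'d::finite) set \<Rightarrow> (nat \<Rightarrow> real^'d \<Rightarrow> real^'m) \<Rightarrow> bool" where
  "equi_integrable \<Omega> z \<longleftrightarrow> (\<forall>\<epsilon>>0. \<exists>\<delta>>0. \<forall>E. E \<in> sets lebesgue \<longrightarrow> E \<subseteq> \<Omega> \<longrightarrow>
      measure lebesgue E < \<delta> \<longrightarrow> (\<forall>n. (LINT x:E|lebesgue. norm (z n x)) < \<epsilon>))"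

definition C0 :: "('a::real_normed_vector \<Rightarrow> real) set" where
  "C0 = {f. continuous_on UNIV f \<and> (f \<longlongrightarrow> 0) at_infinity}"

definition measure_support :: "'a::metric_space measure \<Rightarrow> 'a set" where
  "measure_support \<mu> = {y. \<forall>e>0. emeasure \<mu> (ball y e) > 0}"

definition young_measure :: "(real^'d::finite) set \<Rightarrow> (real^'d \<Rightarrow> (real^'m) measure) \<Rightarrow> bool" where
  "young_measure \<Omega> \<nu> \<longleftrightarrow> (\<forall>x\<in>\<Omega>. prob_space (\<nu> x) \<and> sets (\<nu> x) = sets borel) \<and>
     (\<forall>f\<in>C0. set_borel_measurable lebesgue \<Omega> (\<lambda>x. \<integral>y. f y \<partial>\<nu> x))"

definition generates :: "(real^'d::finite) set \<Rightarrow> (nat \<Rightarrow> real^'d \<Rightarrow> real^'m) \<Rightarrow> (real^'d \<Rightarrow> (real^'m) measure) \<Rightarrow> bool" where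
  "generates \<Omega> z \<nu> \<longleftrightarrow> young_measure \<Omega> \<nu> \<and>
     (\<forall>\<phi> f. set_integrable lebesgue \<Omega> \<phi> \<longrightarrow> f \<in> C0 \<longrightarrow>
        (\<lambda>n. LINT x:\<Omega>|lebesgue. \<phi> x * f (z n x)) \<longlonglongrightarrow> (LINT x:\<Omega>|lebesgue. \<phi> x * (\<integral>y. f y \<partial>\<nu> x)))"

definition compactly_supported :: "(real^'d::finite) set \<Rightarrow> (real^'d \<Rightarrow> (real^'m) measure) \<Rightarrow> bool" where
  "compactly_supported \<Omega> \<nu> \<longleftrightarrow> (\<exists>K. compact K \<and> (\<forall>x\<in>\<Omega>. measure_support (\<nu> x) \<subseteq> K))"

end

theory Submission
  imports Defs "HOL-Real_Asymp.Real_Asymp"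
begin

text \<open>
  Let \<open>z1\<close> and \<open>z2\<close> be almost constant on a set \<open>P\<close>, with values near \<open>a\<close> and \<open>a + \<zeta>\<close>, where \<open>\<zeta> \<noteq> 0\<close> is not in
  the wave cone. In an open set that is only slightly larger than \<open>P\<close> we may write \<open>z n = a + q n *\<^sub>R \<zeta> + e n\<close> with scalars
  \<open>q n\<close> between 0 and 1 and an error \<open>e n\<close> that is small in \<open>L\<^sup>1\<close>. The symbol at \<open>\<zeta>\<close> is injective in the
  frequency, so the gradient of \<open>q n\<close> is the divergence of a small \<open>L\<^sup>1\<close> function up to a term tending to 0 in a
  negative Sobolev space; it is small when tested with Lipschitz fields. Singular integrals are not bounded on
  \<open>L\<^sup>1\<close>, but \<open>q n\<close> is bounded: the oscillation of \<open>q n\<close> is, up to a convergent average, the divergence of a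
  curl-free field with square integrable gradient, and a Lipschitz truncation of this field at height \<open>L\<close> is an admissible
  test field whose error is of order \<open>1 / L\<close>. Hence \<open>q n\<close> has almost no variance on \<open>P\<close>, and since the values of \<open>z1\<close> and
  \<open>z2\<close> can be localised by a countable cover, almost every \<open>\<nu> x\<close> is a Dirac measure.
\<close>

section \<open>A smooth bump function and convolutions\<close>

text \<open>What closes the localisation is the order in which the parameters are chosen. For an
  open set U the integral over U of the variance of the segment coordinate is at most C (L E + |U| /
  L), where E is the integral over U of the mean distance to the segment and C depends on neither U
  nor L. When U shrinks to P, the excess U - P contributes arbitrarily little, |U| tends to |P|, and
  E is at most 2 k |P| up to that excess, k being the localisation radius. Both terms therefore
  scale like |P|. If the total variance is at least a threshold on P, L is fixed from the threshold
  and C, and k afterwards from L; what remains is |P| s \<le> |P| s / 2 with s > 0, so P is null.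
  Points of density or blow-up sequences do not enter. The radius k depends on the segment, hence on
  the values of \<open>z1\<close> and \<open>z2\<close> at the chosen point, and no lower bound for
  it is claimed; this is why the final covering is a countable one in the space of values. A second
  obstacle is that \<open>z n\<close> is unbounded while the duality needs bounded scalars:
  truncating beyond the common support of the measures changes \<open>z n\<close> only by a null
  sequence in the mean, thanks to equi-integrability.\<close>

definition exp_bump :: "nat \<Rightarrow> real \<Rightarrow> real" where
  "exp_bump k t = (if t > 0 then exp (- 1 / t) / t ^ k else 0)"

lemma exp_bump_nonneg: "exp_bump k t \<ge> 0"
  by (simp add: exp_bump_def)

lemma exp_bump_pos: "t > 0 \<Longrightarrow> exp_bump k t > 0"
  by (simp add: exp_bump_def)

lemma exp_bump_eq_0: "t \<le> 0 \<Longrightarrow> exp_bump k t = 0"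
  by (simp add: exp_bump_def)

lemma exp_bump_tendsto_0: "(exp_bump k \<longlongrightarrow> 0) (at 0)"
proof -
  have r: "((\<lambda>h::real. exp (- 1 / h) / h ^ k) \<longlongrightarrow> 0) (at_right 0)"
    by real_asymp
  have "(exp_bump k \<longlongrightarrow> 0) (at_right 0)"
    by (rule Lim_transform_eventually[OF r])
       (auto simp: exp_bump_def eventually_at_filter)
  moreover have "(exp_bump k \<longlongrightarrow> 0) (at_left 0)"
    by (rule Lim_transform_eventually[OF tendsto_const[of 0]])
       (auto simp: exp_bump_def eventually_at_filter)
  ultimately show ?thesis
    by (simp add: filterlim_split_at_real)
qed

text \<open>The powers of t in the denominator make the family closed under differentiation up to
  linear combinations. At t = 0 the difference quotient is itself \<open>exp_bump (k + 1)\<close>,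
  which tends to 0.\<close>

lemma exp_bump_DERIV: "(exp_bump k has_real_derivative exp_bump (k + 2) t - real k * exp_bump (k + 1) t) (at t)"
proof -
  consider "t > 0" | "t < 0" | "t = 0" by linarith
  then show ?thesis
  proof cases
    case 1
    have "((\<lambda>t. exp (- 1 / t) / t ^ k) has_real_derivative exp_bump (k + 2) t - real k * exp_bump (k + 1) t) (at t)"
      using 1 
      apply (auto intro!: derivative_eq_intros simp: exp_bump_def)
      apply (cases k)
      apply (auto simp: field_simps power2_eq_square)
      done
    then show ?thesis
      by (rule has_field_derivative_transform_within_open[where S = "{0<..}"])
         (use 1 in \<open>auto simp: exp_bump_def\<close>)
  next
    case 2
    have "((\<lambda>t. 0) has_real_derivative exp_bump (k + 2) t - real k * exp_bump (k + 1) t) (at t)"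
      using 2 by (simp add: exp_bump_def)
    then show ?thesis
      by (rule has_field_derivative_transform_within_open[where S = "{..<0}"])
         (use 2 in \<open>auto simp: exp_bump_def\<close>)
  next
    case 3
    have "((\<lambda>h. (exp_bump k (0 + h) - exp_bump k 0) / h) \<longlongrightarrow> 0) (at 0)"
      by (rule Lim_transform_eventually[OF exp_bump_tendsto_0[of "k+1"]])
         (auto simp: exp_bump_def eventually_at_filter)
    then show ?thesis
      using 3 by (simp add: DERIV_def exp_bump_eq_0)
  qed
qed

lemma continuous_on_exp_bump [continuous_intros]:
  assumes "continuous_on S f" shows "continuous_on S (\<lambda>x. exp_bump k (f x))"
proof -
  have "continuous_on UNIV (exp_bump k)"
    using exp_bump_DERIV DERIV_isCont continuous_at_imp_continuous_on by blast
  then show ?thesis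
    using continuous_on_compose2[OF _ assms] by blast
qed

text \<open>The derivative is carried along as an explicit function of point and direction, so that
  fields built by integrals keep a known formula for it. Continuity is asked for each fixed
  direction, which in finite dimension amounts to continuity in operator norm.\<close>

definition C1_deriv :: "('a::euclidean_space \<Rightarrow> 'b::real_normed_vector) \<Rightarrow> ('a \<Rightarrow> 'a \<Rightarrow> 'b) \<Rightarrow> bool" where
  "C1_deriv f f' \<longleftrightarrow> (\<forall>x. (f has_derivative f' x) (at x)) \<and> (\<forall>h. continuous_on UNIV (\<lambda>x. f' x h))"

lemma C1dD: assumes "C1_deriv f f'"
  shows "(f has_derivative f' x) (at x)" "continuous_on UNIV (\<lambda>x. f' x h)"
    "continuous_on UNIV f" "linear (f' x)"
proof -
  show 1: "(f has_derivative f' x) (at x)" for x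
    using assms by (auto simp: C1_deriv_def)
  show "continuous_on UNIV (\<lambda>x. f' x h)"
    using assms by (auto simp: C1_deriv_def)
  show "continuous_on UNIV f"
    using 1 by (meson continuous_at_imp_continuous_on has_derivative_continuous)
  show "linear (f' x)"
    using 1 has_derivative_linear by blast
qed

text \<open>This class contains the bump functions and is closed under partial derivatives, so smoothness of all its members follows by induction on the order.\<close>

inductive bump_algebra :: "real \<Rightarrow> ('a::euclidean_space \<Rightarrow> real) \<Rightarrow> bool" for s where
  base: "bump_algebra s (\<lambda>x. exp_bump k (s - x \<bullet> x))"
| coord: "bump_algebra s f \<Longrightarrow> bump_algebra s (\<lambda>x. (x \<bullet> v) * f x)"
| scale: "bump_algebra s f \<Longrightarrow> bump_algebra s (\<lambda>x. c * f x)"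
| add: "bump_algebra s f \<Longrightarrow> bump_algebra s g \<Longrightarrow> bump_algebra s (\<lambda>x. f x + g x)"

lemma has_derivative_exp_bump_ball:
  "((\<lambda>x. exp_bump k (s - x \<bullet> x)) has_derivative
     (\<lambda>h. (- 2 * (exp_bump (k + 2) (s - x \<bullet> x) - real k * exp_bump (k + 1) (s - x \<bullet> x))) * (x \<bullet> h))) (at x)"
proof -
  have 1: "((\<lambda>x. s - x \<bullet> x) has_derivative (\<lambda>h. - 2 * (x \<bullet> h))) (at x)"
    by (auto intro!: derivative_eq_intros simp: inner_commute)
  show ?thesis
    using has_derivative_compose[OF 1 exp_bump_DERIV[unfolded has_field_derivative_def]]
    by (rule has_derivative_eq_rhs) (simp add: fun_eq_iff algebra_simps)
qed

lemma bump_algebra_derivative: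
  assumes "bump_algebra s f"
  shows "\<exists>f'. (\<forall>x. (f has_derivative f' x) (at x)) \<and> (\<forall>h. bump_algebra s (\<lambda>x. f' x h))"
  using assms
proof induction
  case (base k)
  let ?f' = "\<lambda>x h. (- 2 * (exp_bump (k + 2) (s - x \<bullet> x) - real k * exp_bump (k + 1) (s - x \<bullet> x))) * (x \<bullet> h)"
  have "bump_algebra s (\<lambda>x. ?f' x h)" for h :: 'a
  proof -
    have "bump_algebra s (\<lambda>x. (x \<bullet> h) * ((- 2) * exp_bump (k + 2) (s - x \<bullet> x) + (2 * real k) * exp_bump (k + 1) (s - x \<bullet> x)))"
      by (intro bump_algebra.intros)
    then show ?thesis by (simp add: algebra_simps)
  qed
  then show ?case
    using has_derivative_exp_bump_ball[of k s] by (intro exI[of _ ?f']) blast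
next
  case (coord f v)
  then obtain f' where f': "\<And>x. (f has_derivative f' x) (at x)" "\<And>h. bump_algebra s (\<lambda>x. f' x h)"
    by blast
  show ?case
  proof (intro exI conjI allI)
    show "((\<lambda>x. x \<bullet> v * f x) has_derivative (\<lambda>h. x \<bullet> v * f' x h + (h \<bullet> v) * f x)) (at x)" for x
      by (rule has_derivative_mult[OF _ f'(1)]) (auto intro!: derivative_eq_intros)
    show "bump_algebra s (\<lambda>x. x \<bullet> v * f' x h + h \<bullet> v * f x)" for h
      by (intro bump_algebra.intros f' coord)
  qed
next
  case (scale f c)
  then obtain f' where f': "\<And>x. (f has_derivative f' x) (at x)" "\<And>h. bump_algebra s (\<lambda>x. f' x h)"
    by blast
  then show ?case
    by (intro exI[of _ "\<lambda>x h. c * f' x h"] conjI allI bump_algebra.intros has_derivative_mult_right) auto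
next
  case (add f g)
  then obtain f' g' where f': "\<And>x. (f has_derivative f' x) (at x)" "\<And>h. bump_algebra s (\<lambda>x. f' x h)"
    "\<And>x. (g has_derivative g' x) (at x)" "\<And>h. bump_algebra s (\<lambda>x. g' x h)"
    by blast
  then show ?case
    by (intro exI[of _ "\<lambda>x h. f' x h + g' x h"] conjI allI bump_algebra.intros has_derivative_add) auto
qed

lemma has_derivative_partial:
  "(f has_derivative f') (at x) \<Longrightarrow> partial b f x = f' b"
  by (simp add: partial_def frechet_derivative_at[symmetric])

lemma bump_algebra_Cn: "bump_algebra s f \<Longrightarrow> Cn n f"
proof (induction n arbitrary: f)
  case 0
  then obtain f' where f': "\<And>x. (f has_derivative f' x) (at x)"
    using bump_algebra_derivative by blast
  then show ?case
    by (auto intro: continuous_at_imp_continuous_on has_derivative_continuous)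
next
  case (Suc n)
  then obtain f' where f': "\<And>x. (f has_derivative f' x) (at x)" "\<And>h. bump_algebra s (\<lambda>x. f' x h)"
    using bump_algebra_derivative by blast
  have "partial b f = (\<lambda>x. f' x b)" for b
    using f'(1) has_derivative_partial by blast
  then show ?case
    using f' Suc.IH
    by (auto intro: continuous_at_imp_continuous_on has_derivative_continuous simp: differentiable_def)
qed

lemma Cn_continuous: "Cn n f \<Longrightarrow> continuous_on UNIV f"
  by (cases n) auto

text \<open>\<open>Cn\<close> controls the partial derivatives along basis vectors only; linearity
  of the Frechet derivative carries continuity over to every direction.\<close>

lemma C1_deriv_frechet:
  assumes "\<forall>x. f differentiable at x" "\<forall>b\<in>Basis. continuous_on UNIV (partial b f)"
  shows "C1_deriv f (\<lambda>x. frechet_derivative f (at x))"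
proof -
  have 1: "(f has_derivative frechet_derivative f (at x)) (at x)" for x
    using assms frechet_derivative_works by blast
  have "frechet_derivative f (at x) h = (\<Sum>b\<in>Basis. (h \<bullet> b) *\<^sub>R partial b f x)" for x h
  proof -
    interpret linear "frechet_derivative f (at x)"
      using 1 has_derivative_linear by blast
    have "frechet_derivative f (at x) (\<Sum>b\<in>Basis. (h \<bullet> b) *\<^sub>R b) = (\<Sum>b\<in>Basis. (h \<bullet> b) *\<^sub>R partial b f x)"
      by (simp add: sum scale partial_def)
    then show ?thesis by (simp add: euclidean_representation)
  qed
  then show ?thesis
    unfolding C1_deriv_def using 1 assms(2) by (auto intro!: continuous_intros)
qed

text \<open>Mollifications, averages at scale \<open>\<epsilon>\<close> and the double integral defining \<open>avg_field\<close> all have this shape, so that differentiation under the integral sign is needed only once.\<close>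

definition conv :: "'p::euclidean_space \<Rightarrow> 'p \<Rightarrow> ('p \<Rightarrow> 'a::euclidean_space) \<Rightarrow> ('p \<Rightarrow> 'b::euclidean_space)
    \<Rightarrow> ('a \<Rightarrow> real) \<Rightarrow> 'a \<Rightarrow> 'b" where
  "conv a b m c f x = integral (cbox a b) (\<lambda>p. f (x - m p) *\<^sub>R c p)"

lemma continuous_on_UNIV_compose:
  "continuous_on UNIV g \<Longrightarrow> continuous_on S f \<Longrightarrow> continuous_on S (\<lambda>x. g (f x))"
  using continuous_on_compose2 by blast

lemma conv_continuous:
  assumes "continuous_on UNIV f" "continuous_on (cbox a b) m" "continuous_on (cbox a b) c"
  shows "continuous_on UNIV (conv a b m c f)"
proof -
  have "continuous_on (UNIV \<times> cbox a b) (\<lambda>(x, p). f (x - m p) *\<^sub>R c p)"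
    unfolding case_prod_beta
    by (intro continuous_intros continuous_on_UNIV_compose[OF assms(1)]
          continuous_on_compose2[OF assms(2) continuous_on_snd[OF continuous_on_id]]
          continuous_on_compose2[OF assms(3) continuous_on_snd[OF continuous_on_id]]) auto
  then show ?thesis
    unfolding conv_def using integral_continuous_on_param[of UNIV a b "\<lambda>x p. f (x - m p) *\<^sub>R c p"]
    by simp
qed

lemma conv_C1_deriv:
  assumes f: "C1_deriv f f'" and m: "continuous_on (cbox a b) m" and c: "continuous_on (cbox a b) c"
  shows "C1_deriv (conv a b m c f) (\<lambda>x h. conv a b m c (\<lambda>x. f' x h) x)"
proof -
  note f = C1dD[OF f]
  \<comment> \<open>Differentiation under the integral sign wants the derivative as a continuous map
    into the bounded linear functions; continuity for each direction yields this
    componentwise.\<close>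
  define D where "D x p = Blinfun (\<lambda>h. f' (x - m p) h *\<^sub>R c p)" for x p
  have D: "blinfun_apply (D x p) = (\<lambda>h. f' (x - m p) h *\<^sub>R c p)" for x p
    unfolding D_def
    by (intro bounded_linear_Blinfun_apply bounded_linear_scaleR_const)
       (meson f(1) has_derivative_bounded_linear)
  have Dc: "continuous_on (UNIV \<times> cbox a b) (\<lambda>(x, p). D x p)"
    unfolding case_prod_beta
    apply (rule continuous_on_blinfun_componentwise)
    unfolding D
    by (intro continuous_intros continuous_on_UNIV_compose[OF f(2)]
          continuous_on_compose2[OF m continuous_on_snd[OF continuous_on_id]]
          continuous_on_compose2[OF c continuous_on_snd[OF continuous_on_id]]) auto
  have d: "(conv a b m c f has_derivative (\<lambda>h. conv a b m c (\<lambda>x. f' x h) x)) (at x)" for x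
  proof -
    have "((\<lambda>x. integral (cbox a b) (\<lambda>p. f (x - m p) *\<^sub>R c p)) has_derivative
        blinfun_apply (integral (cbox a b) (D x))) (at x within UNIV)"
    proof (rule leibniz_rule[OF _ _ Dc])
      show "((\<lambda>x. f (x - m t) *\<^sub>R c t) has_derivative blinfun_apply (D x t)) (at x within UNIV)" for x t
        unfolding D
        by (intro has_derivative_scaleR_left has_derivative_compose[where f="\<lambda>x. x - m t", OF _ f(1), simplified])
           (auto intro!: derivative_eq_intros)
      show "(\<lambda>p. f (x - m p) *\<^sub>R c p) integrable_on cbox a b" for x
        by (intro integrable_continuous continuous_intros continuous_on_UNIV_compose[OF f(3)] m c)
    qed auto
    moreover have "blinfun_apply (integral (cbox a b) (D x)) h = conv a b m c (\<lambda>x. f' x h) x" for h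
    proof -
      have "continuous_on (cbox a b) (D x)"
        using continuous_on_compose2[OF Dc, of "cbox a b" "\<lambda>p. (x, p)"]
        by (simp add: continuous_on_Pair image_subset_iff)
      then have "blinfun_apply (integral (cbox a b) (D x)) h = integral (cbox a b) (\<lambda>p. blinfun_apply (D x p) h)"
        by (intro blinfun_apply_integral integrable_continuous)
      then show ?thesis by (simp add: D conv_def)
    qed
    ultimately show ?thesis
      unfolding conv_def[abs_def] by (auto elim!: has_derivative_eq_rhs)
  qed
  moreover have "continuous_on UNIV (\<lambda>x. conv a b m c (\<lambda>x. f' x h) x)" for h
    using conv_continuous[OF f(2) m c] by simp
  ultimately show ?thesis by (auto simp: C1_deriv_def)
qed

text \<open>All derivatives fall on \<open>f\<close>, while \<open>m\<close> and \<open>c\<close>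
  are merely continuous. In mollification the smooth kernel takes the place of \<open>f\<close> and
  the function to be smoothed that of \<open>c\<close>.\<close>

lemma conv_Cn:
  assumes "Cn n f" and m: "continuous_on (cbox a b) m" and c: "continuous_on (cbox a b) c"
  shows "Cn n (conv a b m c f)"
  using assms(1)
proof (induction n arbitrary: f)
  case 0
  then show ?case using conv_continuous[OF _ m c] by simp
next
  case (Suc n)
  then have C: "C1_deriv f (\<lambda>x. frechet_derivative f (at x))"
    by (intro C1_deriv_frechet) (auto intro: Cn_continuous)
  note C' = conv_C1_deriv[OF C m c]
  have "partial v (conv a b m c f) = conv a b m c (partial v f)" for v
    using has_derivative_partial[OF C1dD(1)[OF C']] by (simp add: fun_eq_iff partial_def[abs_def])
  then show ?case
    using Suc C1dD[OF C'] by (auto simp: differentiable_def)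
qed

section \<open>Translation invariance and integration by parts\<close>

lemma lebesgue_distr_plus: "distr lebesgue lebesgue ((+) (t::'a::euclidean_space)) = lebesgue"
proof -
  have "(\<lambda>x::'a. t + (\<Sum>j\<in>Basis. (1 * (x \<bullet> j)) *\<^sub>R j)) = (+) t"
    by (simp add: euclidean_representation fun_eq_iff)
  then show ?thesis
    using lebesgue_affine_euclidean[of "\<lambda>_::'a. 1" t] by (simp add: density_1)
qed

lemma lebesgue_measurable_plus: "(+) (t::'a::euclidean_space) \<in> lebesgue \<rightarrow>\<^sub>M lebesgue"
proof -
  have "(\<lambda>x::'a. t + (\<Sum>j\<in>Basis. (1 * (x \<bullet> j)) *\<^sub>R j)) = (+) t"
    by (simp add: euclidean_representation fun_eq_iff)
  then show ?thesis
    using lebesgue_affine_measurable[of "\<lambda>_::'a. 1" t] by simp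
qed

lemma integral_lebesgue_translate:
  fixes f :: "'a::euclidean_space \<Rightarrow> 'b::{banach, second_countable_topology}"
  assumes "f \<in> borel_measurable lebesgue"
  shows "(LINT x|lebesgue. f (t + x)) = (LINT x|lebesgue. f x)"
  using integral_distr[OF lebesgue_measurable_plus assms, of t] by (simp add: lebesgue_distr_plus)

lemma integrable_lebesgue_translate:
  fixes f :: "'a::euclidean_space \<Rightarrow> 'b::{banach, second_countable_topology}"
  assumes "integrable lebesgue f"
  shows "integrable lebesgue (\<lambda>x. f (t + x))"
  using assms integrable_distr_eq[OF lebesgue_measurable_plus, of f t]
  by (auto simp: lebesgue_distr_plus)

lemma continuous_borel_measurable_lebesgue:
  "continuous_on UNIV f \<Longrightarrow> f \<in> borel_measurable lebesgue"
  using measurable_completion[of f lborel borel] borel_measurable_continuous_onI[of f] by simp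

lemma integrable_continuous_compact:
  fixes f :: "'a::euclidean_space \<Rightarrow> 'b::euclidean_space"
  assumes "continuous_on UNIV f" "\<And>x. norm x > R \<Longrightarrow> f x = 0"
  shows "integrable lebesgue f"
proof -
  have "integrable lborel (\<lambda>x. indicator (cball 0 R) x *\<^sub>R f x)"
    by (rule borel_integrable_compact) (auto intro: continuous_on_subset[OF assms(1)])
  also have "(\<lambda>x. indicator (cball 0 R) x *\<^sub>R f x) = f"
    using assms(2) by (force simp: indicator_def)
  finally show ?thesis
    by (simp add: integrable_completion assms borel_measurable_continuous_onI)
qed

section \<open>Difference quotients under the integral sign\<close>

lemma C1_deriv_bounded_dir:
  fixes u :: "'a::euclidean_space \<Rightarrow> real"
  assumes "C1_deriv u u'"
  obtains B where "\<And>x. norm x \<le> R \<Longrightarrow> \<bar>u' x v\<bar> \<le> B" "B \<ge> 0"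
proof -
  have "compact ((\<lambda>x. u' x v) ` cball 0 R)"
    using C1dD(2)[OF assms] by (intro compact_continuous_image) (auto intro: continuous_on_subset)
  then obtain B where "\<forall>y\<in>(\<lambda>x. u' x v) ` cball 0 R. norm y \<le> B"
    using compact_imp_bounded bounded_iff by blast
  then show thesis
    by (intro that[of "max 0 B"]) (auto simp: max_def)
qed

lemma C1_deriv_diff_bound:
  fixes u :: "'a::euclidean_space \<Rightarrow> real"
  assumes u: "C1_deriv u u'" and B: "\<And>t. 0 \<le> t \<Longrightarrow> t \<le> s \<Longrightarrow> \<bar>u' (x + t *\<^sub>R v) v\<bar> \<le> B" and s: "s > 0"
  shows "\<bar>u (x + s *\<^sub>R v) - u x\<bar> \<le> B * s"
proof -
  have "((\<lambda>t. u (x + t *\<^sub>R v)) has_real_derivative u' (x + t *\<^sub>R v) v) (at t)" for t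
  proof -
    have "((\<lambda>t. x + t *\<^sub>R v) has_derivative (\<lambda>h. h *\<^sub>R v)) (at t)"
      by (auto intro!: derivative_eq_intros)
    from has_derivative_compose[OF this C1dD(1)[OF u]]
    show ?thesis
      using linear_scale[OF C1dD(4)[OF u]]
      by (simp add: has_field_derivative_def) (erule has_derivative_eq_rhs, simp add: fun_eq_iff mult.commute)
  qed
  then obtain z where "z > 0" "z < s" "u (x + s *\<^sub>R v) - u (x + 0 *\<^sub>R v) = (s - 0) * u' (x + z *\<^sub>R v) v"
    using MVT2[OF s, of "\<lambda>t. u (x + t *\<^sub>R v)" "\<lambda>t. u' (x + t *\<^sub>R v) v"] by blast
  then show ?thesis
    using B[of z] s by (simp add: abs_mult mult.commute)
qed

lemma difference_quotient_tendsto: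
  assumes "(u has_derivative u') (at x)" "linear u'"
  shows "(\<lambda>n. (u (x + (1 / real (Suc n)) *\<^sub>R v) - u x) / (1 / real (Suc n))) \<longlonglongrightarrow> (u' v :: real)"
proof -
  have "((\<lambda>t. x + t *\<^sub>R v) has_derivative (\<lambda>h. h *\<^sub>R v)) (at 0)"
    by (auto intro!: derivative_eq_intros)
  from has_derivative_compose[OF this, of u u'] assms(1)
  have "((\<lambda>t. u (x + t *\<^sub>R v)) has_real_derivative u' v) (at 0)"
    using linear_scale[OF assms(2)]
    by (simp add: has_field_derivative_def) (erule has_derivative_eq_rhs, simp add: fun_eq_iff mult.commute)
  then have "((\<lambda>h. (u (x + h *\<^sub>R v) - u x) / h) \<longlongrightarrow> u' v) (at 0)"
    by (simp add: DERIV_def)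
  moreover have "filterlim (\<lambda>n. 1 / real (Suc n)) (at 0) sequentially"
    using LIMSEQ_inverse_real_of_nat
    by (auto simp: filterlim_at inverse_eq_divide)
  ultimately show ?thesis
    by (rule filterlim_compose)
qed

text \<open>Dominated convergence: on the ball the quotients are bounded by the maximum of the
  derivative on a slightly larger ball. \<open>G\<close> is only integrable there, so that rough
  ridge functions are admissible later, and the support condition is put on the product because
  sometimes \<open>u\<close> and sometimes \<open>G\<close> has the compact support.\<close>

lemma difference_quotient_integral:
  fixes u G :: "'a::euclidean_space \<Rightarrow> real"
  assumes u: "C1_deriv u u'" and G: "G \<in> borel_measurable lebesgue"
    and Gi: "integrable lebesgue (\<lambda>x. indicator (cball 0 R) x * G x)"
    and supp: "\<And>x s. 0 \<le> s \<Longrightarrow> s \<le> 1 \<Longrightarrow> norm x > R \<Longrightarrow> (u (x + s *\<^sub>R v) - u x) * G x = 0"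
  shows "(\<lambda>n. LINT x|lebesgue. (u (x + (1 / real (Suc n)) *\<^sub>R v) - u x) / (1 / real (Suc n)) * G x)
           \<longlonglongrightarrow> (LINT x|lebesgue. u' x v * G x)"
proof -
  obtain B where B: "\<And>x. norm x \<le> R + norm v \<Longrightarrow> \<bar>u' x v\<bar> \<le> B" "B \<ge> 0"
    using C1_deriv_bounded_dir[OF u] by metis
  have [measurable]: "u \<in> borel_measurable lebesgue" "(\<lambda>x. u' x v) \<in> borel_measurable lebesgue"
    using C1dD[OF u] continuous_borel_measurable_lebesgue by auto
  have [measurable]: "(\<lambda>x. u (x + c)) \<in> borel_measurable lebesgue" for c
    by (intro continuous_borel_measurable_lebesgue continuous_on_UNIV_compose[OF C1dD(3)[OF u]] continuous_intros)
  note G[measurable]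
  show ?thesis
  proof (rule integral_dominated_convergence[where w="\<lambda>x. B * \<bar>indicator (cball 0 R) x * G x\<bar>"])
    show "integrable lebesgue (\<lambda>x. B * \<bar>indicator (cball 0 R) x * G x\<bar>)"
      using Gi by (intro integrable_mult_right integrable_abs)
    show "AE x in lebesgue. (\<lambda>n. (u (x + (1 / real (Suc n)) *\<^sub>R v) - u x) / (1 / real (Suc n)) * G x)
           \<longlonglongrightarrow> u' x v * G x"
      using difference_quotient_tendsto[OF C1dD(1)[OF u] C1dD(4)[OF u]]
      by (intro AE_I2 tendsto_mult tendsto_const) 
    show "AE x in lebesgue. norm ((u (x + (1 / real (Suc n)) *\<^sub>R v) - u x) / (1 / real (Suc n)) * G x)
            \<le> B * \<bar>indicator (cball 0 R) x * G x\<bar>" for n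
    proof (rule AE_I2)
      fix x :: 'a
      define s where "s = 1 / real (Suc n)"
      have s: "s > 0" "s \<le> 1" by (auto simp: s_def)
      show "norm ((u (x + (1 / real (Suc n)) *\<^sub>R v) - u x) / (1 / real (Suc n)) * G x)
            \<le> B * \<bar>indicator (cball 0 R) x * G x\<bar>"
        unfolding s_def[symmetric]
      proof (cases "norm x \<le> R")
        case True
        have "\<bar>u (x + s *\<^sub>R v) - u x\<bar> \<le> B * s"
        proof (rule C1_deriv_diff_bound[OF u _ s(1)])
          fix t assume "0 \<le> t" "t \<le> s"
          then have "norm (t *\<^sub>R v) \<le> norm v" using s by (simp add: mult_left_le_one_le)
          then show "\<bar>u' (x + t *\<^sub>R v) v\<bar> \<le> B"
            using True by (intro B) (metis add_mono_thms_linordered_semiring(1) norm_triangle_le)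
        qed
        then have "\<bar>u (x + s *\<^sub>R v) - u x\<bar> / s \<le> B"
          using s by (simp add: divide_le_eq)
        from mult_right_mono[OF this, of "\<bar>G x\<bar>"] s True
        show "norm ((u (x + s *\<^sub>R v) - u x) / s * G x) \<le> B * \<bar>indicator (cball 0 R) x * G x\<bar>"
          by (simp add: abs_mult)
      next
        case False
        then show "norm ((u (x + s *\<^sub>R v) - u x) / s * G x) \<le> B * \<bar>indicator (cball 0 R) x * G x\<bar>"
          using supp[of s x] s by (auto simp: B)
      qed
    qed
  qed measurable
qed

lemma C1_deriv_zero_outside:
  assumes "C1_deriv u u'" "\<And>x. norm x > R \<Longrightarrow> u x = 0" "norm x > R"
  shows "u' x v = 0"
proof -
  have "((\<lambda>x. 0) has_derivative u' x) (at x)"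
    by (rule has_derivative_transform_within_open[OF C1dD(1)[OF assms(1)], of "- cball 0 R"])
       (use assms in auto)
  then have "u' x = (\<lambda>h. 0)"
    using has_derivative_const has_derivative_unique by blast
  then show ?thesis by simp
qed

text \<open>By translation invariance every difference quotient has integral zero. The radius is
  enlarged by \<open>norm v\<close> so that shifts by at most \<open>v\<close> keep the support
  inside.\<close>

lemma integral_partial_eq_0:
  fixes u :: "'a::euclidean_space \<Rightarrow> real"
  assumes u: "C1_deriv u u'" and supp: "\<And>x. norm x > R \<Longrightarrow> u x = 0"
  shows "(LINT x|lebesgue. u' x v) = 0"
proof -
  have i: "integrable lebesgue u"
    using C1dD(3)[OF u] supp integrable_continuous_compact by blast
  have "(\<lambda>n. LINT x|lebesgue. (u (x + (1 / real (Suc n)) *\<^sub>R v) - u x) / (1 / real (Suc n)) * 1)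
           \<longlonglongrightarrow> (LINT x|lebesgue. u' x v * 1)"
  proof (rule difference_quotient_integral[OF u, of _ "R + norm v"])
    show "integrable lebesgue (\<lambda>x::'a. indicator (cball 0 (R + norm v)) x * (1::real))"
      using lmeasurable_cball[of "0::'a" "R + norm v"] by (simp add: lmeasurable_iff_integrable)
    fix x :: 'a and s :: real
    assume s: "0 \<le> s" "s \<le> 1" and x: "norm x > R + norm v"
    have "norm (s *\<^sub>R v) \<le> norm v" using s by (simp add: mult_left_le_one_le)
    then have "norm (x + s *\<^sub>R v) > R"
      using x norm_triangle_ineq4[of "x + s *\<^sub>R v" "s *\<^sub>R v"] by simp
    moreover have "norm x > R" using x norm_ge_zero[of v] by linarith
    ultimately show "(u (x + s *\<^sub>R v) - u x) * 1 = 0" using supp by simp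
  qed simp
  moreover have "(LINT x|lebesgue. (u (x + s *\<^sub>R v) - u x) / s * 1) = 0" for s
    using integral_lebesgue_translate[of u "s *\<^sub>R v"] i integrable_lebesgue_translate[OF i, of "s *\<^sub>R v"]
    by (simp add: add.commute borel_measurable_integrable)
  ultimately have "(\<lambda>n::nat. 0) \<longlonglongrightarrow> (LINT x|lebesgue. u' x v)"
    by (simp only: mult_1_right)
  then show ?thesis
    by (simp add: LIMSEQ_const_iff)
qed

lemma C1_deriv_mult:
  fixes f g :: "'a::euclidean_space \<Rightarrow> real"
  assumes "C1_deriv f f'" "C1_deriv g g'"
  shows "C1_deriv (\<lambda>x. f x * g x) (\<lambda>x h. f x * g' x h + f' x h * g x)"
  unfolding C1_deriv_def
  using C1dD[OF assms(1)] C1dD[OF assms(2)]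
  by (auto intro!: continuous_intros has_derivative_mult)

text \<open>Difference quotients in place of one of the derivatives make second derivatives unnecessary.\<close>

lemma integral_swap_partials:
  fixes a b :: "'a::euclidean_space \<Rightarrow> real"
  assumes a: "C1_deriv a a'" and b: "C1_deriv b b'" and supp: "\<And>x. norm x > R \<Longrightarrow> b x = 0"
  shows "(LINT x|lebesgue. a' x v * b' x w) = (LINT x|lebesgue. a' x w * b' x v)"
proof -
  define s where "s n = 1 / real (Suc n)" for n
  have s0: "s n > 0" "s n \<le> 1" for n by (auto simp: s_def)
  note ca = C1dD[OF a] and cb = C1dD[OF b]
  have b'0: "b' x h = 0" if "norm x > R" for x h
    using C1_deriv_zero_outside[OF b supp that] by blast
  have m [measurable]: "(\<lambda>x. b' x h) \<in> borel_measurable lebesgue" "(\<lambda>x. a' x h) \<in> borel_measurable lebesgue" for h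
    using ca(2) cb(2) continuous_borel_measurable_lebesgue by auto
  have ca2: "continuous_on UNIV (\<lambda>x. a' (x + c) h)" for c h
    by (rule continuous_on_UNIV_compose[OF ca(2)]) (intro continuous_intros)
  have cb3: "continuous_on UNIV (\<lambda>x. b (x - c))" for c
    by (rule continuous_on_UNIV_compose[OF cb(3)]) (intro continuous_intros)
  have li: "integrable lebesgue (\<lambda>x. indicator (cball 0 r) x * g x)" if "continuous_on UNIV g" for g :: "'a \<Rightarrow> real" and r
  proof -
    have "integrable lborel (\<lambda>x. indicator (cball 0 r) x *\<^sub>R g x)"
      by (rule borel_integrable_compact) (auto intro: continuous_on_subset[OF that])
    then show ?thesis
      by (subst integrable_completion) (use that in \<open>auto intro!: borel_measurable_times borel_measurable_continuous_onI\<close>)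
  qed
  have 1: "(\<lambda>n. LINT x|lebesgue. (a (x + s n *\<^sub>R v) - a x) / s n * b' x w) \<longlonglongrightarrow> (LINT x|lebesgue. a' x v * b' x w)"
    unfolding s_def
    by (rule difference_quotient_integral[OF a _ li[OF cb(2)], where R=R]) (simp_all add: b'0)
  have 2: "(\<lambda>n. LINT x|lebesgue. (b (x + s n *\<^sub>R (-v)) - b x) / s n * a' x w) \<longlonglongrightarrow> (LINT x|lebesgue. b' x (-v) * a' x w)"
    unfolding s_def
  proof (rule difference_quotient_integral[OF b _ li[OF ca(2)], where R="R + norm v"])
    fix x :: 'a and s :: real
    assume s: "0 \<le> s" "s \<le> 1" and x: "norm x > R + norm v"
    have "norm (s *\<^sub>R v) \<le> norm v" using s by (simp add: mult_left_le_one_le)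
    then have "norm (x + s *\<^sub>R (- v)) > R"
      using x norm_triangle_ineq[of "x + s *\<^sub>R (-v)" "s *\<^sub>R v"] by simp
    moreover have "norm x > R" using x norm_ge_zero[of v] by linarith
    ultimately show "(b (x + s *\<^sub>R (-v)) - b x) * a' x w = 0" using supp by simp
  qed measurable
  \<comment> \<open>Discrete integration by parts: the product of the difference quotient of
    \<open>a\<close> with \<open>b\<close> has derivative of integral zero, and a translation then
    moves the shift from \<open>a\<close> to \<open>b\<close>.\<close>
  have 3: "(LINT x|lebesgue. (a (x + s n *\<^sub>R v) - a x) / s n * b' x w)
      = - (LINT x|lebesgue. (b (x + s n *\<^sub>R (-v)) - b x) / s n * a' x w)" for n
  proof -
    define D where "D x = (a (x + s n *\<^sub>R v) - a x) / s n" for x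
    define D' where "D' x h = (a' (x + s n *\<^sub>R v) h - a' x h) / s n" for x h
    have "C1_deriv D D'"
      unfolding C1_deriv_def D_def D'_def
    proof (intro conjI allI)
      show "((\<lambda>x. (a (x + s n *\<^sub>R v) - a x) / s n) has_derivative
          (\<lambda>h. (a' (x + s n *\<^sub>R v) h - a' x h) / s n)) (at x)" for x
      proof -
        have "((\<lambda>x. a (x + s n *\<^sub>R v)) has_derivative (\<lambda>h. a' (x + s n *\<^sub>R v) h)) (at x)"
          by (rule has_derivative_compose[where f="\<lambda>x. x + s n *\<^sub>R v" and f'="\<lambda>h. h", OF _ ca(1)])
             (auto intro!: derivative_eq_intros)
        from bounded_linear.has_derivative[OF bounded_linear_divide has_derivative_diff[OF this ca(1)]]
        show ?thesis .
      qed
      show "continuous_on UNIV (\<lambda>x. (a' (x + s n *\<^sub>R v) h - a' x h) / s n)" for h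
        using s0(1)[of n] by (intro continuous_intros ca(2) ca2) simp
    qed
    note Db = C1_deriv_mult[OF this b]
    have "(LINT x|lebesgue. D x * b' x w + D' x w * b x) = 0"
      by (rule integral_partial_eq_0[OF Db]) (use supp in auto)
    moreover have "integrable lebesgue (\<lambda>x. D x * b' x w)" "integrable lebesgue (\<lambda>x. D' x w * b x)"
      by (rule integrable_continuous_compact[of _ R];
          use C1dD[OF \<open>C1_deriv D D'\<close>] cb b'0 supp in \<open>simp add: continuous_on_mult\<close>)+
    ultimately have "(LINT x|lebesgue. D x * b' x w) = - (LINT x|lebesgue. D' x w * b x)"
      by simp
    also have "(LINT x|lebesgue. D' x w * b x) = (LINT x|lebesgue. a' (x + s n *\<^sub>R v) w * b x / s n) - (LINT x|lebesgue. a' x w * b x / s n)"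
    proof (subst Bochner_Integration.integral_diff[symmetric])
      show "integrable lebesgue (\<lambda>x. a' (x + s n *\<^sub>R v) w * b x / s n)" "integrable lebesgue (\<lambda>x. a' x w * b x / s n)"
        using s0(1)[of n] supp
        by (auto intro!: integrable_continuous_compact[of _ R] continuous_on_divide continuous_on_mult ca(2) cb(3) ca2)
      show "(LINT x|lebesgue. D' x w * b x) = (LINT x|lebesgue. a' (x + s n *\<^sub>R v) w * b x / s n - a' x w * b x / s n)"
        by (simp add: D'_def diff_divide_distrib left_diff_distrib)
    qed
    also have "(LINT x|lebesgue. a' (x + s n *\<^sub>R v) w * b x / s n) = (LINT x|lebesgue. a' x w * b (x - s n *\<^sub>R v) / s n)"
    proof -
      have "(LINT x|lebesgue. a' (s n *\<^sub>R v + x) w * b (s n *\<^sub>R v + x - s n *\<^sub>R v) / s n)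
         = (LINT x|lebesgue. a' x w * b (x - s n *\<^sub>R v) / s n)"
        by (rule integral_lebesgue_translate[of "\<lambda>x. a' x w * b (x - s n *\<^sub>R v) / s n"])
           (use s0(1)[of n] in \<open>auto intro!: continuous_borel_measurable_lebesgue continuous_on_divide continuous_on_mult ca(2) cb3\<close>)
      then show ?thesis by (simp add: add.commute)
    qed
    also have "\<dots> - (LINT x|lebesgue. a' x w * b x / s n) = (LINT x|lebesgue. (b (x + s n *\<^sub>R (-v)) - b x) / s n * a' x w)"
    proof (subst Bochner_Integration.integral_diff[symmetric])
      show "integrable lebesgue (\<lambda>x. a' x w * b x / s n)"
        using s0(1)[of n] supp by (auto intro!: integrable_continuous_compact[of _ R] continuous_on_divide continuous_on_mult ca(2) cb(3))
      have z: "b (x - s n *\<^sub>R v) = 0" if x: "norm x > R + norm v" for x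
      proof -
        have "norm (s n *\<^sub>R v) \<le> norm v" using s0[of n] by (simp add: mult_left_le_one_le)
        then have "norm (x - s n *\<^sub>R v) > R"
          using x norm_triangle_ineq[of "x - s n *\<^sub>R v" "s n *\<^sub>R v"] by simp
        then show ?thesis using supp by simp
      qed
      show "integrable lebesgue (\<lambda>x. a' x w * b (x - s n *\<^sub>R v) / s n)"
        using s0(1)[of n] z
        by (auto intro!: integrable_continuous_compact[of _ "R + norm v"] continuous_on_divide continuous_on_mult ca(2) cb3)
      show "(LINT x|lebesgue. a' x w * b (x - s n *\<^sub>R v) / s n - a' x w * b x / s n)
        = (LINT x|lebesgue. (b (x + s n *\<^sub>R (-v)) - b x) / s n * a' x w)"
        by (simp add: diff_divide_distrib algebra_simps)
    qed
    finally show ?thesis by (simp add: D_def)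
  qed
  from 1 have "(\<lambda>n. - (LINT x|lebesgue. (b (x + s n *\<^sub>R (-v)) - b x) / s n * a' x w)) \<longlonglongrightarrow> (LINT x|lebesgue. a' x v * b' x w)"
    by (simp only: 3)
  from LIMSEQ_unique[OF this tendsto_minus[OF 2]]
  have "(LINT x|lebesgue. a' x v * b' x w) = - (LINT x|lebesgue. b' x (-v) * a' x w)" .
  then show ?thesis
    using linear_neg[OF cb(4)] by (simp add: mult.commute)
qed

section \<open>A curl-free field with prescribed divergence\<close>

lemma inner_vec_eq_0_outside_cbox:
  fixes x :: "'a::euclidean_space"
  assumes "x \<notin> cbox (- One) One"
  shows "x \<bullet> x > 1"
proof -
  obtain b where b: "b \<in> Basis" "x \<bullet> b < -1 \<or> x \<bullet> b > 1"
    using assms by (auto simp: mem_box not_le)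
  then have "1 < \<bar>x \<bullet> b\<bar>" by auto
  also have "\<dots> \<le> norm x" using b(1) by (rule Basis_le_norm)
  finally show ?thesis by (simp add: dot_square_norm)
qed

lemma integral_cbox_eq_lebesgue:
  fixes g :: "'a::euclidean_space \<Rightarrow> 'b::euclidean_space"
  assumes "continuous_on UNIV g" "\<And>x. x \<notin> cbox a b \<Longrightarrow> g x = 0"
  shows "integral (cbox a b) g = (LINT x|lebesgue. g x)"
proof -
  obtain R where R: "\<And>x. x \<in> cbox a b \<Longrightarrow> norm x \<le> R"
    using bounded_cbox[of a b] unfolding bounded_iff by blast
  have "integrable lebesgue g"
    using assms R by (intro integrable_continuous_compact[of g R]) (meson not_le)+
  moreover have "(\<lambda>x. indicator (cbox a b) x *\<^sub>R g x) = g"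
    using assms(2) by (auto simp: indicator_def fun_eq_iff)
  ultimately show ?thesis
    using set_lebesgue_integral_eq_integral(2)[of "cbox a b" g]
    by (simp add: set_integrable_def set_lebesgue_integral_def)
qed

section \<open>The averaging kernel and its potential\<close>

definition bump_mass :: "'a::euclidean_space itself \<Rightarrow> real" where
  "bump_mass _ = (LINT y|lebesgue. exp_bump 2 (1 - (y::'a) \<bullet> y))"

text \<open>Index 2 is chosen because the derivative of \<open>exp_bump 0\<close> is exactly
  \<open>exp_bump 2\<close>; this makes \<open>eta y *\<^sub>R y\<close> a gradient.\<close>

definition eta :: "'a::euclidean_space \<Rightarrow> real" where
  "eta y = exp_bump 2 (1 - y \<bullet> y) / bump_mass TYPE('a)"

lemma exp_bump_ball_outside: "norm y \<ge> 1 \<Longrightarrow> exp_bump k (1 - y \<bullet> y) = 0"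
  by (rule exp_bump_eq_0) (simp add: dot_square_norm)

lemma continuous_exp_bump_ball: "continuous_on S (\<lambda>y. exp_bump k (s - y \<bullet> y))"
  by (intro continuous_intros)

lemma integrable_continuous_nonneg_pos:
  fixes f :: "'a::euclidean_space \<Rightarrow> real"
  assumes "continuous_on UNIV f" "integrable lebesgue f" "\<And>x. f x \<ge> 0" "f x0 > 0"
  shows "(LINT x|lebesgue. f x) > 0"
proof -
  have "(LINT x|lebesgue. f x) \<noteq> 0"
  proof
    assume "(LINT x|lebesgue. f x) = 0"
    then have "AE x in lebesgue. f x = 0"
      using integral_nonneg_eq_0_iff_AE[OF assms(2)] assms(3) by simp
    then have n: "negligible {x. f x \<noteq> 0}"
      by (simp add: negligible_iff_null_sets eventually_ae_filter_negligible AE_iff_null_sets)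
         (metis (mono_tags, lifting) negligible_subset negligible_iff_null_sets)
    have "open {x. f x \<noteq> 0}"
      using assms(1) by (simp add: open_Collect_neq)
    then show False
      using n open_not_negligible[of "{x. f x \<noteq> 0}"] assms(4) by force
  qed
  moreover have "(LINT x|lebesgue. f x) \<ge> 0" using assms by simp
  ultimately show ?thesis by simp
qed

lemma bump_mass_pos: "bump_mass TYPE('a::euclidean_space) > 0"
  unfolding bump_mass_def
proof (rule integrable_continuous_nonneg_pos[where ?x0.0 = 0])
  show "integrable lebesgue (\<lambda>y::'a. exp_bump 2 (1 - y \<bullet> y))"
    by (rule integrable_continuous_compact[where R=1]) (auto intro: continuous_exp_bump_ball exp_bump_ball_outside)
qed (auto intro: continuous_exp_bump_ball exp_bump_nonneg exp_bump_pos)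

lemma eta_nonneg: "eta (y::'a::euclidean_space) \<ge> 0"
  using bump_mass_pos[where 'a='a] by (simp add: eta_def exp_bump_nonneg less_imp_le)

lemma eta_outside: "norm y \<ge> 1 \<Longrightarrow> eta y = 0"
  by (simp add: eta_def exp_bump_ball_outside)

lemma eta_outside_cbox: "y \<notin> cbox (- One) One \<Longrightarrow> eta y = 0"
  using inner_vec_eq_0_outside_cbox[of y] by (simp add: eta_def exp_bump_eq_0)

lemma continuous_eta [continuous_intros]:
  "continuous_on S f \<Longrightarrow> continuous_on S (\<lambda>x. eta (f x :: 'a::euclidean_space))"
  using bump_mass_pos[where 'a='a] unfolding eta_def by (intro continuous_intros) auto

lemma integral_eta: "(LINT y|lebesgue. eta (y::'a::euclidean_space)) = 1"
  using bump_mass_pos[where 'a='a] by (simp add: eta_def bump_mass_def)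

lemma integral_eta_cbox: "integral (cbox (- One) One) (eta :: 'a::euclidean_space \<Rightarrow> real) = 1"
  using integral_cbox_eq_lebesgue[of "eta :: 'a \<Rightarrow> real", OF _ eta_outside_cbox] integral_eta[where 'a='a]
  by (simp add: continuous_eta)

text \<open>The gradient of this function is \<open>eta y *\<^sub>R y\<close>; this is what makes \<open>avg_field\<close> curl-free.\<close>

definition eta_potential :: "'a::euclidean_space \<Rightarrow> real" where
  "eta_potential y = - (exp_bump 0 (1 - y \<bullet> y) / (2 * bump_mass TYPE('a)))"

lemma eta_potential_C1_deriv: "C1_deriv eta_potential (\<lambda>y h. (y \<bullet> h) * eta (y::'a::euclidean_space))"
  unfolding C1_deriv_def
proof (intro conjI allI)
  fix y :: 'a
  have "((\<lambda>y. - (exp_bump 0 (1 - y \<bullet> y) / (2 * bump_mass TYPE('a)))) has_derivative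
     (\<lambda>h. - ((- 2 * (exp_bump (0 + 2) (1 - y \<bullet> y) - real 0 * exp_bump (0 + 1) (1 - y \<bullet> y))) * (y \<bullet> h) / (2 * bump_mass TYPE('a))))) (at y)"
    by (intro has_derivative_minus bounded_linear.has_derivative[OF bounded_linear_divide] has_derivative_exp_bump_ball)
  then show "(eta_potential has_derivative (\<lambda>h. (y \<bullet> h) * eta y)) (at y)"
    unfolding eta_potential_def[abs_def]
    by (rule has_derivative_eq_rhs) (simp add: fun_eq_iff eta_def numeral_2_eq_2)
qed (intro continuous_intros)

lemma conv_eq_0: "(\<And>p. p \<in> cbox a b \<Longrightarrow> c p = 0 \<or> f (x - m p) = 0) \<Longrightarrow> conv a b m c f x = 0"
  unfolding conv_def by (subst integral_cong[where g="\<lambda>_. 0"]) auto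

lemma C1_deriv_component:
  fixes \<phi> :: "real^'d \<Rightarrow> real^'d"
  assumes "C1_deriv \<phi> \<phi>'"
  shows "C1_deriv (\<lambda>x. \<phi> x $ i) (\<lambda>x h. \<phi>' x h $ i)"
  using assms unfolding C1_deriv_def
  by (auto intro!: continuous_intros bounded_linear.has_derivative[OF bounded_linear_vec_nth])

definition ball_avg :: "real \<Rightarrow> (real^'d \<Rightarrow> real) \<Rightarrow> real^'d \<Rightarrow> real" where
  "ball_avg \<epsilon> f = conv (- One) One (\<lambda>y. \<epsilon> *\<^sub>R y) eta f"

text \<open>\<open>avg_field \<epsilon> f x\<close> is minus the integral of \<open>f (x - t *\<^sub>R y) * eta y\<close> times \<open>y\<close> over \<open>t \<in> [0, \<epsilon>]\<close> and \<open>y\<close> in the unit ball. Its divergence integrates the derivative in \<open>t\<close> of the averages of \<open>f\<close> at scale \<open>t\<close>, and is therefore \<open>ball_avg \<epsilon> f - f\<close>.\<close>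

definition avg_field :: "real \<Rightarrow> (real^'d \<Rightarrow> real) \<Rightarrow> real^'d \<Rightarrow> real^'d" where
  "avg_field \<epsilon> f = conv (0, - One) (\<epsilon>, One) (\<lambda>(t, y). t *\<^sub>R y) (\<lambda>(t, y). - (eta y *\<^sub>R y)) f"

definition avg_field_deriv :: "real \<Rightarrow> (real^'d \<Rightarrow> real^'d \<Rightarrow> real) \<Rightarrow> real^'d \<Rightarrow> real^'d \<Rightarrow> real^'d" where
  "avg_field_deriv \<epsilon> f' x h = avg_field \<epsilon> (\<lambda>x. f' x h) x"

lemma avg_field_cont:
  "continuous_on S (\<lambda>(t, y::real^'d). t *\<^sub>R y)" "continuous_on S (\<lambda>(t::real, y::real^'d). - (eta y *\<^sub>R y))"
  unfolding case_prod_beta by (intro continuous_intros)+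

lemma avg_field_C1_deriv: "C1_deriv f f' \<Longrightarrow> C1_deriv (avg_field \<epsilon> f) (avg_field_deriv \<epsilon> f')"
  unfolding avg_field_def avg_field_deriv_def by (rule conv_C1_deriv) (auto intro: avg_field_cont)

lemma avg_field_nth:
  fixes g :: "real^'d \<Rightarrow> real"
  assumes "continuous_on UNIV g"
  shows "avg_field \<epsilon> g x $ i = integral (cbox (0, - One) (\<epsilon>, One)) (\<lambda>(t, y). - (g (x - t *\<^sub>R y) * (eta y * y $ i)))"
proof -
  have "avg_field \<epsilon> g x $ i = integral (cbox (0, - One) (\<epsilon>, One)) (\<lambda>p. ((\<lambda>(t, y::real^'d). g (x - t *\<^sub>R y) *\<^sub>R - (eta y *\<^sub>R y)) p) $ i)"
    unfolding avg_field_def conv_def case_prod_beta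
    by (subst integral_component_eq_cart[symmetric])
       (intro integrable_continuous continuous_intros continuous_on_UNIV_compose[OF assms], simp)
  also have "\<dots> = integral (cbox (0, - One) (\<epsilon>, One)) (\<lambda>(t, y). - (g (x - t *\<^sub>R y) * (eta y * y $ i)))"
    by (rule integral_cong) auto
  finally show ?thesis .
qed

text \<open>For fixed t \<noteq> 0 this is an exchange of two partial derivatives in y, between the
  function \<open>f (x - t *\<^sub>R y)\<close> and \<open>eta_potential\<close>. The chain rule
  puts the same factor t on both sides, where it cancels; the single value t = 0 does not affect the
  outer integral.\<close>

lemma avg_field_curl:
  fixes f :: "real^'d \<Rightarrow> real"
  assumes f: "C1_deriv f f'" and e: "\<epsilon> > 0"
  shows "avg_field_deriv \<epsilon> f' x (axis j 1) $ i = avg_field_deriv \<epsilon> f' x (axis i 1) $ j"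
proof -
  note cf = C1dD[OF f]
  have cont: "continuous_on S (\<lambda>(t, y). - (f' (x - t *\<^sub>R y) (axis j 1) * (eta y * y $ i)))" for S i j
    unfolding case_prod_beta
    by (intro continuous_intros continuous_on_UNIV_compose[OF cf(2)])
  have 1: "avg_field_deriv \<epsilon> f' x (axis j 1) $ i =
      integral (cbox 0 \<epsilon>) (\<lambda>t. integral (cbox (- One) One) (\<lambda>y. - (f' (x - t *\<^sub>R y) (axis j 1) * (eta y * y $ i))))" for i j
    unfolding avg_field_deriv_def avg_field_nth[OF cf(2)]
    by (subst integral_prod_continuous[OF cont]) simp
  have 2: "integral (cbox (- One) One) (\<lambda>y. - (f' (x - t *\<^sub>R y) (axis j 1) * (eta y * y $ i)))
     = integral (cbox (- One) One) (\<lambda>y. - (f' (x - t *\<^sub>R y) (axis i 1) * (eta y * y $ j)))" if t: "t \<noteq> 0" for t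
  proof -
    have eq: "integral (cbox (- One) One) (\<lambda>y. - (f' (x - t *\<^sub>R y) (axis j 1) * (eta y * y $ i)))
       = (LINT y|lebesgue. - (f' (x - t *\<^sub>R y) (axis j 1) * (eta y * y $ i)))" for i j
      by (rule integral_cbox_eq_lebesgue)
         (auto simp: eta_outside_cbox intro!: continuous_intros continuous_on_UNIV_compose[OF cf(2)])
    have a: "C1_deriv (\<lambda>y. f (x - t *\<^sub>R y)) (\<lambda>y h. - t * f' (x - t *\<^sub>R y) h)"
      unfolding C1_deriv_def
    proof (intro conjI allI)
      fix y :: "real^'d"
      have "((\<lambda>y. x - t *\<^sub>R y) has_derivative (\<lambda>h. - (t *\<^sub>R h))) (at y)"
        by (auto intro!: derivative_eq_intros)
      from has_derivative_compose[OF this cf(1)]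
      show "((\<lambda>y. f (x - t *\<^sub>R y)) has_derivative (\<lambda>h. - t * f' (x - t *\<^sub>R y) h)) (at y)"
        by (rule has_derivative_eq_rhs) (simp add: linear_neg[OF cf(4)] linear_scale[OF cf(4)])
    qed (intro continuous_intros continuous_on_UNIV_compose[OF cf(2)])
    have "(LINT y|lebesgue. (- t * f' (x - t *\<^sub>R y) (axis j 1)) * ((y \<bullet> axis i 1) * eta y))
        = (LINT y|lebesgue. (- t * f' (x - t *\<^sub>R y) (axis i 1)) * ((y \<bullet> axis j 1) * eta y))"
      by (rule integral_swap_partials[OF a eta_potential_C1_deriv, where R=1])
         (simp add: eta_potential_def exp_bump_ball_outside)
    then have "t * (LINT y|lebesgue. - (f' (x - t *\<^sub>R y) (axis j 1) * (eta y * y $ i)))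
       = t * (LINT y|lebesgue. - (f' (x - t *\<^sub>R y) (axis i 1) * (eta y * y $ j)))"
      unfolding integral_mult_right_zero[symmetric] by (simp add: inner_axis mult_ac)
    then show ?thesis unfolding eq using t by simp
  qed
  show ?thesis
    unfolding 1
    by (rule integral_spike[where S="{0}"]) (use 2 in auto)
qed

lemma avg_field_div:
  fixes f :: "real^'d \<Rightarrow> real"
  assumes f: "C1_deriv f f'" and e: "\<epsilon> > 0"
  shows "(\<Sum>i\<in>UNIV. avg_field_deriv \<epsilon> f' x (axis i 1) $ i) = ball_avg \<epsilon> f x - f x"
proof -
  note cf = C1dD[OF f]
  have cont: "continuous_on S (\<lambda>(t, y). - (f' (x - t *\<^sub>R y) h * (eta y * y $ i)))" for S i h
    unfolding case_prod_beta
    by (intro continuous_intros continuous_on_UNIV_compose[OF cf(2)])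
  have rep: "(\<Sum>i\<in>UNIV. - (f' z (axis i 1) * (eta y * y $ i))) = - (eta y * f' z y)" for z y
  proof -
    have "f' z y = f' z (\<Sum>i\<in>UNIV. (y $ i) *\<^sub>R axis i 1)"
      by (simp add: basis_expansion scalar_mult_eq_scaleR[symmetric])
    also have "\<dots> = (\<Sum>i\<in>UNIV. y $ i * f' z (axis i 1))"
      by (simp add: linear_sum[OF cf(4)] linear_scale[OF cf(4)])
    finally show ?thesis
      by (simp add: sum_negf sum_distrib_left mult_ac)
  qed
  have cont2: "continuous_on S (\<lambda>(t, y). - (eta y * f' (x - t *\<^sub>R y) y))" for S
  proof -
    have "continuous_on S (\<lambda>p. \<Sum>i\<in>UNIV. (\<lambda>(t, y). - (f' (x - t *\<^sub>R y) (axis i 1) * (eta y * y $ i))) p)"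
      by (intro continuous_on_sum cont)
    then show ?thesis by (simp add: case_prod_beta rep)
  qed
  have "(\<Sum>i\<in>UNIV. avg_field_deriv \<epsilon> f' x (axis i 1) $ i)
     = integral (cbox (0, - One) (\<epsilon>, One)) (\<lambda>p. \<Sum>i\<in>UNIV. (\<lambda>(t, y). - (f' (x - t *\<^sub>R y) (axis i 1) * (eta y * y $ i))) p)"
    unfolding avg_field_deriv_def avg_field_nth[OF cf(2)]
    by (rule integral_sum[symmetric]) (auto intro!: integrable_continuous cont)
  also have "\<dots> = integral (cbox (0, - One) (\<epsilon>, One)) (\<lambda>(t, y). - (eta y * f' (x - t *\<^sub>R y) y))"
    by (rule integral_cong) (auto simp: rep)
  also have "\<dots> = integral (cbox 0 \<epsilon>) (\<lambda>t. integral (cbox (- One) One) (\<lambda>y. - (eta y * f' (x - t *\<^sub>R y) y)))"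
    by (subst integral_prod_continuous[OF cont2]) simp
  \<comment> \<open>With t innermost the integrand is the derivative in t of
    \<open>eta y * f (x - t *\<^sub>R y)\<close>, so the inner integral telescopes.\<close>
  also have "\<dots> = integral (cbox (- One) One) (\<lambda>y. integral (cbox 0 \<epsilon>) (\<lambda>t. - (eta y * f' (x - t *\<^sub>R y) y)))"
    by (rule integral_swap_continuous[OF cont2])
  also have "\<dots> = integral (cbox (- One) One) (\<lambda>y. eta y * (f (x - \<epsilon> *\<^sub>R y) - f x))"
  proof (rule integral_cong)
    fix y :: "real^'d"
    have "((\<lambda>t. - (eta y * f' (x - t *\<^sub>R y) y)) has_integral eta y * f (x - \<epsilon> *\<^sub>R y) - eta y * f (x - 0 *\<^sub>R y)) {0..\<epsilon>}"
    proof (rule fundamental_theorem_of_calculus)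
      fix t :: real
      have "((\<lambda>t. x - t *\<^sub>R y) has_derivative (\<lambda>h. - (h *\<^sub>R y))) (at t)"
        by (auto intro!: derivative_eq_intros)
      from has_derivative_mult_right[OF has_derivative_compose[OF this cf(1)], of "eta y"]
      have "((\<lambda>t. eta y * f (x - t *\<^sub>R y)) has_derivative (\<lambda>h. h *\<^sub>R (- (eta y * f' (x - t *\<^sub>R y) y)))) (at t)"
        by (rule has_derivative_eq_rhs) (simp add: linear_neg[OF cf(4)] linear_scale[OF cf(4)] mult.left_commute)
      then show "((\<lambda>t. eta y * f (x - t *\<^sub>R y)) has_vector_derivative - (eta y * f' (x - t *\<^sub>R y) y)) (at t within {0..\<epsilon>})"
        unfolding has_vector_derivative_def by (rule has_derivative_at_withinI)
    qed (use e in simp)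
    from integral_unique[OF this]
    show "integral (cbox 0 \<epsilon>) (\<lambda>t. - (eta y * f' (x - t *\<^sub>R y) y)) = eta y * (f (x - \<epsilon> *\<^sub>R y) - f x)"
      by (simp add: right_diff_distrib)
  qed
  also have "\<dots> = integral (cbox (- One) One) (\<lambda>y. f (x - \<epsilon> *\<^sub>R y) * eta y - eta y * f x)"
    by (simp add: algebra_simps)
  also have "\<dots> = ball_avg \<epsilon> f x - integral (cbox (- One) One) (\<lambda>y::real^'d. eta y * f x)"
    unfolding ball_avg_def conv_def
    by (subst integral_diff)
       (auto intro!: integrable_continuous continuous_intros continuous_on_UNIV_compose[OF cf(3)])
  also have "integral (cbox (- One) One) (\<lambda>y::real^'d. eta y * f x) = f x"
    using integral_eta_cbox[where 'a="real^'d"] by simp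
  finally show ?thesis .
qed

text \<open>\<open>eta\<close> has mass 1 and lives on the unit ball, so only the length \<epsilon>
  of the range of t counts. Smallness of order \<epsilon> is what later pays for a cutoff of slope 1
  / \<epsilon>: the product still has a Lipschitz constant independent of \<epsilon>.\<close>

lemma norm_avg_field_le:
  fixes f :: "real^'d \<Rightarrow> real"
  assumes f: "continuous_on UNIV f" "\<And>x. \<bar>f x\<bar> \<le> 1" and e: "\<epsilon> > 0"
  shows "norm (avg_field \<epsilon> f x) \<le> \<epsilon>"
proof -
  have "norm (avg_field \<epsilon> f x) \<le> integral (cbox (0, - One) (\<epsilon>, One)) (\<lambda>(t::real, y::real^'d). eta y)"
    unfolding avg_field_def conv_def
  proof (rule integral_norm_bound_integral)
    show "(\<lambda>p. f (x - (case p of (t, y) \<Rightarrow> t *\<^sub>R y)) *\<^sub>R (case p of (t, y) \<Rightarrow> - (eta y *\<^sub>R y))) integrable_on cbox (0, - One) (\<epsilon>, One)"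
      unfolding case_prod_beta
      by (intro integrable_continuous continuous_intros continuous_on_UNIV_compose[OF f(1)])
    show "(\<lambda>(t::real, y::real^'d). eta y) integrable_on cbox (0, - One) (\<epsilon>, One)"
      unfolding case_prod_beta by (intro integrable_continuous continuous_intros)
    fix p :: "real \<times> (real^'d)"
    obtain t y where p: "p = (t, y)" by force
    have "\<bar>f (x - t *\<^sub>R y)\<bar> * (eta y * norm y) \<le> 1 * (eta y * 1)"
    proof (cases "norm y \<le> 1")
      case True
      then show ?thesis using f eta_nonneg[of y] by (intro mult_mono) auto
    qed (simp add: eta_outside)
    then show "norm (f (x - (case p of (t, y) \<Rightarrow> t *\<^sub>R y)) *\<^sub>R (case p of (t, y) \<Rightarrow> - (eta y *\<^sub>R y)))
      \<le> (case p of (t, y) \<Rightarrow> eta y)"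
      by (simp add: p eta_nonneg abs_mult mult.assoc)
  qed
  also have "\<dots> = integral (cbox 0 \<epsilon>) (\<lambda>t. integral (cbox (- One) One) (\<lambda>y::real^'d. eta y))"
    by (subst integral_prod_continuous) (auto simp: case_prod_beta intro!: continuous_intros)
  also have "\<dots> = \<epsilon>"
    using e by (simp add: integral_eta_cbox)
  finally show ?thesis .
qed

lemma avg_field_support:
  assumes "\<And>x. x \<notin> \<Sigma> \<Longrightarrow> f x = 0" and e: "\<epsilon> > 0" and far: "\<And>z. z \<in> \<Sigma> \<Longrightarrow> dist x z > \<epsilon>"
  shows "avg_field \<epsilon> f x = 0" "ball_avg \<epsilon> f x = 0"
proof -
  have *: "eta y = 0 \<or> f (x - t *\<^sub>R y) = 0" if "0 \<le> t" "t \<le> \<epsilon>" for t y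
  proof (cases "norm y \<ge> 1")
    case False
    have "dist x (x - t *\<^sub>R y) \<le> \<epsilon>"
      using that False by (simp add: dist_norm) (meson mult_left_le norm_ge_zero less_imp_le mult_mono' order_trans not_le)
    then show ?thesis using far assms(1) by fastforce
  qed (simp add: eta_outside)
  show "avg_field \<epsilon> f x = 0" unfolding avg_field_def
  proof (rule conv_eq_0)
    fix p :: "real \<times> (real^'a)"
    assume "p \<in> cbox (0, - One) (\<epsilon>, One)"
    then show "(case p of (t, y) \<Rightarrow> - (eta y *\<^sub>R y)) = 0 \<or> f (x - (case p of (t, y) \<Rightarrow> t *\<^sub>R y)) = 0"
      using *[of "fst p" "snd p"] by (auto simp: cbox_Pair_eq case_prod_beta)
  qed
  show "ball_avg \<epsilon> f x = 0" unfolding ball_avg_def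
    by (rule conv_eq_0) (use * e in auto)
qed

lemma ball_avg_bound:
  fixes f :: "real^'d \<Rightarrow> real"
  assumes f: "continuous_on UNIV f" "\<And>x. \<bar>f x\<bar> \<le> 1"
  shows "\<bar>ball_avg \<epsilon> f x\<bar> \<le> 1"
proof -
  have "norm (ball_avg \<epsilon> f x) \<le> integral (cbox (- One) One) (eta :: real^'d \<Rightarrow> real)"
    unfolding ball_avg_def conv_def
  proof (rule integral_norm_bound_integral)
    show "(\<lambda>p. f (x - \<epsilon> *\<^sub>R p) *\<^sub>R eta p) integrable_on cbox (- One) One"
      by (intro integrable_continuous continuous_intros continuous_on_UNIV_compose[OF f(1)])
    show "eta integrable_on cbox (- One) (One::real^'d)"
      using continuous_eta[OF continuous_on_id] by (intro integrable_continuous) simp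
    fix p :: "real^'d"
    have "\<bar>f (x - \<epsilon> *\<^sub>R p)\<bar> * eta p \<le> 1 * eta p"
      using f eta_nonneg[of p] by (intro mult_right_mono) auto
    then show "norm (f (x - \<epsilon> *\<^sub>R p) *\<^sub>R eta p) \<le> eta p"
      using eta_nonneg[of p] by (simp add: abs_mult)
  qed
  then show ?thesis by (simp add: integral_eta_cbox)
qed

lemma ball_avg_continuous: "continuous_on UNIV f \<Longrightarrow> continuous_on UNIV (ball_avg \<epsilon> f)"
  unfolding ball_avg_def by (rule conv_continuous) (auto intro!: continuous_intros)

text \<open>For a curl-free field the integral of the squared Jacobian entries equals that of the squared divergence.\<close>

lemma avg_field_L2:
  fixes f :: "real^'d \<Rightarrow> real"
  assumes f: "C1_deriv f f'" and e: "\<epsilon> > 0" and supp: "\<And>x. x \<notin> cball 0 R \<Longrightarrow> f x = 0"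
  shows "(LINT x|lebesgue. (\<Sum>i\<in>UNIV. \<Sum>j\<in>UNIV. (avg_field_deriv \<epsilon> f' x (axis j 1) $ i)\<^sup>2))
     = (LINT x|lebesgue. (ball_avg \<epsilon> f x - f x)\<^sup>2)"
proof -
  let ?g = "\<lambda>i j x. avg_field_deriv \<epsilon> f' x (axis j 1) $ i"
  note C = avg_field_C1_deriv[OF f, of \<epsilon>]
  note Ci = C1_deriv_component[OF C]
  have supp': "avg_field \<epsilon> f x = 0" if "norm x > R + \<epsilon>" for x
  proof (rule avg_field_support(1)[OF supp e])
    fix z :: "real^'d" assume "z \<in> cball 0 R"
    then show "dist x z > \<epsilon>"
      using that norm_triangle_ineq2[of x z] by (simp add: dist_norm)
  qed
  have z: "?g i j x = 0" if "norm x > R + \<epsilon>" for i j x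
    by (rule C1_deriv_zero_outside[OF Ci _ that]) (use supp' in simp)
  have I: "integrable lebesgue (\<lambda>x. ?g i j x * ?g k l x)" for i j k l
    by (rule integrable_continuous_compact[where R="R + \<epsilon>"]) (auto simp: z intro!: continuous_intros C1dD(2)[OF Ci])
  have "(LINT x|lebesgue. (\<Sum>i\<in>UNIV. \<Sum>j\<in>UNIV. (?g i j x)\<^sup>2))
     = (\<Sum>i\<in>UNIV. \<Sum>j\<in>UNIV. LINT x|lebesgue. ?g i j x * ?g i j x)"
    by (simp add: power2_eq_square I Bochner_Integration.integral_sum)
  \<comment> \<open>The vanishing curl rewrites the square of entry (i, j) as the product of entries
    (i, j) and (j, i); exchanging the two partial derivatives turns this into a product of diagonal
    entries.\<close>
  also have "\<dots> = (\<Sum>i\<in>UNIV. \<Sum>j\<in>UNIV. LINT x|lebesgue. ?g i i x * ?g j j x)"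
  proof (intro sum.cong refl)
    fix i j :: 'd
    have "(LINT x|lebesgue. ?g i j x * ?g i j x) = (LINT x|lebesgue. ?g i j x * ?g j i x)"
      by (simp add: avg_field_curl[OF f e, of _ j i])
    also have "\<dots> = (LINT x|lebesgue. ?g i i x * ?g j j x)"
      by (rule integral_swap_partials[OF Ci Ci, where R="R + \<epsilon>"]) (use supp' in simp)
    finally show "(LINT x|lebesgue. ?g i j x * ?g i j x) = (LINT x|lebesgue. ?g i i x * ?g j j x)" .
  qed
  also have "\<dots> = (LINT x|lebesgue. (\<Sum>i\<in>UNIV. \<Sum>j\<in>UNIV. ?g i i x * ?g j j x))"
    by (simp add: I Bochner_Integration.integral_sum)
  also have "\<dots> = (LINT x|lebesgue. (\<Sum>i\<in>UNIV. ?g i i x)\<^sup>2)"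
    by (simp add: power2_eq_square sum_product)
  also have "\<dots> = (LINT x|lebesgue. (ball_avg \<epsilon> f x - f x)\<^sup>2)"
    by (simp only: avg_field_div[OF f e])
  finally show ?thesis .
qed

section \<open>Points where averages of the gradient are small\<close>

lemma emeasure_ball_scale:
  fixes x y :: "'a::euclidean_space"
  assumes "r \<ge> 0" "k \<ge> 0"
  shows "emeasure lborel (ball x (k * r)) = ennreal (k ^ DIM('a)) * emeasure lborel (ball y r)"
  using assms emeasure_ball[of "k * r" x] emeasure_ball[of r y]
  by (simp add: ennreal_mult[symmetric] power_mult_distrib mult_ac unit_ball_vol_nonneg)

lemma nn_integral_lborel_affine:
  fixes x :: "'a::euclidean_space"
  assumes [measurable]: "f \<in> borel_measurable borel" and s: "s > 0"
  shows "(\<integral>\<^sup>+p. f p \<partial>lborel) = ennreal (s ^ DIM('a)) * (\<integral>\<^sup>+y. f (x + s *\<^sub>R y) \<partial>lborel)"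
proof -
  have "(\<integral>\<^sup>+p. f p \<partial>lborel) = (\<integral>\<^sup>+p. f p \<partial>density (distr lborel borel (\<lambda>y. x + s *\<^sub>R y)) (\<lambda>_. ennreal (\<bar>s\<bar> ^ DIM('a))))"
    using lborel_affine[of s x] s by simp
  also have "\<dots> = ennreal (s ^ DIM('a)) * (\<integral>\<^sup>+y. f (x + s *\<^sub>R y) \<partial>lborel)"
    using s by (simp add: nn_integral_density nn_integral_distr nn_integral_cmult)
  finally show ?thesis .
qed

text \<open>This is the weak type estimate for the local maximal function. Vitali selects disjoint
  balls on each of which the integral of \<open>F\<close> dominates the measure, and their fivefold
  enlargements cover X. The union of the enlargements serves as an open substitute for X, whose
  measurability is then no issue.\<close>

lemma weak_type_covering:
  fixes F :: "'a::euclidean_space \<Rightarrow> ennreal"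
  assumes [measurable]: "F \<in> borel_measurable borel"
    and bad: "\<And>x. x \<in> X \<Longrightarrow> \<exists>s. 0 < s \<and> s \<le> 1 \<and> c * emeasure lborel (ball x s) \<le> (\<integral>\<^sup>+p. indicator (ball x s) p * F p \<partial>lborel)"
  obtains W where "open W" "X \<subseteq> W" "c * emeasure lborel W \<le> ennreal (5 ^ DIM('a)) * (\<integral>\<^sup>+p. F p \<partial>lborel)"
proof -
  obtain r where r: "\<And>x. x \<in> X \<Longrightarrow> 0 < r x \<and> r x \<le> 1 \<and> c * emeasure lborel (ball x (r x)) \<le> (\<integral>\<^sup>+p. indicator (ball x (r x)) p * F p \<partial>lborel)"
    using bad by metis
  have "X \<subseteq> (\<Union>i\<in>X. ball i (r i))" using r by force
  then obtain C where C: "countable C" "C \<subseteq> X" "pairwise (\<lambda>i j. disjnt (ball i (r i)) (ball j (r j))) C"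
    "X \<subseteq> (\<Union>i\<in>C. ball i (5 * r i))"
    using Vitali_covering_lemma_balls[where S=X and K=X and a="\<lambda>x. x" and r=r and B=1] r
    by (metis (no_types, lifting))
  \<comment> \<open>The selected balls are indexed by all natural numbers, with the empty set off
    the range of the enumeration, so that finite and infinite selections are summed alike.\<close>
  define A where "A n = (if n \<in> to_nat_on C ` C then ball (from_nat_into C n) (r (from_nat_into C n)) else {})" for n
  define A5 where "A5 n = (if n \<in> to_nat_on C ` C then ball (from_nat_into C n) (5 * r (from_nat_into C n)) else {})" for n
  have inC: "from_nat_into C n \<in> C" if "n \<in> to_nat_on C ` C" for n
    using that C(1) by force
  have dA: "disjoint_family A"
    unfolding disjoint_family_on_def
  proof (intro ballI impI)
    fix m n :: nat assume "m \<noteq> n"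
    show "A m \<inter> A n = {}"
    proof (cases "m \<in> to_nat_on C ` C \<and> n \<in> to_nat_on C ` C")
      case True
      then have "from_nat_into C m \<noteq> from_nat_into C n"
        using \<open>m \<noteq> n\<close> C(1) by (metis (no_types, lifting) image_iff from_nat_into_to_nat_on)
      then show ?thesis
        using True inC C(3) unfolding A_def pairwise_def disjnt_def by auto
    qed (auto simp: A_def)
  qed
  have [measurable]: "A n \<in> sets borel" "A5 n \<in> sets borel" for n
    by (auto simp: A_def A5_def)
  have step: "c * emeasure lborel (A5 n) \<le> ennreal (5 ^ DIM('a)) * (\<integral>\<^sup>+p. F p * indicator (A n) p \<partial>lborel)" for n
  proof (cases "n \<in> to_nat_on C ` C")
    case True
    define x where "x = from_nat_into C n"
    have x: "x \<in> X" using inC[OF True] C(2) by (auto simp: x_def)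
    have "c * emeasure lborel (A5 n) = ennreal (5 ^ DIM('a)) * (c * emeasure lborel (ball x (r x)))"
      using True r[OF x] emeasure_ball_scale[of "r x" 5 x x] by (simp add: A5_def x_def[symmetric] mult_ac)
    also have "\<dots> \<le> ennreal (5 ^ DIM('a)) * (\<integral>\<^sup>+p. indicator (ball x (r x)) p * F p \<partial>lborel)"
      using r[OF x] by (intro mult_left_mono) auto
    finally show ?thesis using True by (simp add: A_def x_def[symmetric] mult.commute)
  qed (simp add: A5_def)
  have "c * emeasure lborel (\<Union>n. A5 n) \<le> c * (\<Sum>n. emeasure lborel (A5 n))"
    by (intro mult_left_mono emeasure_subadditive_countably) auto
  also have "\<dots> = (\<Sum>n. c * emeasure lborel (A5 n))"
    by simp
  also have "\<dots> \<le> (\<Sum>n. ennreal (5 ^ DIM('a)) * (\<integral>\<^sup>+p. F p * indicator (A n) p \<partial>lborel))"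
    by (intro suminf_le step) auto
  also have "\<dots> = ennreal (5 ^ DIM('a)) * (\<Sum>n. (\<integral>\<^sup>+p. F p * indicator (A n) p \<partial>lborel))"
    by simp
  also have "(\<Sum>n. (\<integral>\<^sup>+p. F p * indicator (A n) p \<partial>lborel)) = (\<integral>\<^sup>+p. F p * indicator (\<Union>n. A n) p \<partial>lborel)"
    by (subst nn_integral_disjoint_family[OF _ _ dA]) auto
  also have "\<dots> \<le> (\<integral>\<^sup>+p. F p \<partial>lborel)"
    by (intro nn_integral_mono) (auto simp: indicator_def)
  finally have "c * emeasure lborel (\<Union>n. A5 n) \<le> ennreal (5 ^ DIM('a)) * (\<integral>\<^sup>+p. F p \<partial>lborel)"
    by (simp add: mult_left_mono)
  moreover have "open (\<Union>n. A5 n)" by (auto simp: A5_def)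
  moreover have "X \<subseteq> (\<Union>n. A5 n)"
  proof
    fix x assume "x \<in> X"
    then obtain i where i: "i \<in> C" "x \<in> ball i (5 * r i)" using C(4) by blast
    then have "x \<in> A5 (to_nat_on C i)" using C(1) by (simp add: A5_def)
    then show "x \<in> (\<Union>n. A5 n)" by blast
  qed
  ultimately show thesis by (rule that[rotated 2])
qed

text \<open>Write \<open>\<phi> (x + y) - \<phi> x\<close> as an integral along the segment and exchange the two integrations.\<close>

lemma ball_average_deviation:
  fixes \<phi> :: "'a::euclidean_space \<Rightarrow> 'b::euclidean_space"
  assumes \<phi>: "C1_deriv \<phi> \<phi>'" and a: "continuous_on UNIV a" "\<And>x. a x \<ge> 0" "\<And>x h. norm (\<phi>' x h) \<le> a x * norm h"
    and L: "L \<ge> 0" and t: "t > 0"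
    and good: "\<And>s. 0 < s \<Longrightarrow> s \<le> t \<Longrightarrow> (\<integral>\<^sup>+p. indicator (ball x s) p * ennreal (a p) \<partial>lborel) \<le> ennreal L * emeasure lborel (ball x s)"
  shows "(\<integral>\<^sup>+p. indicator (ball x t) p * ennreal (norm (\<phi> p - \<phi> x)) \<partial>lborel) \<le> ennreal (L * t) * emeasure lborel (ball x t)"
proof -
  have [measurable]: "a \<in> borel_measurable borel" "\<phi> \<in> borel_measurable borel"
    using a(1) C1dD(3)[OF \<phi>] by (auto intro: borel_measurable_continuous_onI)
  have m\<phi>: "(\<lambda>p. ennreal (norm (\<phi> p - c))) \<in> borel_measurable borel" for c
    by (intro borel_measurable_continuous_onI continuous_on_ennreal continuous_intros C1dD(3)[OF \<phi>])
  have m1: "(\<lambda>z::real \<times> 'a. ennreal (a (x + fst z *\<^sub>R snd z) * t)) \<in> borel_measurable (lborel \<Otimes>\<^sub>M lborel)"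
    unfolding lborel_prod
    by (simp, intro borel_measurable_continuous_onI continuous_on_ennreal continuous_intros continuous_on_UNIV_compose[OF a(1)])
  have pw: "ennreal (norm (\<phi> (x + y) - \<phi> x)) \<le> (\<integral>\<^sup>+s. indicator {0..1} s * ennreal (a (x + s *\<^sub>R y) * t) \<partial>lborel)"
    if y: "y \<in> ball 0 t" for y
  proof -
    have d: "((\<lambda>s. \<phi> (x + s *\<^sub>R y)) has_vector_derivative \<phi>' (x + s *\<^sub>R y) y) (at s within {0..1})" for s
    proof -
      have "((\<lambda>s. x + s *\<^sub>R y) has_derivative (\<lambda>h. h *\<^sub>R y)) (at s)"
        by (auto intro!: derivative_eq_intros)
      from has_derivative_compose[OF this C1dD(1)[OF \<phi>]]
      have "((\<lambda>s. \<phi> (x + s *\<^sub>R y)) has_derivative (\<lambda>h. h *\<^sub>R \<phi>' (x + s *\<^sub>R y) y)) (at s)"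
        by (simp add: linear_scale[OF C1dD(4)[OF \<phi>]])
      then show ?thesis
        unfolding has_vector_derivative_def by (rule has_derivative_at_withinI)
    qed
    then have i: "((\<lambda>s. \<phi>' (x + s *\<^sub>R y) y) has_integral \<phi> (x + 1 *\<^sub>R y) - \<phi> (x + 0 *\<^sub>R y)) {0..1}"
      by (intro fundamental_theorem_of_calculus) auto
    have ai: "(\<lambda>s. a (x + s *\<^sub>R y) * t) integrable_on {0..1}"
      by (intro integrable_continuous_interval continuous_intros continuous_on_UNIV_compose[OF a(1)])
    have "norm (\<phi> (x + y) - \<phi> x) = norm (integral {0..1} (\<lambda>s. \<phi>' (x + s *\<^sub>R y) y))"
      using integral_unique[OF i] by simp
    also have "\<dots> \<le> integral {0..1} (\<lambda>s. a (x + s *\<^sub>R y) * t)"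
    proof (rule integral_norm_bound_integral[OF _ ai])
      show "(\<lambda>s. \<phi>' (x + s *\<^sub>R y) y) integrable_on {0..1}" using i by blast
      fix s :: real
      have "norm (\<phi>' (x + s *\<^sub>R y) y) \<le> a (x + s *\<^sub>R y) * norm y" by (rule a(3))
      also have "\<dots> \<le> a (x + s *\<^sub>R y) * t" using y a(2) by (intro mult_left_mono) auto
      finally show "norm (\<phi>' (x + s *\<^sub>R y) y) \<le> a (x + s *\<^sub>R y) * t" .
    qed
    finally have "ennreal (norm (\<phi> (x + y) - \<phi> x)) \<le> ennreal (integral {0..1} (\<lambda>s. a (x + s *\<^sub>R y) * t))"
      by (rule ennreal_leI)
    also have "\<dots> = (\<integral>\<^sup>+s. ennreal (a (x + s *\<^sub>R y) * t) * indicator {0..1} s \<partial>lborel)"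
      using a(2) t by (intro nn_integral_has_integral_lebesgue'[symmetric] integrable_integral[OF ai]) auto
    finally show ?thesis by (simp add: mult.commute)
  qed
  have "(\<integral>\<^sup>+p. indicator (ball x t) p * ennreal (norm (\<phi> p - \<phi> x)) \<partial>lborel)
     = (\<integral>\<^sup>+y. indicator (ball x t) (x + 1 *\<^sub>R y) * ennreal (norm (\<phi> (x + 1 *\<^sub>R y) - \<phi> x)) \<partial>lborel)"
    by (subst nn_integral_lborel_affine[where s=1 and x=x]) (auto intro!: borel_measurable_times_ennreal m\<phi> borel_measurable_indicator borel_open)
  also have "\<dots> = (\<integral>\<^sup>+y. indicator (ball 0 t) y * ennreal (norm (\<phi> (x + y) - \<phi> x)) \<partial>lborel)"
    by (intro nn_integral_cong) (auto simp: indicator_def dist_norm)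
  also have "\<dots> \<le> (\<integral>\<^sup>+y. (\<integral>\<^sup>+s. indicator (ball 0 t) y * (indicator {0..1} s * ennreal (a (x + s *\<^sub>R y) * t)) \<partial>lborel) \<partial>lborel)"
    using pw by (intro nn_integral_mono) (auto simp: indicator_def)
  also have "\<dots> = (\<integral>\<^sup>+s. (\<integral>\<^sup>+y. indicator (ball 0 t) y * (indicator {0..1} s * ennreal (a (x + s *\<^sub>R y) * t)) \<partial>lborel) \<partial>lborel)"
    by (rule lborel_pair.Fubini', unfold case_prod_beta,
        intro borel_measurable_times_ennreal m1 measurable_compose[OF measurable_snd borel_measurable_indicator]
          measurable_compose[OF measurable_fst borel_measurable_indicator]) auto
  also have "\<dots> \<le> (\<integral>\<^sup>+s. indicator {0..1::real} s * (ennreal (L * t) * emeasure lborel (ball x t)) \<partial>lborel)"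
  proof (rule nn_integral_mono_AE)
    have "AE s in lborel. s \<noteq> (0::real)" by (rule AE_lborel_singleton)
    then show "AE s in lborel. (\<integral>\<^sup>+y. indicator (ball 0 t) y * (indicator {0..1} s * ennreal (a (x + s *\<^sub>R y) * t)) \<partial>lborel)
       \<le> indicator {0..1::real} s * (ennreal (L * t) * emeasure lborel (ball x t))"
    proof eventually_elim
      case (elim s)
      show ?case
      proof (cases "s \<in> {0..1}")
        case True
        then have s: "0 < s" "s \<le> 1" using elim by auto
        have st: "0 < s * t" "s * t \<le> t" using s t by (auto simp: mult_left_le_one_le)
        \<comment> \<open>The substitution p = x + s y maps the ball of radius t to that of radius s
          t, where the hypothesis applies. The factor s to the dimension occurs on both sides and
          cancels, which is why s = 0 had to be discarded.\<close>
        have "ennreal (s ^ DIM('a)) * (\<integral>\<^sup>+y. indicator (ball 0 t) y * ennreal (a (x + s *\<^sub>R y)) \<partial>lborel)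
            = ennreal (s ^ DIM('a)) * (\<integral>\<^sup>+y. indicator (ball x (s * t)) (x + s *\<^sub>R y) * ennreal (a (x + s *\<^sub>R y)) \<partial>lborel)"
          using s by (auto intro!: arg_cong2[where f="(*)"] nn_integral_cong simp: indicator_def dist_norm)
        also have "\<dots> = (\<integral>\<^sup>+p. indicator (ball x (s * t)) p * ennreal (a p) \<partial>lborel)"
          by (rule nn_integral_lborel_affine[symmetric])
             (use s in \<open>auto intro!: borel_measurable_times_ennreal borel_measurable_indicator borel_open\<close>)
        also have "\<dots> \<le> ennreal L * emeasure lborel (ball x (s * t))"
          by (rule good) (use st in auto)
        also have "\<dots> = ennreal (s ^ DIM('a)) * (ennreal L * emeasure lborel (ball x t))"
          using s t by (simp add: emeasure_ball_scale[where y=x] mult_ac)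
        finally have "(\<integral>\<^sup>+y. indicator (ball 0 t) y * ennreal (a (x + s *\<^sub>R y)) \<partial>lborel) \<le> ennreal L * emeasure lborel (ball x t)"
          using s by (subst (asm) ennreal_mult_le_mult_iff) auto
        then have "ennreal t * (\<integral>\<^sup>+y. indicator (ball 0 t) y * ennreal (a (x + s *\<^sub>R y)) \<partial>lborel) \<le> ennreal t * (ennreal L * emeasure lborel (ball x t))"
          by (intro mult_left_mono) auto
        moreover have "(\<integral>\<^sup>+y. indicator (ball 0 t) y * (indicator {0..1} s * ennreal (a (x + s *\<^sub>R y) * t)) \<partial>lborel)
           = ennreal t * (\<integral>\<^sup>+y. indicator (ball 0 t) y * ennreal (a (x + s *\<^sub>R y)) \<partial>lborel)"
          using True t a(2)
          by (subst nn_integral_cmult[symmetric])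
             (auto simp: ennreal_mult' mult_ac intro!: nn_integral_cong borel_measurable_times_ennreal
                borel_measurable_indicator borel_open)
        ultimately show ?thesis
          using True L t by (simp add: ennreal_mult' mult_ac)
      qed simp
    qed
  qed
  also have "\<dots> = ennreal (L * t) * emeasure lborel (ball x t)"
    by (subst nn_integral_multc) auto
  finally show ?thesis .
qed

text \<open>With t the distance of the two points, the ball of radius t / 2 about their midpoint
  lies in both balls of radius t. On it \<phi> is compared in the mean with both values; the volume
  ratio 2 to the dimension and the two comparisons give the constant.\<close>

lemma good_points_Lipschitz:
  fixes \<phi> :: "'a::euclidean_space \<Rightarrow> 'b::euclidean_space"
  assumes \<phi>: "C1_deriv \<phi> \<phi>'" and a: "continuous_on UNIV a" "\<And>x. a x \<ge> 0" "\<And>x h. norm (\<phi>' x h) \<le> a x * norm h"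
    and L: "L \<ge> 0" and xy: "dist x y \<le> 1"
    and good: "\<And>s z. z \<in> {x, y} \<Longrightarrow> 0 < s \<Longrightarrow> s \<le> 1 \<Longrightarrow> (\<integral>\<^sup>+p. indicator (ball z s) p * ennreal (a p) \<partial>lborel) \<le> ennreal L * emeasure lborel (ball z s)"
  shows "norm (\<phi> x - \<phi> y) \<le> 2 ^ (DIM('a) + 1) * L * dist x y"
proof (cases "x = y")
  case False
  define t where "t = dist x y"
  have t: "t > 0" "t \<le> 1" using False xy by (auto simp: t_def)
  have [measurable]: "\<phi> \<in> borel_measurable borel"
    using C1dD(3)[OF \<phi>] by (auto intro: borel_measurable_continuous_onI)
  have m\<phi>: "(\<lambda>p. ennreal (norm (\<phi> p - c))) \<in> borel_measurable borel" for c
    by (intro borel_measurable_continuous_onI continuous_on_ennreal continuous_intros C1dD(3)[OF \<phi>])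
  define m where "m = midpoint x y"
  have sub: "ball m (t / 2) \<subseteq> ball x t" "ball m (t / 2) \<subseteq> ball y t"
  proof -
    have d: "dist x m = t / 2" "dist y m = t / 2"
      by (auto simp: m_def t_def dist_midpoint)
    have "dist z p < t" if "dist z m = t / 2" "dist m p < t / 2" for z p
      using that dist_triangle[of z p m] by simp
    then show "ball m (t / 2) \<subseteq> ball x t" "ball m (t / 2) \<subseteq> ball y t"
      using d by auto
  qed
  define v where "v = emeasure lborel (ball m (t / 2))"
  have vt: "emeasure lborel (ball z t) = ennreal (2 ^ DIM('a)) * v" for z :: 'a
    using emeasure_ball_scale[where r="t / 2" and k=2 and x=z and y=m] t by (simp add: v_def)
  have v: "v > 0" "v < \<infinity>"
    using t by (simp_all add: v_def emeasure_ball)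
  have I: "(\<integral>\<^sup>+p. indicator (ball m (t / 2)) p * ennreal (norm (\<phi> p - \<phi> z)) \<partial>lborel) \<le> ennreal (L * t) * (ennreal (2 ^ DIM('a)) * v)"
    if z: "z \<in> {x, y}" for z
  proof -
    have "(\<integral>\<^sup>+p. indicator (ball m (t / 2)) p * ennreal (norm (\<phi> p - \<phi> z)) \<partial>lborel)
      \<le> (\<integral>\<^sup>+p. indicator (ball z t) p * ennreal (norm (\<phi> p - \<phi> z)) \<partial>lborel)"
      using sub z by (intro nn_integral_mono) (auto simp: indicator_def subset_iff)
    also have "\<dots> \<le> ennreal (L * t) * emeasure lborel (ball z t)"
      by (rule ball_average_deviation[OF \<phi> a L t(1)]) (use good z t in auto)
    finally show ?thesis by (simp add: vt)
  qed
  have "ennreal (norm (\<phi> x - \<phi> y)) * v = (\<integral>\<^sup>+p. indicator (ball m (t / 2)) p * ennreal (norm (\<phi> x - \<phi> y)) \<partial>lborel)"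
    by (simp add: mult.commute[of "indicator _ _"] nn_integral_cmult_indicator v_def del: mult.commute)
  also have "\<dots> \<le> (\<integral>\<^sup>+p. indicator (ball m (t / 2)) p * ennreal (norm (\<phi> p - \<phi> x)) + indicator (ball m (t / 2)) p * ennreal (norm (\<phi> p - \<phi> y)) \<partial>lborel)"
  proof (intro nn_integral_mono)
    fix p
    have "norm (\<phi> x - \<phi> y) \<le> norm (\<phi> p - \<phi> x) + norm (\<phi> p - \<phi> y)"
      using norm_triangle_ineq4[of "\<phi> p - \<phi> y" "\<phi> p - \<phi> x"] by simp
    then show "indicator (ball m (t / 2)) p * ennreal (norm (\<phi> x - \<phi> y))
        \<le> indicator (ball m (t / 2)) p * ennreal (norm (\<phi> p - \<phi> x)) + indicator (ball m (t / 2)) p * ennreal (norm (\<phi> p - \<phi> y))"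
      by (auto simp: indicator_def ennreal_plus[symmetric] simp del: ennreal_plus intro!: ennreal_leI)
  qed
  also have "\<dots> \<le> ennreal (L * t) * (ennreal (2 ^ DIM('a)) * v) + ennreal (L * t) * (ennreal (2 ^ DIM('a)) * v)"
    by (subst nn_integral_add) (auto intro!: add_mono I borel_measurable_times_ennreal m\<phi> borel_measurable_indicator borel_open)
  also have "\<dots> = ennreal (2 ^ (DIM('a) + 1) * L * t) * v"
    using L t by (simp add: ennreal_mult mult_ac mult_2[symmetric])
  finally have "ennreal (norm (\<phi> x - \<phi> y)) * v \<le> ennreal (2 ^ (DIM('a) + 1) * L * t) * v" .
  then have "ennreal (norm (\<phi> x - \<phi> y)) \<le> ennreal (2 ^ (DIM('a) + 1) * L * t)"
    using v ennreal_mult_le_mult_iff[of v "ennreal (norm (\<phi> x - \<phi> y))" "ennreal (2 ^ (DIM('a) + 1) * L * t)"]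
    by (simp add: mult.commute)
  then show ?thesis
    using L t by (simp add: ennreal_le_iff t_def[symmetric])
qed simp

section \<open>Lipschitz extension and mollification\<close>

lemma uniform_continuity_compact_support:
  fixes f :: "'a::euclidean_space \<Rightarrow> 'b::real_normed_vector"
  assumes "continuous_on UNIV f" "\<And>x. norm x > R \<Longrightarrow> f x = 0" "e > 0"
  obtains d where "d > 0" "\<And>x y. dist x y \<le> d \<Longrightarrow> norm (f x - f y) \<le> e"
proof -
  have "uniformly_continuous_on (cball 0 (R + 1)) f"
    by (rule compact_uniformly_continuous) (auto intro: continuous_on_subset[OF assms(1)])
  then obtain d where d: "d > 0" "\<And>x y. x \<in> cball 0 (R + 1) \<Longrightarrow> y \<in> cball 0 (R + 1) \<Longrightarrow> dist x y < d \<Longrightarrow> dist (f x) (f y) < e"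
    using assms(3) unfolding uniformly_continuous_on_def by metis
  show thesis
  proof (rule that[of "min (d / 2) 1"])
    fix x y :: 'a assume xy: "dist x y \<le> min (d / 2) 1"
    show "norm (f x - f y) \<le> e"
    proof (cases "norm x \<le> R + 1 \<and> norm y \<le> R + 1")
      case True
      then show ?thesis using d(2)[of x y] d(1) xy by (simp add: dist_norm)
    next
      case False
      have "norm x \<le> norm y + dist x y" "norm y \<le> norm x + dist x y"
        using norm_triangle_ineq2[of x y] norm_triangle_ineq2[of y x] by (simp_all add: dist_norm norm_minus_commute)
      then have "norm x > R" "norm y > R" using False xy by auto
      then show ?thesis using assms by simp
    qed
  qed (use d in auto)
qed

text \<open>McShane's formula: the infimum of the cones \<open>g y + K * dist x y\<close> with apex
  over S.\<close>

lemma Lipschitz_extension: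
  fixes g :: "'a::metric_space \<Rightarrow> real"
  assumes "S \<noteq> {}" "K \<ge> 0" and g: "\<And>x y. x \<in> S \<Longrightarrow> y \<in> S \<Longrightarrow> \<bar>g x - g y\<bar> \<le> K * dist x y"
  obtains h where "\<And>x y. \<bar>h x - h y\<bar> \<le> K * dist x y" "\<And>x. x \<in> S \<Longrightarrow> h x = g x"
proof -
  define h where "h x = (INF y\<in>S. g y + K * dist x y)" for x
  obtain y0 where y0: "y0 \<in> S" using assms(1) by blast
  have bdd: "bdd_below ((\<lambda>y. g y + K * dist x y) ` S)" for x
  proof (rule bdd_belowI2)
    fix y assume y: "y \<in> S"
    have "K * dist y0 y \<le> K * dist x y0 + K * dist x y"
      using assms(2) dist_triangle2[of y0 y x] mult_left_mono[of "dist y0 y" "dist x y0 + dist x y" K]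
      by (simp add: distrib_left dist_commute)
    then show "g y0 - K * dist x y0 \<le> g y + K * dist x y"
      using g[OF y0 y] by linarith
  qed
  have le: "h x \<le> h y + K * dist x y" for x y
  proof -
    have "h x - K * dist x y \<le> h y"
      unfolding h_def[of y]
    proof (rule cINF_greatest)
      fix z assume z: "z \<in> S"
      have "h x \<le> g z + K * dist x z"
        unfolding h_def by (rule cINF_lower[OF bdd z])
      also have "\<dots> \<le> g z + (K * dist x y + K * dist y z)"
        using assms(2) dist_triangle[of x z y] mult_left_mono[of "dist x z" "dist x y + dist y z" K]
        by (simp add: distrib_left)
      finally show "h x - K * dist x y \<le> g z + K * dist y z" by simp
    qed (use assms in auto)
    then show ?thesis by simp
  qed
  show thesis
  proof (rule that)
    show "\<bar>h x - h y\<bar> \<le> K * dist x y" for x y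
      using le[of x y] le[of y x] by (simp add: dist_commute abs_le_iff)
    fix x assume x: "x \<in> S"
    have "h x \<le> g x" using cINF_lower[OF bdd x, of x] by (simp add: h_def)
    moreover have "g x \<le> h x"
      unfolding h_def
    proof (rule cINF_greatest)
      fix y assume "y \<in> S"
      then show "g x \<le> g y + K * dist x y" using g[OF x, of y] by linarith
    qed (use assms in auto)
    ultimately show "h x = g x" by simp
  qed
qed

text \<open>The radius enters inside \<open>exp_bump\<close>, with a fresh normalisation, instead of
  by dilating \<open>eta\<close>. In this form the kernel belongs to
  \<open>bump_algebra (\<tau>\<^sup>2)\<close> as it stands, which gives its smoothness.\<close>

definition rho :: "real \<Rightarrow> 'a::euclidean_space \<Rightarrow> real" where
  "rho \<tau> y = exp_bump 0 (\<tau>\<^sup>2 - y \<bullet> y) / (LINT y|lebesgue. exp_bump 0 (\<tau>\<^sup>2 - (y::'a) \<bullet> y))"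

lemma rho_props:
  fixes y :: "'a::euclidean_space"
  assumes \<tau>: "\<tau> > 0"
  shows "rho \<tau> y \<ge> 0" "norm y \<ge> \<tau> \<Longrightarrow> rho \<tau> y = 0" "Cn n (rho \<tau> :: 'a \<Rightarrow> real)"
    "(LINT y|lebesgue. rho \<tau> (y::'a)) = 1"
proof -
  let ?m = "LINT y|lebesgue. exp_bump 0 (\<tau>\<^sup>2 - (y::'a) \<bullet> y)"
  have out: "exp_bump 0 (\<tau>\<^sup>2 - y \<bullet> y) = 0" if "norm y \<ge> \<tau>" for y :: 'a
    using that \<tau> by (intro exp_bump_eq_0) (simp add: dot_square_norm power_mono)
  have m: "?m > 0"
  proof (rule integrable_continuous_nonneg_pos[where ?x0.0 = 0])
    show "integrable lebesgue (\<lambda>y::'a. exp_bump 0 (\<tau>\<^sup>2 - y \<bullet> y))"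
      by (rule integrable_continuous_compact[where R=\<tau>]) (auto intro: continuous_exp_bump_ball out)
  qed (use \<tau> in \<open>auto intro: continuous_exp_bump_ball exp_bump_nonneg exp_bump_pos\<close>)
  show "rho \<tau> y \<ge> 0" using m by (simp add: rho_def exp_bump_nonneg less_imp_le)
  show "norm y \<ge> \<tau> \<Longrightarrow> rho \<tau> y = 0" by (simp add: rho_def out)
  have "bump_algebra (\<tau>\<^sup>2) (\<lambda>y::'a. (1 / ?m) * exp_bump 0 (\<tau>\<^sup>2 - y \<bullet> y))"
    by (intro bump_algebra.intros)
  then show "Cn n (rho \<tau> :: 'a \<Rightarrow> real)"
    using bump_algebra_Cn unfolding rho_def[abs_def] by auto
  show "(LINT y|lebesgue. rho \<tau> (y::'a)) = 1"
    using m by (simp add: rho_def)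
qed

lemma Cn_1_C1_deriv:
  assumes "Cn (Suc 0) f" shows "C1_deriv f (\<lambda>x. frechet_derivative f (at x))"
  using assms by (intro C1_deriv_frechet) auto

text \<open>Averaging preserves closeness: of values to a constant, and of increments to a linear
  map T. The second property asks no differentiability of \<open>h\<close>. With T = 0 it transfers
  a Lipschitz constant to the derivative of the mollification; with T the derivative of a smooth
  field it gives closeness of derivatives wherever \<open>h\<close> coincides nearby with that
  field.\<close>

lemma mollification:
  fixes h :: "'a::euclidean_space \<Rightarrow> 'b::euclidean_space"
  assumes h: "continuous_on UNIV h" "\<And>x. norm x > R \<Longrightarrow> h x = 0" and \<tau>: "\<tau> > 0"
  obtains \<psi> \<psi>' where "smooth \<psi>" "C1_deriv \<psi> \<psi>'"
    "\<And>x c e. (\<And>y. dist x y \<le> \<tau> \<Longrightarrow> norm (h y - c) \<le> e) \<Longrightarrow> norm (\<psi> x - c) \<le> e"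
    "\<And>x v T \<omega> \<sigma>. linear T \<Longrightarrow> \<sigma> > 0 \<Longrightarrow>
       (\<And>y w. dist x y \<le> \<tau> \<Longrightarrow> norm w \<le> \<sigma> \<Longrightarrow> norm (h (y + w) - h y - T w) \<le> \<omega> * norm w)
       \<Longrightarrow> norm (\<psi>' x v - T v) \<le> \<omega> * norm v"
proof -
  obtain b where b: "cball 0 R \<subseteq> cbox (- b) (b::'a)"
    using bounded_subset_cbox_symmetric[OF bounded_cball] by metis
  have h0: "h x = 0" if "x \<notin> cbox (- b) b" for x
    using that b h(2)[of x] by (cases "norm x \<le> R") (auto simp: subset_iff)
  define \<psi> where "\<psi> = conv (- b) b (\<lambda>y. y) h (rho \<tau>)"
  have rc: "continuous_on UNIV (rho \<tau> :: 'a \<Rightarrow> real)"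
    using rho_props(3)[OF \<tau>] Cn_continuous by blast
  have cn: "Cn n \<psi>" for n
    unfolding \<psi>_def by (rule conv_Cn[OF rho_props(3)[OF \<tau>]]) (auto intro: continuous_on_subset[OF h(1)])
  define \<psi>' where "\<psi>' x = frechet_derivative \<psi> (at x)" for x
  have C: "C1_deriv \<psi> \<psi>'"
    using Cn_1_C1_deriv[OF cn] unfolding \<psi>'_def .
  have eq: "\<psi> x = (LINT y|lebesgue. rho \<tau> (x - y) *\<^sub>R h y)" for x
    unfolding \<psi>_def conv_def
    by (rule integral_cbox_eq_lebesgue)
       (auto simp: h0 intro!: continuous_intros h(1) continuous_on_UNIV_compose[OF rc])
  have ic: "integrable lebesgue (\<lambda>y. rho \<tau> (x - y) *\<^sub>R g y)"
    if "continuous_on UNIV g" for x :: 'a and g :: "'a \<Rightarrow> 'c::euclidean_space"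
  proof (rule integrable_continuous_compact[where R="norm x + \<tau>"])
    show "continuous_on UNIV (\<lambda>y. rho \<tau> (x - y) *\<^sub>R g y)"
      by (intro continuous_intros that continuous_on_UNIV_compose[OF rc])
    fix y :: 'a assume "norm x + \<tau> < norm y"
    then have "norm (x - y) \<ge> \<tau>"
      using norm_triangle_ineq2[of y x] by (simp add: norm_minus_commute)
    then show "rho \<tau> (x - y) *\<^sub>R g y = 0" by (simp add: rho_props(2)[OF \<tau>])
  qed
  have r1: "(LINT y|lebesgue. rho \<tau> (x - y)) = 1" for x :: 'a
  proof -
    have "rho \<tau> (x - y) = rho \<tau> (- x + y)" for y
      by (simp add: rho_def inner_diff_left inner_diff_right inner_commute algebra_simps)
    then have "(LINT y|lebesgue. rho \<tau> (x - y)) = (LINT y|lebesgue. rho \<tau> (- x + y))"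
      by simp
    also have "\<dots> = (LINT y|lebesgue. rho \<tau> (y::'a))"
      by (rule integral_lebesgue_translate[OF continuous_borel_measurable_lebesgue[OF rc]])
    finally show ?thesis using rho_props(4)[OF \<tau>, where 'a='a] by simp
  qed
  have avg: "norm (LINT y|lebesgue. rho \<tau> (x - y) *\<^sub>R g y) \<le> e"
    if g: "continuous_on UNIV g" and e: "\<And>y. dist x y \<le> \<tau> \<Longrightarrow> norm (g y) \<le> e" for x :: 'a and e and g :: "'a \<Rightarrow> 'b"
  proof -
    have "norm (LINT y|lebesgue. rho \<tau> (x - y) *\<^sub>R g y) \<le> (LINT y|lebesgue. norm (rho \<tau> (x - y) *\<^sub>R g y))"
      by (rule integral_norm_bound)
    also have "\<dots> \<le> (LINT y|lebesgue. rho \<tau> (x - y) *\<^sub>R e)"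
    proof (rule integral_mono)
      show "integrable lebesgue (\<lambda>y. norm (rho \<tau> (x - y) *\<^sub>R g y))"
        using ic[OF g] by (rule integrable_norm)
      show "integrable lebesgue (\<lambda>y. rho \<tau> (x - y) *\<^sub>R e)" by (rule ic) simp
      fix y
      show "norm (rho \<tau> (x - y) *\<^sub>R g y) \<le> rho \<tau> (x - y) *\<^sub>R e"
      proof (cases "norm (x - y) \<ge> \<tau>")
        case False
        then show ?thesis
          using rho_props(1)[OF \<tau>, of "x - y"] e[of y] by (simp add: dist_norm mult_left_mono)
      qed (simp add: rho_props(2)[OF \<tau>])
    qed
    also have "\<dots> = e" by (simp add: r1)
    finally show ?thesis .
  qed
  show thesis
  proof (rule that[of \<psi> \<psi>'])
    show "smooth \<psi>" using cn by (simp add: smooth_def)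
    show "C1_deriv \<psi> \<psi>'" by (rule C)
    fix x
    { fix c e assume c: "\<And>y. dist x y \<le> \<tau> \<Longrightarrow> norm (h y - c) \<le> e"
      have "\<psi> x - c = (LINT y|lebesgue. rho \<tau> (x - y) *\<^sub>R h y) - (LINT y|lebesgue. rho \<tau> (x - y) *\<^sub>R c)"
        using ic[of "\<lambda>_. 1::real" x] by (simp add: eq r1)
      also have "\<dots> = (LINT y|lebesgue. rho \<tau> (x - y) *\<^sub>R (h y - c))"
        using ic[OF h(1)] ic[of "\<lambda>_. c"] by (simp add: scaleR_diff_right)
      finally show "norm (\<psi> x - c) \<le> e"
        using avg[of "\<lambda>y. h y - c" x e] c h(1) by (simp add: continuous_on_diff) }
    fix v \<omega> \<sigma> and T :: "'a \<Rightarrow> 'b"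
    assume T: "linear T" and \<sigma>: "\<sigma> > 0"
      and hT: "\<And>y w. dist x y \<le> \<tau> \<Longrightarrow> norm w \<le> \<sigma> \<Longrightarrow> norm (h (y + w) - h y - T w) \<le> \<omega> * norm w"
    have bound: "norm (\<psi> (x + w) - \<psi> x - T w) \<le> \<omega> * norm w" if w: "norm w \<le> \<sigma>" for w
    proof -
      have hw: "continuous_on UNIV (\<lambda>y. h (w + y))"
        by (intro continuous_on_UNIV_compose[OF h(1)] continuous_intros)
      have "\<psi> (x + w) = (LINT y|lebesgue. rho \<tau> (x + w - (w + y)) *\<^sub>R h (w + y))"
        unfolding eq
        by (rule integral_lebesgue_translate[symmetric] )
           (intro continuous_borel_measurable_lebesgue continuous_intros h(1) continuous_on_UNIV_compose[OF rc])
      then have "\<psi> (x + w) - \<psi> x - T w = (LINT y|lebesgue. rho \<tau> (x - y) *\<^sub>R h (w + y)) -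
          (LINT y|lebesgue. rho \<tau> (x - y) *\<^sub>R h y) - (LINT y|lebesgue. rho \<tau> (x - y) *\<^sub>R T w)"
        using ic[of "\<lambda>_. 1::real" x] by (simp add: eq r1)
      also have "\<dots> = (LINT y|lebesgue. rho \<tau> (x - y) *\<^sub>R (h (w + y) - h y - T w))"
        using ic[OF h(1)] ic[of "\<lambda>_. T w"] ic[OF hw] by (simp add: scaleR_diff_right)
      finally show ?thesis
        using avg[of "\<lambda>y. h (w + y) - h y - T w" x "\<omega> * norm w"] hT[OF _ w] h(1) hw
        by (simp add: continuous_on_diff add.commute)
    qed
    \<comment> \<open>Testing against the error vector itself reduces the vector inequality to
      limits of real difference quotients.\<close>
    define b where "b = \<psi>' x v - T v"
    have Cb: "((\<lambda>x. \<psi> x \<bullet> b) has_derivative (\<lambda>h. \<psi>' x h \<bullet> b)) (at x)"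
      by (intro has_derivative_inner_left C1dD(1)[OF C])
    have "linear (\<lambda>h. \<psi>' x h \<bullet> b)" using Cb has_derivative_linear by blast
    from difference_quotient_tendsto[OF Cb this, of v]
    have lim: "(\<lambda>n. (\<psi> (x + (1 / real (Suc n)) *\<^sub>R v) \<bullet> b - \<psi> x \<bullet> b) / (1 / real (Suc n)) - T v \<bullet> b) \<longlonglongrightarrow> \<psi>' x v \<bullet> b - T v \<bullet> b"
      by (intro tendsto_diff tendsto_const)
    have "(\<lambda>n. (1 / real (Suc n)) * norm v) \<longlonglongrightarrow> 0 * norm v"
      using LIMSEQ_inverse_real_of_nat by (intro tendsto_mult tendsto_const) (simp add: inverse_eq_divide)
    then have ev: "\<forall>\<^sub>F n in sequentially. (1 / real (Suc n)) * norm v < \<sigma>"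
      using \<sigma> by (intro order_tendstoD(2)) auto
    have "\<psi>' x v \<bullet> b - T v \<bullet> b \<le> \<omega> * norm v * norm b"
    proof (rule tendsto_upperbound[OF lim _ sequentially_bot])
      show "\<forall>\<^sub>F n in sequentially. (\<psi> (x + (1 / real (Suc n)) *\<^sub>R v) \<bullet> b - \<psi> x \<bullet> b) / (1 / real (Suc n)) - T v \<bullet> b \<le> \<omega> * norm v * norm b"
        using ev
      proof eventually_elim
        case (elim n)
        define s where "s = 1 / real (Suc n)"
        have s: "s > 0" by (simp add: s_def)
        have "(\<psi> (x + s *\<^sub>R v) - \<psi> x - T (s *\<^sub>R v)) \<bullet> b \<le> norm (\<psi> (x + s *\<^sub>R v) - \<psi> x - T (s *\<^sub>R v)) * norm b"
          by (rule norm_cauchy_schwarz)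
        also have "\<dots> \<le> (\<omega> * norm (s *\<^sub>R v)) * norm b"
          using elim[folded s_def] s by (intro mult_right_mono bound) auto
        also have "\<dots> = (\<omega> * norm v * norm b) * s" using s by simp
        finally have "\<psi> (x + s *\<^sub>R v) \<bullet> b - \<psi> x \<bullet> b - s * (T v \<bullet> b) \<le> (\<omega> * norm v * norm b) * s"
          by (simp add: inner_diff_left linear_scale[OF T])
        then have "(\<psi> (x + s *\<^sub>R v) \<bullet> b - \<psi> x \<bullet> b - s * (T v \<bullet> b)) / s \<le> \<omega> * norm v * norm b"
          using s by (simp add: divide_le_eq)
        then show ?case
          using s unfolding s_def[symmetric] by (simp add: diff_divide_distrib)
      qed
    qed
    then have "norm b * norm b \<le> (\<omega> * norm v) * norm b"
      by (simp add: b_def inner_diff_left[symmetric] power2_norm_eq_inner[symmetric] power2_eq_square)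
    \<comment> \<open>The sign of \<omega> is not among the hypotheses; an increment of length
      \<sigma> reveals it. It is needed when the error \<open>b\<close> vanishes and cannot be
      cancelled.\<close>
    moreover have "\<omega> * norm v \<ge> 0"
    proof (cases "v = 0")
      case False
      define w where "w = (\<sigma> / norm v) *\<^sub>R v"
      have nw: "norm w = \<sigma>" using False \<sigma> by (simp add: w_def)
      have "0 \<le> norm (h (x + w) - h x - T w)" by simp
      also have "\<dots> \<le> \<omega> * \<sigma>" using hT[of x w] \<tau> nw by simp
      finally show ?thesis using \<sigma> by (simp add: zero_le_mult_iff)
    qed simp
    ultimately show "norm (\<psi>' x v - T v) \<le> \<omega> * norm v"
      unfolding b_def[symmetric]
      by (metis mult_le_cancel_right norm_ge_zero order_le_less not_le)
  qed
qed

section \<open>Truncated test fields\<close>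

text \<open>With N the dimension, \<open>4 * real N ^ 2\<close> times the volume bounds the squared
  integral norm of the Jacobian, \<open>5 ^ N\<close> is the covering constant, and the bracket
  bounds, in units of L, the divergences of the truncated field and of the original one where
  truncation takes effect. The last summand comes from the square of the Jacobian divided by
  L.\<close>

definition trunc_const :: "nat \<Rightarrow> real" where
  "trunc_const N = 4 * real N ^ 2 * 5 ^ N * (real N ^ 2 * (2 ^ (N + 2) + 1) + 1) + 4 * real N ^ 2"

lemma linear_norm_le_entries:
  fixes T :: "real^'d \<Rightarrow> real^'d"
  assumes "linear T"
  shows "norm (T h) \<le> (\<Sum>i\<in>UNIV. \<Sum>j\<in>UNIV. \<bar>T (axis j 1) $ i\<bar>) * norm h"
proof -
  have "T h = (\<Sum>j\<in>UNIV. h $ j *\<^sub>R T (axis j 1))"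
  proof -
    have "T h = T (\<Sum>j\<in>UNIV. h $ j *\<^sub>R axis j 1)"
      by (simp add: basis_expansion scalar_mult_eq_scaleR[symmetric])
    then show ?thesis by (simp add: linear_sum[OF assms] linear_scale[OF assms])
  qed
  then have "T h $ i = (\<Sum>j\<in>UNIV. h $ j * T (axis j 1) $ i)" for i by simp
  note Th = this
  have "\<And>i. \<bar>T h $ i\<bar> \<le> (\<Sum>j\<in>UNIV. \<bar>T (axis j 1) $ i\<bar> * norm h)"
  proof -
    fix i
    have "\<bar>h $ j * T (axis j 1) $ i\<bar> \<le> \<bar>T (axis j 1) $ i\<bar> * norm h" for j
      using mult_right_mono[OF component_le_norm_cart[of h j], of "\<bar>T (axis j 1) $ i\<bar>"]
      by (simp add: abs_mult mult.commute)
    then have "(\<Sum>j\<in>UNIV. \<bar>h $ j * T (axis j 1) $ i\<bar>) \<le> (\<Sum>j\<in>UNIV. \<bar>T (axis j 1) $ i\<bar> * norm h)"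
      by (intro sum_mono)
    then show "\<bar>T h $ i\<bar> \<le> (\<Sum>j\<in>UNIV. \<bar>T (axis j 1) $ i\<bar> * norm h)"
      unfolding Th by (rule order_trans[OF sum_abs])
  qed
  then have "(\<Sum>i\<in>UNIV. \<bar>T h $ i\<bar>) \<le> (\<Sum>i\<in>UNIV. \<Sum>j\<in>UNIV. \<bar>T (axis j 1) $ i\<bar> * norm h)"
    by (rule sum_mono)
  with norm_le_l1_cart[of "T h"] show ?thesis
    by (simp add: sum_distrib_right)
qed

text \<open>Young's inequality a \<le> L / 2 + a^2 / (2 L). Contrapositively, a ball on which the
  mean of a exceeds L is one on which the mean of a^2 exceeds L^2; covering such balls with the
  density a^2 makes the bad set of order 1 / L^2 instead of 1 / L.\<close>

lemma bound_of_average_quadratic: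
  fixes a :: "'a::euclidean_space \<Rightarrow> real"
  assumes [measurable]: "a \<in> borel_measurable borel" and "\<And>x. a x \<ge> 0" "L > 0"
    and "(\<integral>\<^sup>+p. indicator (ball x s) p * ennreal ((a p)\<^sup>2) \<partial>lborel) \<le> ennreal (L\<^sup>2) * emeasure lborel (ball x s)"
  shows "(\<integral>\<^sup>+p. indicator (ball x s) p * ennreal (a p) \<partial>lborel) \<le> ennreal L * emeasure lborel (ball x s)"
proof -
  have [measurable]: "indicator (ball x s) \<in> borel_measurable (borel :: 'a measure)"
    by (intro borel_measurable_indicator borel_open) auto
  have am: "a p \<le> L / 2 + (1 / (2 * L)) * (a p)\<^sup>2" for p
  proof -
    have "0 \<le> (a p - L)\<^sup>2" by simp
    then have "2 * L * a p \<le> L\<^sup>2 + (a p)\<^sup>2" by (simp add: power2_diff mult_ac)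
    then show ?thesis using assms(3) by (simp add: field_simps power2_eq_square)
  qed
  have "(\<integral>\<^sup>+p. indicator (ball x s) p * ennreal (a p) \<partial>lborel)
    \<le> (\<integral>\<^sup>+p. ennreal (L / 2) * indicator (ball x s) p + ennreal (1 / (2 * L)) * (indicator (ball x s) p * ennreal ((a p)\<^sup>2)) \<partial>lborel)"
    using am assms(2,3)
    by (intro nn_integral_mono) (auto simp: indicator_def ennreal_plus[symmetric] ennreal_mult[symmetric] simp del: ennreal_plus intro!: ennreal_leI)
  also have "\<dots> = ennreal (L / 2) * emeasure lborel (ball x s) + ennreal (1 / (2 * L)) * (\<integral>\<^sup>+p. indicator (ball x s) p * ennreal ((a p)\<^sup>2) \<partial>lborel)"
    by (subst nn_integral_add) (auto simp: nn_integral_cmult)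
  also have "\<dots> \<le> ennreal (L / 2) * emeasure lborel (ball x s) + ennreal (1 / (2 * L)) * (ennreal (L\<^sup>2) * emeasure lborel (ball x s))"
    by (intro add_mono mult_left_mono assms) auto
  also have "\<dots> = ennreal L * emeasure lborel (ball x s)"
  proof -
    have "ennreal (1 / (2 * L)) * ennreal (L\<^sup>2) = ennreal (L / 2)"
      using assms(3) by (simp add: ennreal_mult[symmetric] power2_eq_square)
    then have "ennreal (1 / (2 * L)) * (ennreal (L\<^sup>2) * emeasure lborel (ball x s)) = ennreal (L / 2) * emeasure lborel (ball x s)"
      by (simp add: mult.assoc[symmetric])
    moreover have "ennreal (L / 2) + ennreal (L / 2) = ennreal L"
      using assms(3) by (simp add: ennreal_plus[symmetric] del: ennreal_plus)
    ultimately show ?thesis by (simp add: distrib_right[symmetric])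
  qed
  finally show ?thesis .
qed

text \<open>Mollification looks at a neighbourhood of the good set, so goodness has to survive small
  translations. If a varies by at most L under the shift, this costs only a doubling of L.\<close>

lemma good_points_translate:
  fixes a :: "'a::euclidean_space \<Rightarrow> real"
  assumes [measurable]: "a \<in> borel_measurable borel" and "\<And>x. a x \<ge> 0" "L \<ge> 0"
    and cl: "\<And>p. a (p + (y - x)) \<le> a p + L"
    and good: "(\<integral>\<^sup>+p. indicator (ball x s) p * ennreal (a p) \<partial>lborel) \<le> ennreal L * emeasure lborel (ball x s)"
  shows "(\<integral>\<^sup>+p. indicator (ball y s) p * ennreal (a p) \<partial>lborel) \<le> ennreal (2 * L) * emeasure lborel (ball y s)"
proof -
  have [measurable]: "indicator (ball x s) \<in> borel_measurable (borel :: 'a measure)" for x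
    by (intro borel_measurable_indicator borel_open) auto
  have "(\<integral>\<^sup>+p. indicator (ball y s) p * ennreal (a p) \<partial>lborel)
      = (\<integral>\<^sup>+p. indicator (ball y s) ((y - x) + 1 *\<^sub>R p) * ennreal (a ((y - x) + 1 *\<^sub>R p)) \<partial>lborel)"
    by (subst nn_integral_lborel_affine[where s=1 and x="y - x"]) auto
  also have "\<dots> \<le> (\<integral>\<^sup>+p. indicator (ball x s) p * ennreal (a p) + ennreal L * indicator (ball x s) p \<partial>lborel)"
  proof (intro nn_integral_mono)
    fix p
    have "indicator (ball y s) (y - x + 1 *\<^sub>R p) = (indicator (ball x s) p :: ennreal)"
      by (simp add: indicator_def dist_norm algebra_simps)
    moreover have "ennreal (a (y - x + p)) \<le> ennreal (a p) + ennreal L"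
      using cl[of p] assms(2,3) by (simp add: ennreal_plus[symmetric] add.commute del: ennreal_plus)
    ultimately show "indicator (ball y s) (y - x + 1 *\<^sub>R p) * ennreal (a (y - x + 1 *\<^sub>R p))
        \<le> indicator (ball x s) p * ennreal (a p) + ennreal L * indicator (ball x s) p"
      by (simp add: indicator_def)
  qed
  also have "\<dots> = (\<integral>\<^sup>+p. indicator (ball x s) p * ennreal (a p) \<partial>lborel) + ennreal L * emeasure lborel (ball x s)"
    by (subst nn_integral_add) (auto simp: nn_integral_cmult)
  also have "\<dots> \<le> ennreal L * emeasure lborel (ball x s) + ennreal L * emeasure lborel (ball x s)"
    by (intro add_mono good order_refl)
  also have "\<dots> = ennreal (2 * L) * emeasure lborel (ball x s)"
    using assms(3) by (simp add: distrib_right[symmetric] ennreal_plus[symmetric] del: ennreal_plus)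
  also have "emeasure lborel (ball x s) = emeasure lborel (ball y s)"
    by (cases "s \<ge> 0") (simp_all add: emeasure_ball ball_empty)
  finally show ?thesis .
qed

text \<open>The field \<open>avg_field \<epsilon> f\<close> has the right divergence, but its Jacobian is bounded only in the mean square. Where all averages of the Jacobian over balls are at most \<open>L\<close> it is Lipschitz with constant of order \<open>L\<close>, and the complement has measure of order \<open>1 / L\<^sup>2\<close>; extend from there, cut off and mollify.\<close>

lemma truncated_test_field:
  fixes f :: "real^'d \<Rightarrow> real" and \<Omega> :: "(real^'d) set"
  assumes f: "C1_deriv f f'" "\<And>x. \<bar>f x\<bar> \<le> 1" and \<epsilon>: "\<epsilon> > 0" "\<epsilon> \<le> 1"
    and \<Sigma>: "compact \<Sigma>" "\<Sigma> \<noteq> {}" "\<And>x. x \<notin> \<Sigma> \<Longrightarrow> f x = 0"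
    and \<Omega>: "open \<Omega>" "bounded \<Omega>" "\<And>x. infdist x \<Sigma> \<le> 3 * \<epsilon> \<Longrightarrow> x \<in> \<Omega>"
    and L: "L \<ge> 1" and e: "e > 0"
  obtains \<psi> \<psi>' where "test_fun \<Omega> \<psi>" "C1_deriv \<psi> \<psi>'"
    "\<And>x i j. \<bar>\<psi>' x (axis j 1) $ i\<bar> \<le> trunc_const CARD('d) * L"
    "(LINT x:\<Omega>|lebesgue. \<bar>(\<Sum>i\<in>UNIV. \<psi>' x (axis i 1) $ i) - (ball_avg \<epsilon> f x - f x)\<bar>)
       \<le> trunc_const CARD('d) * measure lebesgue \<Omega> / L + e"
proof -
  define N where "N = CARD('d)"
  have N1: "real N \<ge> 1" by (simp add: N_def Suc_le_eq)
  note cf = C1dD[OF f(1)]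
  define \<phi> where "\<phi> = avg_field \<epsilon> f"
  define \<phi>' where "\<phi>' = avg_field_deriv \<epsilon> f'"
  have \<phi>: "C1_deriv \<phi> \<phi>'" unfolding \<phi>_def \<phi>'_def by (rule avg_field_C1_deriv[OF f(1)])
  have div\<phi>: "(\<Sum>i\<in>UNIV. \<phi>' x (axis i 1) $ i) = ball_avg \<epsilon> f x - f x" for x
    unfolding \<phi>'_def by (rule avg_field_div[OF f(1) \<epsilon>(1)])
  have \<phi>le: "norm (\<phi> x) \<le> \<epsilon>" for x
    unfolding \<phi>_def by (rule norm_avg_field_le[OF cf(3) f(2) \<epsilon>(1)])
  have far: "dist x z > \<epsilon>" if "infdist x \<Sigma> > \<epsilon>" "z \<in> \<Sigma>" for x z
    using infdist_le[OF that(2), of x] that(1) by simp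
  have \<phi>0: "\<phi> x = 0" "ball_avg \<epsilon> f x = 0" if "infdist x \<Sigma> > \<epsilon>" for x
    using avg_field_support[OF \<Sigma>(3) \<epsilon>(1) far[OF that]] by (auto simp: \<phi>_def)
  obtain R0 where R0: "\<And>x. x \<in> \<Sigma> \<Longrightarrow> norm x \<le> R0"
    using \<Sigma>(1) compact_imp_bounded bounded_iff by metis
  define R where "R = R0 + 3 * \<epsilon>"
  have near: "infdist x \<Sigma> > 3 * \<epsilon>" if x: "norm x > R" for x
  proof -
    obtain z where z: "z \<in> \<Sigma>" "infdist x \<Sigma> = dist x z"
      using infdist_attains_inf[OF compact_imp_closed[OF \<Sigma>(1)] \<Sigma>(2)] by blast
    have "norm x \<le> norm z + dist x z" using norm_triangle_ineq2[of x z] by (simp add: dist_norm)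
    then show ?thesis using R0[OF z(1)] x z by (simp add: R_def)
  qed
  have \<phi>R: "\<phi> x = 0" if "norm x > R" for x
    using near[OF that] \<epsilon> by (intro \<phi>0) auto
  have \<phi>'R: "\<phi>' x h = 0" if "norm x > R" for x h
  proof -
    have "\<phi>' x h $ i = 0" for i
      by (rule C1_deriv_zero_outside[OF C1_deriv_component[OF \<phi>] _ that]) (simp add: \<phi>R)
    then show ?thesis by (simp add: vec_eq_iff)
  qed
  \<comment> \<open>The sum of the absolute entries is continuous, dominates the operator norm, and
    its square is comparable with the sum of squares in \<open>avg_field_L2\<close>.\<close>
  define a where "a x = (\<Sum>i\<in>UNIV. \<Sum>j\<in>UNIV. \<bar>\<phi>' x (axis j 1) $ i\<bar>)" for x
  have ac: "continuous_on UNIV a"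
    unfolding a_def by (intro continuous_intros C1dD(2)[OF \<phi>])
  have a0: "a x \<ge> 0" for x by (simp add: a_def sum_nonneg)
  have aR: "a x = 0" if "norm x > R" for x by (simp add: a_def \<phi>'R[OF that])
  have an: "norm (\<phi>' x h) \<le> a x * norm h" for x h
    unfolding a_def by (rule linear_norm_le_entries[OF C1dD(4)[OF \<phi>]])
  have [measurable]: "a \<in> borel_measurable borel" by (rule borel_measurable_continuous_onI[OF ac])
  have sub: "{x. infdist x \<Sigma> \<le> \<epsilon>} \<subseteq> \<Omega>" using \<Omega>(3) \<epsilon> by auto
  have \<Omega>m: "\<Omega> \<in> lmeasurable" by (simp add: \<Omega> lmeasurable_open)
  define V where "V = measure lebesgue \<Omega>"
  have V0: "V \<ge> 0" by (simp add: V_def)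
  have ia2: "integrable lebesgue (\<lambda>x. (a x)\<^sup>2)"
    by (rule integrable_continuous_compact[where R=R]) (auto simp: aR intro!: continuous_intros ac)
  \<comment> \<open>Cauchy-Schwarz over the entries costs the factor \<open>real N ^ 2\<close>. The
    number 4 is the square of the bound 2 for \<open>ball_avg \<epsilon> f x - f x\<close>, which
    vanishes off \<Omega>.\<close>
  have A2: "(LINT x|lebesgue. (a x)\<^sup>2) \<le> 4 * real N ^ 2 * V"
  proof -
    let ?q = "\<lambda>x. \<Sum>i\<in>UNIV. \<Sum>j\<in>UNIV. (\<phi>' x (axis j 1) $ i)\<^sup>2"
    have iq: "integrable lebesgue ?q"
      by (rule integrable_continuous_compact[where R=R]) (auto simp: \<phi>'R intro!: continuous_intros C1dD(2)[OF \<phi>])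
    have aq: "(a x)\<^sup>2 \<le> real N ^ 2 * ?q x" for x
    proof -
      have "(a x)\<^sup>2 = (\<Sum>p\<in>UNIV \<times> UNIV. \<bar>\<phi>' x (axis (snd p) 1) $ fst p\<bar>)\<^sup>2"
        by (simp add: a_def sum.cartesian_product case_prod_beta)
      also have "\<dots> \<le> (\<Sum>p\<in>UNIV \<times> UNIV. \<bar>\<phi>' x (axis (snd p) 1) $ fst p\<bar>\<^sup>2) * real (card (UNIV \<times> UNIV :: ('d \<times> 'd) set))"
        by (rule sum_squared_le_sum_of_squares)
      also have "\<dots> = real N ^ 2 * ?q x"
        by (simp add: sum.cartesian_product case_prod_beta N_def power2_eq_square card_cartesian_product)
      finally show ?thesis .
    qed
    have "(LINT x|lebesgue. (a x)\<^sup>2) \<le> (LINT x|lebesgue. real N ^ 2 * ?q x)"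
      using aq iq by (intro integral_mono ia2) auto
    also have "\<dots> = real N ^ 2 * (LINT x|lebesgue. (ball_avg \<epsilon> f x - f x)\<^sup>2)"
      using avg_field_L2[OF f(1) \<epsilon>(1), of R0] R0 \<Sigma>(3) unfolding \<phi>'_def by auto
    finally have *: "(LINT x|lebesgue. (a x)\<^sup>2) \<le> real N ^ 2 * (LINT x|lebesgue. (ball_avg \<epsilon> f x - f x)\<^sup>2)" .
    have "(LINT x|lebesgue. (ball_avg \<epsilon> f x - f x)\<^sup>2) \<le> (LINT x|lebesgue. 4 * indicator \<Omega> x)"
    proof (rule integral_mono)
      have z: "ball_avg \<epsilon> f x - f x = 0" if "x \<notin> \<Omega>" for x
      proof -
        have i: "infdist x \<Sigma> > \<epsilon>" using that sub by (cases "infdist x \<Sigma> \<le> \<epsilon>") auto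
        then have "x \<notin> \<Sigma>" using \<epsilon> by auto
        then show ?thesis using \<Sigma>(3) \<phi>0(2)[OF i] by simp
      qed
      show "integrable lebesgue (\<lambda>x. (ball_avg \<epsilon> f x - f x)\<^sup>2)"
      proof (rule integrable_continuous_compact[where R=R])
        fix x :: "real^'d" assume "norm x > R"
        then have "x \<notin> \<Sigma>" "infdist x \<Sigma> > \<epsilon>"
          using R0 near[of x] \<epsilon> by (auto simp: R_def)
        then show "(ball_avg \<epsilon> f x - f x)\<^sup>2 = 0" using \<Sigma>(3) \<phi>0(2) by simp
      qed (intro continuous_intros ball_avg_continuous cf(3))
      show "integrable lebesgue (\<lambda>x. 4 * indicator \<Omega> x :: real)"
        using \<Omega>m by (simp add: lmeasurable_iff_integrable)
      fix x
      show "(ball_avg \<epsilon> f x - f x)\<^sup>2 \<le> 4 * indicator \<Omega> x"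
      proof (cases "x \<in> \<Omega>")
        case True
        have "\<bar>ball_avg \<epsilon> f x - f x\<bar> \<le> 2"
          using ball_avg_bound[OF cf(3) f(2), of \<epsilon> x] f(2)[of x] by linarith
        then have "\<bar>ball_avg \<epsilon> f x - f x\<bar>\<^sup>2 \<le> 2\<^sup>2" by (intro power_mono) auto
        then show ?thesis using True by simp
      qed (simp add: z)
    qed
    also have "(LINT x|lebesgue. 4 * indicator \<Omega> x) = 4 * V"
      using \<Omega>m by (simp add: V_def)
    finally have "real N ^ 2 * (LINT x|lebesgue. (ball_avg \<epsilon> f x - f x)\<^sup>2) \<le> real N ^ 2 * (4 * V)"
      by (intro mult_left_mono) auto
    with * show ?thesis by simp
  qed
  \<comment> \<open>Radii up to 1 suffice: for points further apart than 1 the Lipschitz bound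
    follows from the smallness of \<phi>.\<close>
  define X where "X = {x. \<exists>s. 0 < s \<and> s \<le> 1 \<and> \<not> ((\<integral>\<^sup>+p. indicator (ball x s) p * ennreal (a p) \<partial>lborel) \<le> ennreal L * emeasure lborel (ball x s))}"
  have bad: "\<exists>s. 0 < s \<and> s \<le> 1 \<and> ennreal (L\<^sup>2) * emeasure lborel (ball x s) \<le> (\<integral>\<^sup>+p. indicator (ball x s) p * ennreal ((a p)\<^sup>2) \<partial>lborel)"
    if xX: "x \<in> X" for x
  proof -
    from xX obtain s where s: "0 < s" "s \<le> 1" "\<not> ((\<integral>\<^sup>+p. indicator (ball x s) p * ennreal (a p) \<partial>lborel) \<le> ennreal L * emeasure lborel (ball x s))"
      unfolding X_def mem_Collect_eq by (elim exE conjE)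
    have "\<not> (\<integral>\<^sup>+p. indicator (ball x s) p * ennreal ((a p)\<^sup>2) \<partial>lborel) \<le> ennreal (L\<^sup>2) * emeasure lborel (ball x s)"
    proof
      assume "(\<integral>\<^sup>+p. indicator (ball x s) p * ennreal ((a p)\<^sup>2) \<partial>lborel) \<le> ennreal (L\<^sup>2) * emeasure lborel (ball x s)"
      from bound_of_average_quadratic[OF \<open>a \<in> borel_measurable borel\<close> a0 _ this] L s(3)
      show False by simp
    qed
    then show ?thesis using s(1,2) by (meson linear)
  qed
  have "(\<lambda>p. ennreal ((a p)\<^sup>2)) \<in> borel_measurable borel" by measurable
  then obtain W where W: "open W" "X \<subseteq> W" "ennreal (L\<^sup>2) * emeasure lborel W \<le> ennreal (5 ^ N) * (\<integral>\<^sup>+p. ennreal ((a p)\<^sup>2) \<partial>lborel)"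
    by (rule weak_type_covering[where X=X and c="ennreal (L\<^sup>2)"]) (auto intro: bad simp: N_def)
  have "(\<integral>\<^sup>+p. ennreal ((a p)\<^sup>2) \<partial>lborel) = (\<integral>\<^sup>+p. ennreal ((a p)\<^sup>2) \<partial>lebesgue)"
    by (simp add: nn_integral_completion)
  also have "\<dots> = ennreal (LINT x|lebesgue. (a x)\<^sup>2)"
    by (rule nn_integral_eq_integral[OF ia2]) simp
  also have "\<dots> \<le> ennreal (4 * real N ^ 2 * V)" by (rule ennreal_leI[OF A2])
  finally have "ennreal (5 ^ N) * (\<integral>\<^sup>+p. ennreal ((a p)\<^sup>2) \<partial>lborel) \<le> ennreal (5 ^ N) * ennreal (4 * real N ^ 2 * V)"
    by (intro mult_left_mono) auto
  with W(3) have W3: "ennreal (L\<^sup>2) * emeasure lborel W \<le> ennreal (5 ^ N * (4 * real N ^ 2 * V))"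
    using V0 by (simp add: ennreal_mult)
  have Wfin: "emeasure lborel W < \<infinity>"
  proof (rule ccontr)
    assume "\<not> emeasure lborel W < \<infinity>"
    then have "emeasure lborel W = \<infinity>" using less_top[of "emeasure lborel W"] by auto
    then show False using W3 L by (simp add: ennreal_mult_top top_unique)
  qed
  define w where "w = measure lebesgue W"
  have w0: "w \<ge> 0" by (simp add: w_def)
  have Wm: "W \<in> lmeasurable"
    using W(1) Wfin by (simp add: fmeasurable_def borel_open)
  have eW: "emeasure lborel W = ennreal w"
    using Wfin W(1) by (simp add: w_def measure_def borel_open less_top)
  have wle: "L\<^sup>2 * w \<le> 5 ^ N * (4 * real N ^ 2 * V)"
    using W3 V0 w0 unfolding eW by (simp add: ennreal_mult[symmetric])
  define G where "G = - W"
  have Gne: "G \<noteq> {}"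
  proof
    assume "G = {}"
    then have "W = UNIV" by (auto simp: G_def)
    then show False using Wfin by simp
  qed
  have good: "(\<integral>\<^sup>+p. indicator (ball x s) p * ennreal (a p) \<partial>lborel) \<le> ennreal L * emeasure lborel (ball x s)"
    if "x \<in> G" "0 < s" "s \<le> 1" for x s
  proof (rule ccontr)
    assume "\<not> ?thesis"
    then have "x \<in> X" unfolding X_def mem_Collect_eq using that by (intro exI[of _ s] conjI)
    then show False using that W(2) by (auto simp: G_def)
  qed
  \<comment> \<open>Off the bad set each diagonal entry may differ by \<omega>, which sums and
    integrates to at most e. Adding 1 to the volume avoids division by zero.\<close>
  define \<omega> where "\<omega> = e / (real N * (V + 1))"
  have \<omega>: "\<omega> > 0" using e V0 N1 by (simp add: \<omega>_def)
  obtain \<tau>1 where \<tau>1: "\<tau>1 > 0" "\<And>x y. dist x y \<le> \<tau>1 \<Longrightarrow> norm (a x - a y) \<le> L"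
    by (rule uniform_continuity_compact_support[OF ac aR, of R L]) (use L in auto)
  have "\<exists>d>0. \<forall>x y. dist x y \<le> d \<longrightarrow> norm (\<phi>' x (axis j 1) - \<phi>' y (axis j 1)) \<le> \<omega> / (real N)\<^sup>2" for j
    by (rule uniform_continuity_compact_support[OF C1dD(2)[OF \<phi>, of "axis j 1"] \<phi>'R, of R "\<omega> / (real N)\<^sup>2"])
       (use \<omega> N1 in auto)
  then obtain dj where dj: "\<And>j. dj j > 0" "\<And>j x y. dist x y \<le> dj j \<Longrightarrow> norm (\<phi>' x (axis j 1) - \<phi>' y (axis j 1)) \<le> \<omega> / (real N)\<^sup>2"
    by metis
  define \<tau>2 where "\<tau>2 = Min (range dj)"
  have \<tau>2: "\<tau>2 > 0" "\<tau>2 \<le> dj j" for j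
    using dj(1) by (auto simp: \<tau>2_def)
  have \<phi>'close: "norm (\<phi>' x h - \<phi>' y h) \<le> \<omega> * norm h" if "dist x y \<le> \<tau>2" for x y h
  proof -
    have lin: "linear (\<lambda>h. \<phi>' x h - \<phi>' y h)"
      by (intro linear_compose_sub C1dD(4)[OF \<phi>])
    have "norm (\<phi>' x h - \<phi>' y h) \<le> (\<Sum>i\<in>UNIV. \<Sum>j\<in>UNIV. \<bar>(\<phi>' x (axis j 1) - \<phi>' y (axis j 1)) $ i\<bar>) * norm h"
      by (rule linear_norm_le_entries[OF lin])
    also have "\<dots> \<le> (\<Sum>i\<in>(UNIV::'d set). \<Sum>j\<in>(UNIV::'d set). \<omega> / (real N)\<^sup>2) * norm h"
      using that \<tau>2(2)
      by (intro mult_right_mono sum_mono order_trans[OF component_le_norm_cart] dj) (auto intro: order_trans)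
    also have "\<dots> = \<omega> * norm h"
      using N1 by (simp add: N_def power2_eq_square)
    finally show ?thesis .
  qed
  \<comment> \<open>Three demands on the mollification scale: within \<open>\<tau>1\<close> the
    function a varies by at most L, within \<open>\<tau>2\<close> the derivative of \<phi> varies by
    at most \<omega>, and within \<epsilon> the support remains under control.\<close>
  define \<tau> where "\<tau> = min (min \<tau>1 \<tau>2) \<epsilon>"
  have \<tau>: "\<tau> > 0" "\<tau> \<le> \<tau>1" "\<tau> \<le> \<tau>2" "\<tau> \<le> \<epsilon>"
    using \<tau>1 \<tau>2(1) \<epsilon> by (auto simp: \<tau>_def)
  \<comment> \<open>The extension is to agree with \<phi> on a whole neighbourhood of the good set.
    Agreement on \<open>G\<close> alone would say nothing about the derivative of the mollified
    extension there.\<close>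
  define G' where "G' = {y. \<exists>x\<in>G. dist x y \<le> \<tau>}"
  have GG': "x \<in> G'" if "x \<in> G" for x
    using that \<tau> unfolding G'_def by (auto intro!: bexI[of _ x])
  then have G'ne: "G' \<noteq> {}" using Gne by blast
  have good': "(\<integral>\<^sup>+p. indicator (ball y s) p * ennreal (a p) \<partial>lborel) \<le> ennreal (2 * L) * emeasure lborel (ball y s)"
    if y: "y \<in> G'" "0 < s" "s \<le> 1" for y s
  proof -
    obtain x where x: "x \<in> G" "dist x y \<le> \<tau>" using y by (auto simp: G'_def)
    show ?thesis
    proof (rule good_points_translate[where L=L and x=x and y=y])
      fix p
      have "dist (p + (y - x)) p \<le> \<tau>1" using x(2) \<tau>(2) by (simp add: dist_norm norm_minus_commute)
      from \<tau>1(2)[OF this] show "a (p + (y - x)) \<le> a p + L" by simp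
    qed (use L good x y a0 in auto)
  qed
  \<comment> \<open>\<open>good_points_Lipschitz\<close> contributes the power with exponent N + 1,
    and passing from \<open>G\<close> to \<open>G'\<close> a further factor 2.\<close>
  define K where "K = 2 ^ (N + 2) * L"
  have K: "K \<ge> 4"
  proof -
    have "(4::real) * 1 \<le> (2 ^ N * 4) * L" using L by (intro mult_mono) auto
    then show ?thesis by (simp add: K_def)
  qed
  have \<phi>Lip: "norm (\<phi> x - \<phi> y) \<le> K * dist x y" if "x \<in> G'" "y \<in> G'" for x y
  proof (cases "dist x y \<le> 1")
    case True
    have "norm (\<phi> x - \<phi> y) \<le> 2 ^ (DIM(real^'d) + 1) * (2 * L) * dist x y"
      by (rule good_points_Lipschitz[OF \<phi> ac a0 an]) (use L True good' that in auto)
    then show ?thesis by (simp add: K_def N_def)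
  next
    case False
    have "norm (\<phi> x - \<phi> y) \<le> \<epsilon> + \<epsilon>"
      using norm_triangle_ineq4[of "\<phi> x" "\<phi> y"] \<phi>le[of x] \<phi>le[of y] by simp
    also have "\<dots> \<le> 4 * 1" using \<epsilon> by simp
    also have "\<dots> \<le> K * dist x y" using False K by (intro mult_mono) auto
    finally show ?thesis .
  qed
  have "\<exists>H. (\<forall>x y. \<bar>H x - H y\<bar> \<le> K * dist x y) \<and> (\<forall>x\<in>G'. H x = \<phi> x $ i)" for i
  proof (rule Lipschitz_extension[OF G'ne, of K "\<lambda>x. \<phi> x $ i"])
    show "\<bar>\<phi> x $ i - \<phi> y $ i\<bar> \<le> K * dist x y" if "x \<in> G'" "y \<in> G'" for x y
      using component_le_norm_cart[of "\<phi> x - \<phi> y" i] \<phi>Lip[OF that] by simp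
  qed (use K in auto)
  then obtain H where H: "\<And>i x y. \<bar>H i x - H i y\<bar> \<le> K * dist x y" "\<And>i x. x \<in> G' \<Longrightarrow> H i x = \<phi> x $ i"
    by metis
  \<comment> \<open>The cutoff is 1 up to distance \<epsilon> from \<Sigma>, beyond which \<phi>
    vanishes, and 0 from distance 2 \<epsilon> on. Clipping the components at \<epsilon> keeps the
    product with a cutoff of slope 1 / \<epsilon> Lipschitz with constant \<open>K + 1\<close>.
    Neither operation alters \<phi> itself.\<close>
  define \<theta> where "\<theta> x = max 0 (min 1 (2 - infdist x \<Sigma> / \<epsilon>))" for x
  define cl where "cl t = max (- \<epsilon>) (min \<epsilon> t)" for t
  define h where "h x = (\<chi> i. \<theta> x * cl (H i x))" for x
  have \<theta>: "0 \<le> \<theta> x" "\<theta> x \<le> 1" "\<bar>\<theta> x - \<theta> y\<bar> \<le> dist x y / \<epsilon>" for x y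
  proof -
    have "\<bar>\<theta> x - \<theta> y\<bar> \<le> \<bar>infdist x \<Sigma> / \<epsilon> - infdist y \<Sigma> / \<epsilon>\<bar>"
      unfolding \<theta>_def by (simp add: max_def min_def abs_if)
    also have "\<dots> = \<bar>infdist x \<Sigma> - infdist y \<Sigma>\<bar> / \<epsilon>"
      using \<epsilon> by (simp add: diff_divide_distrib[symmetric])
    also have "\<dots> \<le> dist x y / \<epsilon>" using \<epsilon> by (intro divide_right_mono infdist_triangle_abs) auto
    finally show "\<bar>\<theta> x - \<theta> y\<bar> \<le> dist x y / \<epsilon>" .
  qed (auto simp: \<theta>_def)
  have cl: "\<bar>cl t\<bar> \<le> \<epsilon>" "\<bar>cl s - cl t\<bar> \<le> \<bar>s - t\<bar>" for s t
    using \<epsilon> by (auto simp: cl_def max_def min_def abs_if)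
  have hLip1: "\<bar>h x $ i - h y $ i\<bar> \<le> (K + 1) * dist x y" for x y i
  proof -
    have "h x $ i - h y $ i = \<theta> x * (cl (H i x) - cl (H i y)) + (\<theta> x - \<theta> y) * cl (H i y)"
      by (simp add: h_def algebra_simps)
    then have "\<bar>h x $ i - h y $ i\<bar> \<le> \<bar>\<theta> x\<bar> * \<bar>cl (H i x) - cl (H i y)\<bar> + \<bar>\<theta> x - \<theta> y\<bar> * \<bar>cl (H i y)\<bar>"
      using abs_triangle_ineq[of "\<theta> x * (cl (H i x) - cl (H i y))" "(\<theta> x - \<theta> y) * cl (H i y)"] by (simp add: abs_mult)
    also have "\<dots> \<le> 1 * (K * dist x y) + (dist x y / \<epsilon>) * \<epsilon>"
      using \<theta>[of x] \<theta>(3)[of x y] cl(1)[of "H i y"] order_trans[OF cl(2) H(1), of i x y] \<epsilon> K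
      by (intro add_mono mult_mono) auto
    also have "\<dots> = (K + 1) * dist x y" using \<epsilon> by (simp add: algebra_simps)
    finally show ?thesis .
  qed
  have hLip: "norm (h x - h y) \<le> real N * (K + 1) * dist x y" for x y
  proof -
    have "norm (h x - h y) \<le> (\<Sum>i\<in>(UNIV::'d set). (K + 1) * dist x y)"
      by (intro order_trans[OF norm_le_l1_cart] sum_mono) (use hLip1 in simp)
    then show ?thesis by (simp add: N_def)
  qed
  have hc: "continuous_on UNIV h"
  proof (rule lipschitz_on_continuous_on)
    show "(real N * (K + 1))-lipschitz_on UNIV h"
      using hLip K by (intro lipschitz_onI) (auto simp: dist_norm)
  qed
  have h0: "h x = 0" if "infdist x \<Sigma> \<ge> 2 * \<epsilon>" for x
  proof -
    have "\<theta> x = 0" using that \<epsilon> by (simp add: \<theta>_def field_simps)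
    then show ?thesis by (simp add: h_def vec_eq_iff)
  qed
  have hR: "h x = 0" if "norm x > R" for x
    using near[OF that] \<epsilon> by (intro h0) auto
  have h\<phi>: "h x = \<phi> x" if x: "x \<in> G'" for x
  proof -
    have "\<theta> x * cl (\<phi> x $ i) = \<phi> x $ i" for i
    proof (cases "infdist x \<Sigma> \<le> \<epsilon>")
      case True
      then have "infdist x \<Sigma> / \<epsilon> \<le> 1" using \<epsilon> by simp
      then have "\<theta> x = 1" by (simp add: \<theta>_def)
      moreover have "\<bar>\<phi> x $ i\<bar> \<le> \<epsilon>"
        using component_le_norm_cart[of "\<phi> x" i] \<phi>le[of x] by simp
      then have "cl (\<phi> x $ i) = \<phi> x $ i" by (auto simp: cl_def)
      ultimately show ?thesis by simp
    next
      case False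
      then have "\<phi> x = 0" by (intro \<phi>0) auto
      then show ?thesis using \<epsilon> by (simp add: cl_def)
    qed
    then show ?thesis by (simp add: h_def H(2)[OF x] vec_eq_iff)
  qed
  have \<tau>2': "\<tau> / 2 > 0" using \<tau> by simp
  obtain \<psi> \<psi>' where \<psi>: "smooth \<psi>" "C1_deriv \<psi> \<psi>'"
    and \<psi>avg: "\<And>x c e. (\<And>y. dist x y \<le> \<tau> / 2 \<Longrightarrow> norm (h y - c) \<le> e) \<Longrightarrow> norm (\<psi> x - c) \<le> e"
    and \<psi>D: "\<And>x v T \<omega> \<sigma>. linear T \<Longrightarrow> \<sigma> > 0 \<Longrightarrow>
       (\<And>y w. dist x y \<le> \<tau> / 2 \<Longrightarrow> norm w \<le> \<sigma> \<Longrightarrow> norm (h (y + w) - h y - T w) \<le> \<omega> * norm w)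
       \<Longrightarrow> norm (\<psi>' x v - T v) \<le> \<omega> * norm v"
    using mollification[OF hc hR \<tau>2'] by metis
  have \<psi>0: "\<psi> x = 0" if "infdist x \<Sigma> > 3 * \<epsilon>" for x
  proof -
    have "norm (\<psi> x - 0) \<le> 0"
    proof (rule \<psi>avg)
      fix y assume "dist x y \<le> \<tau> / 2"
      then have "infdist y \<Sigma> \<ge> 2 * \<epsilon>"
        using infdist_triangle[of x \<Sigma> y] that \<tau> by linarith
      then show "norm (h y - 0) \<le> 0" by (simp add: h0)
    qed
    then show ?thesis by simp
  qed
  have test: "test_fun \<Omega> \<psi>"
  proof -
    let ?C = "{x. infdist x \<Sigma> \<le> 3 * \<epsilon>}"
    have cC: "closed ?C"
      by (intro closed_Collect_le continuous_intros)
    have "bounded ?C"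
      using near by (auto simp: bounded_iff intro!: exI[of _ R]) (meson not_le)
    then have "compact ?C" using cC compact_eq_bounded_closed by blast
    moreover have s: "closure {x. \<psi> x \<noteq> 0} \<subseteq> ?C"
      using \<psi>0 cC by (intro closure_minimal) (auto simp: not_less[symmetric])
    ultimately have "compact (closure {x. \<psi> x \<noteq> 0})"
      by (metis closed_closure compact_Int_closed inf.absorb_iff2)
    then show ?thesis
      using \<psi>(1) s \<Omega>(3) by (auto simp: test_fun_def)
  qed
  have \<psi>'bound: "\<bar>\<psi>' x (axis j 1) $ i\<bar> \<le> real N * (K + 1)" for x i j
  proof -
    have "norm (\<psi>' x (axis j 1) - 0) \<le> (real N * (K + 1)) * norm (axis j (1::real) :: real^'d)"
    proof (rule \<psi>D[of "\<lambda>_. 0" 1])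
      fix y w :: "real^'d"
      show "norm (h (y + w) - h y - 0) \<le> real N * (K + 1) * norm w"
        using hLip[of "y + w" y] by (simp add: dist_norm)
    qed (auto intro: linear_zero)
    then show ?thesis using component_le_norm_cart[of "\<psi>' x (axis j 1)" i] by simp
  qed
  \<comment> \<open>All points that occur lie in the ball of radius \<tau> about x, hence in
    \<open>G'\<close>, where \<open>h\<close> is \<phi>. The mean value inequality is applied to
    \<phi> minus its linearisation at x.\<close>
  have \<psi>'close: "norm (\<psi>' x v - \<phi>' x v) \<le> \<omega> * norm v" if x: "x \<in> G" for x v
  proof (rule \<psi>D[OF C1dD(4)[OF \<phi>] \<tau>2'])
    fix y w :: "real^'d" assume y: "dist x y \<le> \<tau> / 2" and w: "norm w \<le> \<tau> / 2"
    have y': "dist x y \<le> \<tau>" "dist x (y + w) \<le> \<tau>"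
      using y w \<tau> norm_triangle_ineq4[of "x - y" w] by (auto simp: dist_norm algebra_simps)
    then have "h y = \<phi> y" "h (y + w) = \<phi> (y + w)"
      using x by (auto intro!: h\<phi> simp: G'_def)
    moreover have "norm ((\<lambda>z. \<phi> z - \<phi>' x z) (y + w) - (\<lambda>z. \<phi> z - \<phi>' x z) y) \<le> \<omega> * norm ((y + w) - y)"
    proof (rule differentiable_bound[of "cball x \<tau>"])
      fix z assume z: "z \<in> cball x \<tau>"
      show "((\<lambda>z. \<phi> z - \<phi>' x z) has_derivative (\<lambda>h. \<phi>' z h - \<phi>' x h)) (at z within cball x \<tau>)"
        by (rule has_derivative_at_withinI[OF has_derivative_diff[OF C1dD(1)[OF \<phi>]
             linear_imp_has_derivative[OF C1dD(4)[OF \<phi>]]]])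
      have "dist z x \<le> \<tau>2" using z \<tau> by (simp add: dist_commute)
      then show "onorm (\<lambda>h. \<phi>' z h - \<phi>' x h) \<le> \<omega>"
        by (intro onorm_bound \<phi>'close) (use \<omega> in auto)
    qed (use y' in auto)
    ultimately show "norm (h (y + w) - h y - \<phi>' x w) \<le> \<omega> * norm w"
      by (simp add: linear_add[OF C1dD(4)[OF \<phi>]] algebra_simps)
  qed
  \<comment> \<open>On the bad set nothing is gained from cancellation: the first summand bounds the
    divergence of the truncated field, and L together with a^2 / L bounds that of the original
    field.\<close>
  define B where "B = real N ^ 2 * (K + 1) + L"
  have B0: "B \<ge> 0" using K L by (simp add: B_def)
  have diff: "\<bar>(\<Sum>i\<in>UNIV. \<psi>' x (axis i 1) $ i) - (ball_avg \<epsilon> f x - f x)\<bar> * indicator \<Omega> x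
      \<le> real N * \<omega> * indicator \<Omega> x + B * indicator W x + (1 / L) * (a x)\<^sup>2" for x
  proof (cases "x \<in> \<Omega>")
    case x\<Omega>: True
    let ?l = "\<bar>(\<Sum>i\<in>UNIV. \<psi>' x (axis i 1) $ i) - (\<Sum>i\<in>UNIV. \<phi>' x (axis i 1) $ i)\<bar>"
    have a2: "(1 / L) * (a x)\<^sup>2 \<ge> 0" using L by simp
    have "?l \<le> real N * \<omega> + B * indicator W x + (1 / L) * (a x)\<^sup>2"
    proof (cases "x \<in> W")
      case False
      then have xG: "x \<in> G" by (simp add: G_def)
      have "?l \<le> (\<Sum>i\<in>UNIV. \<bar>\<psi>' x (axis i 1) $ i - \<phi>' x (axis i 1) $ i\<bar>)"
        unfolding sum_subtractf[symmetric] by (rule sum_abs)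
      also have "\<dots> \<le> (\<Sum>i\<in>(UNIV::'d set). \<omega>)"
      proof (rule sum_mono)
        fix i :: 'd
        show "\<bar>\<psi>' x (axis i 1) $ i - \<phi>' x (axis i 1) $ i\<bar> \<le> \<omega>"
          using component_le_norm_cart[of "\<psi>' x (axis i 1) - \<phi>' x (axis i 1)" i] \<psi>'close[OF xG, of "axis i 1"] by simp
      qed
      finally show ?thesis using False a2 by (simp add: N_def)
    next
      case True
      have "\<bar>\<Sum>i\<in>UNIV. \<psi>' x (axis i 1) $ i\<bar> \<le> (\<Sum>i\<in>(UNIV::'d set). real N * (K + 1))"
        by (intro order_trans[OF sum_abs] sum_mono \<psi>'bound)
      then have 1: "\<bar>\<Sum>i\<in>UNIV. \<psi>' x (axis i 1) $ i\<bar> \<le> real N ^ 2 * (K + 1)"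
        by (simp add: N_def power2_eq_square mult.assoc)
      have "\<bar>\<Sum>i\<in>UNIV. \<phi>' x (axis i 1) $ i\<bar> \<le> (\<Sum>i\<in>UNIV. \<bar>\<phi>' x (axis i 1) $ i\<bar>)"
        by (rule sum_abs)
      also have "\<dots> \<le> a x"
        unfolding a_def by (intro sum_mono member_le_sum[where f="\<lambda>j. \<bar>\<phi>' x (axis j 1) $ _\<bar>"]) auto
      also have "\<dots> \<le> L + (1 / L) * (a x)\<^sup>2"
      proof (cases "a x \<le> L")
        case False
        then have "a x * L \<le> a x * a x" using a0[of x] by (intro mult_left_mono) auto
        then show ?thesis using L by (simp add: field_simps power2_eq_square add_increasing)
      qed (use a2 in simp)
      finally have 2: "\<bar>\<Sum>i\<in>UNIV. \<phi>' x (axis i 1) $ i\<bar> \<le> L + (1 / L) * (a x)\<^sup>2" .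
      have "?l \<le> B + (1 / L) * (a x)\<^sup>2"
        using 1 2 unfolding B_def by linarith
      moreover have "real N * \<omega> \<ge> 0" using \<omega> by simp
      ultimately show ?thesis using True by simp
    qed
    then show ?thesis using x\<Omega> by (simp add: div\<phi>)
  next
    case False
    then show ?thesis using B0 L by (simp add: indicator_def)
  qed
  have int: "(LINT x:\<Omega>|lebesgue. \<bar>(\<Sum>i\<in>UNIV. \<psi>' x (axis i 1) $ i) - (ball_avg \<epsilon> f x - f x)\<bar>)
     \<le> real N * \<omega> * V + B * w + (1 / L) * (4 * real N ^ 2 * V)"
  proof -
    have iW: "integrable lebesgue (indicator W :: _ \<Rightarrow> real)" and iO: "integrable lebesgue (indicator \<Omega> :: _ \<Rightarrow> real)"
      using Wm \<Omega>m by (auto simp: lmeasurable_iff_integrable)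
    have irhs: "integrable lebesgue (\<lambda>x. real N * \<omega> * indicator \<Omega> x + B * indicator W x + (1 / L) * (a x)\<^sup>2)"
      using iW iO ia2 by (intro Bochner_Integration.integrable_add integrable_mult_right) auto
    have "(LINT x:\<Omega>|lebesgue. \<bar>(\<Sum>i\<in>UNIV. \<psi>' x (axis i 1) $ i) - (ball_avg \<epsilon> f x - f x)\<bar>)
       \<le> (LINT x|lebesgue. real N * \<omega> * indicator \<Omega> x + B * indicator W x + (1 / L) * (a x)\<^sup>2)"
      unfolding set_lebesgue_integral_def
    proof (rule integral_mono_AE'[OF irhs])
      show "AE x in lebesgue. indicator \<Omega> x *\<^sub>R \<bar>(\<Sum>i\<in>UNIV. \<psi>' x (axis i 1) $ i) - (ball_avg \<epsilon> f x - f x)\<bar>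
         \<le> real N * \<omega> * indicator \<Omega> x + B * indicator W x + (1 / L) * (a x)\<^sup>2"
        using diff by (simp add: mult.commute)
      show "AE x in lebesgue. 0 \<le> real N * \<omega> * indicator \<Omega> x + B * indicator W x + (1 / L) * (a x)\<^sup>2"
        by (intro AE_I2 add_nonneg_nonneg mult_nonneg_nonneg) (use B0 \<omega> L in auto)
    qed
    also have "\<dots> = real N * \<omega> * V + B * w + (1 / L) * (LINT x|lebesgue. (a x)\<^sup>2)"
      using iW iO ia2 Wm \<Omega>m by (simp add: V_def w_def)
    also have "\<dots> \<le> real N * \<omega> * V + B * w + (1 / L) * (4 * real N ^ 2 * V)"
      using A2 L by (intro add_left_mono mult_left_mono) auto
    finally show ?thesis .
  qed
  define C1 where "C1 = real N ^ 2 * (2 ^ (N + 2) + 1) + 1"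
  have BC: "B \<le> C1 * L"
  proof -
    have "real N ^ 2 * 1 \<le> real N ^ 2 * L" using L by (intro mult_left_mono) auto
    then show ?thesis by (simp add: B_def C1_def K_def algebra_simps)
  qed
  have C10: "C1 \<ge> 0" by (simp add: C1_def)
  have "B * w \<le> C1 * L * w" using BC w0 by (rule mult_right_mono)
  also have "\<dots> = C1 * (L\<^sup>2 * w) / L" using L by (simp add: power2_eq_square)
  also have "\<dots> \<le> C1 * (5 ^ N * (4 * real N ^ 2 * V)) / L"
    using wle C10 L by (intro divide_right_mono mult_left_mono) auto
  finally have Bw: "B * w \<le> C1 * (5 ^ N * (4 * real N ^ 2 * V)) / L" .
  have "real N * \<omega> * V = e * (V / (V + 1))" using N1 by (simp add: \<omega>_def)
  also have "\<dots> \<le> e * 1" using e V0 by (intro mult_left_mono) auto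
  finally have N\<omega>: "real N * \<omega> * V \<le> e" by simp
  have fin: "(LINT x:\<Omega>|lebesgue. \<bar>(\<Sum>i\<in>UNIV. \<psi>' x (axis i 1) $ i) - (ball_avg \<epsilon> f x - f x)\<bar>) \<le> trunc_const N * V / L + e"
  proof -
    have "C1 * (5 ^ N * (4 * real N ^ 2 * V)) / L + (1 / L) * (4 * real N ^ 2 * V) = trunc_const N * V / L"
      unfolding trunc_const_def C1_def[symmetric] by (simp add: add_divide_distrib[symmetric] algebra_simps)
    then show ?thesis using int Bw N\<omega> by linarith
  qed
  have "real N * (K + 1) \<le> trunc_const N * L"
  proof -
    have p1: "(1::real) \<le> 5 ^ N" by simp
    have "real N * 1 \<le> real N * real N" using N1 by (intro mult_left_mono) auto
    then have "real N * (2 ^ (N + 2) + 1) \<le> real N ^ 2 * (2 ^ (N + 2) + 1)"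
      by (intro mult_right_mono) (auto simp: power2_eq_square)
    also have "\<dots> \<le> C1" by (simp add: C1_def)
    also have "\<dots> \<le> trunc_const N"
    proof -
      have "1 \<le> real N * real N" using mult_mono[OF N1 N1] by simp
      then have "(1::real) * 1 \<le> (4 * real N ^ 2) * 5 ^ N"
        by (intro mult_mono) (simp_all add: power2_eq_square)
      from mult_right_mono[OF this C10]
      have "C1 \<le> 4 * real N ^ 2 * 5 ^ N * C1" by simp
      then show ?thesis unfolding trunc_const_def C1_def[symmetric] by (intro add_increasing2) auto
    qed
    finally have "real N * (2 ^ (N + 2) + 1) * L \<le> trunc_const N * L"
      using L by (intro mult_right_mono) auto
    moreover have "real N * (K + 1) \<le> real N * (2 ^ (N + 2) + 1) * L"
    proof -
      have "K + 1 \<le> (2 ^ (N + 2) + 1) * L" using L by (simp add: K_def algebra_simps)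
      then show ?thesis by (simp add: mult.assoc mult_left_mono)
    qed
    ultimately show ?thesis by simp
  qed
  then have "\<bar>\<psi>' x (axis j 1) $ i\<bar> \<le> trunc_const N * L" for x i j
    using \<psi>'bound[of x j i] by simp
  then show thesis
    using that[OF test \<psi>(2)] fin unfolding N_def V_def by blast
qed

section \<open>An asymptotic bound in the mean square\<close>

lemma continuous_bounded_on_cball:
  fixes g :: "'a::euclidean_space \<Rightarrow> real"
  assumes "continuous_on UNIV g"
  obtains M where "\<And>x. x \<in> cball 0 R \<Longrightarrow> \<bar>g x\<bar> \<le> M"
proof -
  have "compact (g ` cball 0 R)"
    by (intro compact_continuous_image continuous_on_subset[OF assms]) auto
  then have "bounded (g ` cball 0 R)" by (rule compact_imp_bounded)
  then obtain M where "\<forall>y\<in>g ` cball 0 R. norm y \<le> M" unfolding bounded_iff by blast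
  then show thesis by (intro that[of M]) auto
qed

lemma integral_lborel_affine:
  fixes x :: "'a::euclidean_space" and g :: "'a \<Rightarrow> real"
  assumes g: "g \<in> borel_measurable borel" and s: "s > 0"
  shows "(LINT p|lebesgue. g p) = s ^ DIM('a) * (LINT y|lebesgue. g (x - s *\<^sub>R y))"
proof -
  have [measurable]: "g \<in> borel_measurable borel" by (rule g)
  have T: "(\<lambda>y. x - s *\<^sub>R y) \<in> borel_measurable borel" by measurable
  have "(LINT p|lebesgue. g p) = (LINT p|lborel. g p)"
    by (simp add: integral_completion)
  also have "\<dots> = (LINT p|density (distr lborel borel (\<lambda>y. x - s *\<^sub>R y)) (\<lambda>_. ennreal (s ^ DIM('a))). g p)"
    using lborel_affine[of "- s" x] s by simp
  also have "\<dots> = (LINT p|distr lborel borel (\<lambda>y. x - s *\<^sub>R y). s ^ DIM('a) * g p)"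
    using s by (subst integral_density) auto
  also have "\<dots> = s ^ DIM('a) * (LINT y|lborel. g (x - s *\<^sub>R y))"
    using T by (subst integral_distr) auto
  also have "(LINT y|lborel. g (x - s *\<^sub>R y)) = (LINT y|lebesgue. g (x - s *\<^sub>R y))"
    by (rule integral_completion[symmetric]) measurable
  finally show ?thesis .
qed

text \<open>In this form x occurs only in the kernel, so that weak convergence of functions
  \<open>f\<close> gives pointwise convergence of their averages.\<close>

lemma ball_avg_eq_lebesgue:
  fixes f :: "real^'d \<Rightarrow> real"
  assumes "continuous_on UNIV f" "\<epsilon> > 0"
  shows "ball_avg \<epsilon> f x = (1 / \<epsilon> ^ CARD('d)) * (LINT p|lebesgue. f p * eta ((1 / \<epsilon>) *\<^sub>R (x - p)))"
proof -
  have "ball_avg \<epsilon> f x = (LINT y|lebesgue. f (x - \<epsilon> *\<^sub>R y) * eta y)"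
    unfolding ball_avg_def conv_def
    by (subst integral_cbox_eq_lebesgue)
       (auto simp: eta_outside_cbox intro!: continuous_intros continuous_on_UNIV_compose[OF assms(1)])
  moreover have "(LINT p|lebesgue. f p * eta ((1 / \<epsilon>) *\<^sub>R (x - p)))
      = \<epsilon> ^ CARD('d) * (LINT y|lebesgue. f (x - \<epsilon> *\<^sub>R y) * eta ((1 / \<epsilon>) *\<^sub>R (x - (x - \<epsilon> *\<^sub>R y))))"
    using integral_lborel_affine[of "\<lambda>p. f p * eta ((1 / \<epsilon>) *\<^sub>R (x - p))" \<epsilon> x] assms
    by (simp add: borel_measurable_continuous_onI continuous_intros)
  ultimately show ?thesis using assms(2) by simp
qed

text \<open>Clipping at 1 and cutting off near \<Sigma> do not disturb the almost everywhere
  convergence of continuous approximants, since \<open>g\<close> satisfies the bound and the support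
  condition itself. Both the cutoff and the mollification enlarge the support by at most \<epsilon>,
  hence the factor 2.\<close>

lemma C1_deriv_approximation:
  fixes g :: "'a::euclidean_space \<Rightarrow> real"
  assumes g: "g \<in> borel_measurable lebesgue" "\<And>x. \<bar>g x\<bar> \<le> 1" "\<And>x. x \<notin> \<Sigma> \<Longrightarrow> g x = 0"
    and \<Sigma>: "compact \<Sigma>" "\<Sigma> \<noteq> {}" and \<epsilon>: "\<epsilon> > 0" and e: "e > 0"
  obtains f f' where "C1_deriv f f'" "\<And>x. \<bar>f x\<bar> \<le> 1" "\<And>x. infdist x \<Sigma> > 2 * \<epsilon> \<Longrightarrow> f x = 0"
    "(LINT x|lebesgue. \<bar>f x - g x\<bar>) \<le> e"
proof -
  have "g measurable_on UNIV"
    by (rule lebesgue_measurable_imp_measurable_on) (use g(1) in auto)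
  then obtain N G where N: "negligible N" and G: "\<And>k. continuous_on UNIV (G k)"
    and lim: "\<And>x. x \<notin> N \<Longrightarrow> (\<lambda>k. G k x) \<longlonglongrightarrow> g x"
    unfolding measurable_on_def by (auto cong: if_cong)
  obtain R0 where R0: "\<And>x. x \<in> \<Sigma> \<Longrightarrow> norm x \<le> R0"
    using \<Sigma>(1) compact_imp_bounded bounded_iff by metis
  define R where "R = R0 + 2 * \<epsilon>"
  have far: "infdist x \<Sigma> > 2 * \<epsilon>" if "norm x > R" for x
  proof -
    obtain z where z: "z \<in> \<Sigma>" "infdist x \<Sigma> = dist x z"
      using infdist_attains_inf[OF compact_imp_closed[OF \<Sigma>(1)] \<Sigma>(2)] by blast
    have "norm x \<le> norm z + dist x z" using norm_triangle_ineq2[of x z] by (simp add: dist_norm)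
    then show ?thesis using R0[OF z(1)] that z by (simp add: R_def)
  qed
  define \<theta> where "\<theta> x = max 0 (1 - infdist x \<Sigma> / \<epsilon>)" for x
  have \<theta>: "0 \<le> \<theta> x" "\<theta> x \<le> 1" "x \<in> \<Sigma> \<Longrightarrow> \<theta> x = 1" "infdist x \<Sigma> \<ge> \<epsilon> \<Longrightarrow> \<theta> x = 0" for x
    using \<epsilon> infdist_nonneg[of x \<Sigma>] by (auto simp: \<theta>_def)
  define H where "H k x = \<theta> x * max (- 1) (min 1 (G k x))" for k x
  have Hc: "continuous_on UNIV (H k)" for k
    unfolding H_def \<theta>_def using \<epsilon> by (intro continuous_intros G) auto
  have Hb: "\<bar>H k x\<bar> \<le> 1" for k x
  proof -
    have "\<bar>max (- 1) (min 1 (G k x))\<bar> \<le> 1" by auto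
    then show ?thesis using \<theta>[of x] mult_mono[of "\<theta> x" 1 "\<bar>max (- 1) (min 1 (G k x))\<bar>" 1]
      by (simp add: H_def abs_mult)
  qed
  have H0: "H k x = 0" if "infdist x \<Sigma> \<ge> \<epsilon>" for k x
    using \<theta>(4)[OF that] by (simp add: H_def)
  have HR: "H k x = 0" if "norm x > R" for k x
    using far[OF that] \<epsilon> by (intro H0) auto
  have gR: "g x = 0" if "norm x > R" for x
    using R0[of x] that \<epsilon> by (intro g(3)) (auto simp: R_def)
  have [measurable]: "H k \<in> borel_measurable lebesgue" for k
    using Hc by (rule continuous_borel_measurable_lebesgue)
  have [measurable]: "g \<in> borel_measurable lebesgue" by (rule g(1))
  have iB: "integrable lebesgue (\<lambda>x::'a. c * indicator (cball 0 R) x :: real)" for c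
    using lmeasurable_cball[of "0::'a" R] by (simp add: lmeasurable_iff_integrable)
  have "(\<lambda>k. LINT x|lebesgue. \<bar>H k x - g x\<bar>) \<longlonglongrightarrow> (LINT x::'a|lebesgue. 0)"
  proof (rule integral_dominated_convergence[OF _ _ iB[of 2]])
    show "AE x in lebesgue. (\<lambda>k. \<bar>H k x - g x\<bar>) \<longlonglongrightarrow> 0"
    proof -
      have "AE x in lebesgue. x \<notin> N"
        using N by (simp add: negligible_iff_null_sets AE_not_in)
      then show ?thesis
      proof eventually_elim
        case (elim x)
        have "(\<lambda>k. H k x) \<longlonglongrightarrow> \<theta> x * max (- 1) (min 1 (g x))"
          unfolding H_def by (intro tendsto_intros lim elim)
        moreover have "\<theta> x * max (- 1) (min 1 (g x)) = g x"
          using g(2)[of x] g(3)[of x] \<theta>(3)[of x] by (cases "x \<in> \<Sigma>") auto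
        ultimately show ?case by (simp add: tendsto_rabs_zero LIM_zero)
      qed
    qed
    show "AE x in lebesgue. norm \<bar>H k x - g x\<bar> \<le> 2 * indicator (cball 0 R) x" for k
    proof (rule AE_I2)
      fix x
      show "norm \<bar>H k x - g x\<bar> \<le> 2 * indicator (cball 0 R) x"
      proof (cases "norm x \<le> R")
        case True
        have "\<bar>H k x - g x\<bar> \<le> 2"
          using Hb[of k x] g(2)[of x] abs_triangle_ineq4[of "H k x" "g x"] by linarith
        then show ?thesis using True by simp
      qed (simp add: HR gR)
    qed
  qed measurable
  then have "\<forall>\<^sub>F k in sequentially. (LINT x|lebesgue. \<bar>H k x - g x\<bar>) < e / 2"
    using e by (intro order_tendstoD(2)) auto
  then obtain k where k: "(LINT x|lebesgue. \<bar>H k x - g x\<bar>) < e / 2"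
    using eventually_happens'[OF sequentially_bot] by blast
  define B where "B = (LINT x::'a|lebesgue. indicator (cball 0 R) x :: real)"
  have B: "B \<ge> 0" by (simp add: B_def)
  define e' where "e' = e / (2 * (B + 1))"
  have e': "e' > 0" using e B by (simp add: e'_def)
  obtain d where d: "d > 0" "\<And>x y. dist x y \<le> d \<Longrightarrow> norm (H k x - H k y) \<le> e'"
    using uniform_continuity_compact_support[OF Hc HR e'] by metis
  define \<tau> where "\<tau> = min d \<epsilon>"
  have \<tau>: "\<tau> > 0" "\<tau> \<le> d" "\<tau> \<le> \<epsilon>" using d \<epsilon> by (auto simp: \<tau>_def)
  obtain f f' where f: "C1_deriv f f'"
    and avg: "\<And>x c e. (\<And>y. dist x y \<le> \<tau> \<Longrightarrow> norm (H k y - c) \<le> e) \<Longrightarrow> norm (f x - c) \<le> e"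
    using mollification[OF Hc HR \<tau>(1)] by metis
  have f0: "f x = 0" if "infdist x \<Sigma> > 2 * \<epsilon>" for x
  proof -
    have "norm (f x - 0) \<le> 0"
    proof (rule avg)
      fix y assume "dist x y \<le> \<tau>"
      then have "infdist y \<Sigma> \<ge> \<epsilon>"
        using infdist_triangle[of x \<Sigma> y] that \<tau> by linarith
      then show "norm (H k y - 0) \<le> 0" by (simp add: H0)
    qed
    then show ?thesis by simp
  qed
  have fH: "\<bar>f x - H k x\<bar> \<le> e' * indicator (cball 0 R) x" for x
  proof (cases "norm x \<le> R")
    case True
    have "norm (f x - H k x) \<le> e'"
      by (rule avg) (use d(2) \<tau> in \<open>auto simp: dist_commute\<close>)
    then show ?thesis using True by simp
  qed (use f0 far HR in auto)
  show thesis
  proof (rule that[OF f _ f0])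
    show "\<bar>f x\<bar> \<le> 1" for x
      using avg[of x 0 1] Hb by simp
    have iH: "integrable lebesgue (\<lambda>x. \<bar>H k x - g x\<bar>)"
    proof (rule Bochner_Integration.integrable_bound[OF iB[of 2]])
      show "AE x in lebesgue. norm \<bar>H k x - g x\<bar> \<le> norm (2 * indicator (cball 0 R) x :: real)"
      proof (rule AE_I2)
        fix x
        show "norm \<bar>H k x - g x\<bar> \<le> norm (2 * indicator (cball 0 R) x :: real)"
        proof (cases "norm x \<le> R")
          case True
          have "\<bar>H k x - g x\<bar> \<le> 2"
            using Hb[of k x] g(2)[of x] abs_triangle_ineq4[of "H k x" "g x"] by linarith
          then show ?thesis using True by simp
        qed (simp add: HR gR)
      qed
    qed measurable
    have "(LINT x|lebesgue. \<bar>f x - g x\<bar>) \<le> (LINT x|lebesgue. e' * indicator (cball 0 R) x + \<bar>H k x - g x\<bar>)"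
    proof (rule integral_mono_AE')
      show "integrable lebesgue (\<lambda>x. e' * indicator (cball 0 R) x + \<bar>H k x - g x\<bar>)"
        by (intro Bochner_Integration.integrable_add iB iH)
      show "AE x in lebesgue. \<bar>f x - g x\<bar> \<le> e' * indicator (cball 0 R) x + \<bar>H k x - g x\<bar>"
        using fH abs_triangle_ineq4 by (intro AE_I2) (smt (verit, best))
      show "AE x in lebesgue. 0 \<le> e' * indicator (cball 0 R) x + \<bar>H k x - g x\<bar>"
        using e' by (intro AE_I2 add_nonneg_nonneg) auto
    qed
    also have "\<dots> = e' * B + (LINT x|lebesgue. \<bar>H k x - g x\<bar>)"
      by (subst Bochner_Integration.integral_add[OF iB iH]) (simp add: B_def)
    also have "e' * B \<le> e / 2"
    proof -
      have "e' * B = (e / 2) * (B / (B + 1))" by (simp add: e'_def)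
      also have "\<dots> \<le> (e / 2) * 1" using e B by (intro mult_left_mono) auto
      finally show ?thesis by simp
    qed
    finally show "(LINT x|lebesgue. \<bar>f x - g x\<bar>) \<le> e" using k by linarith
  qed
qed

lemma trunc_const_nonneg: "trunc_const N \<ge> 0"
  by (simp add: trunc_const_def)

text \<open>Let f approximate \<mu>, let S be its average at scale \<epsilon>, and let \<psi> be the
  truncated field with divergence close to S - f. Then \<mu>^2 is \<mu> S - \<mu> div \<psi> + \<mu>
  (div \<psi> - (S - f)) + \<mu> (\<mu> - f). The first term disappears because \<mu> tends weakly
  to 0, the second is the pairing at a gradient bound of order L, the third is the truncation error
  of order 1 / L, and the last is the approximation error. The limit \<open>D\<^sub>0\<close> is
  kept positive in general: the distance to the segment does not vanish along the sequence.\<close>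

lemma asymptotic_L2_bound:
  fixes \<mu> :: "nat \<Rightarrow> real^'d \<Rightarrow> real" and \<Omega> :: "(real^'d) set"
  assumes \<Omega>: "open \<Omega>" "bounded \<Omega>"
    and \<mu>: "\<And>n. \<mu> n \<in> borel_measurable lebesgue" "\<And>n x. \<bar>\<mu> n x\<bar> \<le> 1" "\<And>n x. x \<notin> \<Omega> \<Longrightarrow> \<mu> n x = 0"
    and weak: "\<And>g. integrable lebesgue g \<Longrightarrow> (\<lambda>n. LINT x|lebesgue. g x * \<mu> n x) \<longlonglongrightarrow> 0"
    and pair: "\<And>n \<psi> \<psi>' B. test_fun \<Omega> \<psi> \<Longrightarrow> C1_deriv \<psi> \<psi>' \<Longrightarrow> (\<And>x i j. \<bar>\<psi>' x (axis j 1) $ i\<bar> \<le> B)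
       \<Longrightarrow> \<bar>LINT x|lebesgue. \<mu> n x * (\<Sum>i\<in>UNIV. \<psi>' x (axis i 1) $ i)\<bar> \<le> B * D n"
    and D: "D \<longlonglongrightarrow> D\<^sub>0" "D\<^sub>0 \<ge> 0" and L: "L \<ge> 1" and e: "e > 0"
  shows "\<forall>\<^sub>F n in sequentially. (LINT x|lebesgue. (\<mu> n x)\<^sup>2)
     \<le> trunc_const CARD('d) * (L * D\<^sub>0 + measure lebesgue \<Omega> / L) + e"
proof (cases "\<Omega> = {}")
  case True
  then have "\<mu> n x = 0" for n x using \<mu>(3) by blast
  then show ?thesis using L D(2) e trunc_const_nonneg[of "CARD('d)"] by (simp add: True)
next
  case False
  then obtain x0 where x0: "x0 \<in> \<Omega>" by blast
  define C where "C = trunc_const CARD('d)"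
  have C0: "C \<ge> 0" by (simp add: C_def trunc_const_nonneg)
  have \<Omega>m: "\<Omega> \<in> lmeasurable" by (simp add: \<Omega> lmeasurable_open)
  have "e / 4 > 0" using e by simp
  then obtain T where T: "closed T" "T \<subseteq> \<Omega>" "\<Omega> - T \<in> lmeasurable" "emeasure lebesgue (\<Omega> - T) < ennreal (e / 4)"
    using sets_lebesgue_inner_closed[of \<Omega> "e / 4"] \<Omega>m by auto
  \<comment> \<open>The support has to stay away from the boundary to leave room for the test
    fields. The part of \<Omega> that is lost has measure at most e / 4, and \<mu> is bounded by 1;
    the point \<open>x0\<close> only makes the compact set nonempty.\<close>
  define \<Sigma>0 where "\<Sigma>0 = insert x0 T"
  have \<Sigma>0: "compact \<Sigma>0" "\<Sigma>0 \<noteq> {}" "\<Sigma>0 \<subseteq> \<Omega>"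
    using T x0 \<Omega>(2) by (auto simp: \<Sigma>0_def compact_eq_bounded_closed intro: bounded_subset)
  have [measurable]: "\<Sigma>0 \<in> sets lebesgue" "\<Omega> \<in> sets lebesgue" "T \<in> sets lebesgue"
    using \<Sigma>0(1) \<Omega>m T(1) by (auto simp: compact_imp_closed)
  have \<Omega>T: "measure lebesgue (\<Omega> - T) \<le> e / 4"
    using T(4) e unfolding emeasure_eq_measure2[OF T(3)] by (simp add: ennreal_less_iff)
  obtain \<delta> where \<delta>: "\<delta> > 0" "{x. infdist x \<Sigma>0 \<le> \<delta>} \<subseteq> \<Omega>"
    using compact_in_open_separated[OF \<Sigma>0(2,1) \<Omega>(1) \<Sigma>0(3)] by metis
  \<comment> \<open>Of the five parts, two are consumed by the support of the approximations and
    three by that of the truncated field.\<close>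
  define \<epsilon> where "\<epsilon> = min 1 (\<delta> / 5)"
  have \<epsilon>: "\<epsilon> > 0" "\<epsilon> \<le> 1" "5 * \<epsilon> \<le> \<delta>" using \<delta> by (auto simp: \<epsilon>_def)
  define \<Sigma> where "\<Sigma> = {x. infdist x \<Sigma>0 \<le> 2 * \<epsilon>}"
  have \<Sigma>sub: "\<Sigma> \<subseteq> \<Omega>" using \<delta> \<epsilon> by (auto simp: \<Sigma>_def)
  have \<Sigma>: "compact \<Sigma>" "\<Sigma> \<noteq> {}"
  proof -
    have "closed \<Sigma>" unfolding \<Sigma>_def by (intro closed_Collect_le continuous_intros)
    then show "compact \<Sigma>" using bounded_subset[OF \<Omega>(2) \<Sigma>sub] compact_eq_bounded_closed by blast
    have "x0 \<in> \<Sigma>" using \<epsilon> by (simp add: \<Sigma>_def \<Sigma>0_def)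
    then show "\<Sigma> \<noteq> {}" by blast
  qed
  have \<Sigma>near: "x \<in> \<Omega>" if "infdist x \<Sigma> \<le> 3 * \<epsilon>" for x
  proof -
    obtain z where z: "z \<in> \<Sigma>" "infdist x \<Sigma> = dist x z"
      using infdist_attains_inf[OF compact_imp_closed[OF \<Sigma>(1)] \<Sigma>(2)] by blast
    have "infdist x \<Sigma>0 \<le> 2 * \<epsilon> + 3 * \<epsilon>"
      using infdist_triangle[of x \<Sigma>0 z] z that by (simp add: \<Sigma>_def)
    then show ?thesis using \<delta>(2) \<epsilon> by auto
  qed
  define \<mu>0 where "\<mu>0 n x = indicator \<Sigma>0 x * \<mu> n x" for n x
  have [measurable]: "\<mu> n \<in> borel_measurable lebesgue" for n by (rule \<mu>(1))
  have [measurable]: "\<mu>0 n \<in> borel_measurable lebesgue" for n unfolding \<mu>0_def by measurable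
  have \<mu>0b: "\<bar>\<mu>0 n x\<bar> \<le> 1" for n x using \<mu>(2)[of n x] by (simp add: \<mu>0_def indicator_def)
  \<comment> \<open>The tolerance tends to 0 with n, so that the approximations inherit the weak
    limit of the functions they approximate.\<close>
  have "\<exists>f f'. C1_deriv f f' \<and> (\<forall>x. \<bar>f x\<bar> \<le> 1) \<and> (\<forall>x. x \<notin> \<Sigma> \<longrightarrow> f x = 0) \<and> (LINT x|lebesgue. \<bar>f x - \<mu>0 n x\<bar>) \<le> 1 / real (Suc n)" for n
  proof -
    obtain f f' where "C1_deriv f f'" "\<And>x. \<bar>f x\<bar> \<le> 1" "\<And>x. infdist x \<Sigma>0 > 2 * \<epsilon> \<Longrightarrow> f x = 0"
      "(LINT x|lebesgue. \<bar>f x - \<mu>0 n x\<bar>) \<le> 1 / real (Suc n)"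
      using C1_deriv_approximation[of "\<mu>0 n" \<Sigma>0 \<epsilon> "1 / real (Suc n)"] \<mu>0b \<Sigma>0 \<epsilon> by (auto simp: \<mu>0_def)
    then show ?thesis by (intro exI[of _ f] exI[of _ f']) (auto simp: \<Sigma>_def)
  qed
  then obtain f f' where f: "\<And>n. C1_deriv (f n) (f' n)" "\<And>n x. \<bar>f n x\<bar> \<le> 1" "\<And>n x. x \<notin> \<Sigma> \<Longrightarrow> f n x = 0"
    and f\<mu>: "\<And>n. (LINT x|lebesgue. \<bar>f n x - \<mu>0 n x\<bar>) \<le> 1 / real (Suc n)"
    by metis
  note fc = C1dD(3)[OF f(1)]
  have [measurable]: "f n \<in> borel_measurable lebesgue" for n
    using fc by (rule continuous_borel_measurable_lebesgue)
  define P where "P n \<psi> \<psi>' \<longleftrightarrow> test_fun \<Omega> \<psi> \<and> C1_deriv \<psi> \<psi>' \<and> (\<forall>x i j. \<bar>\<psi>' x (axis j 1) $ i\<bar> \<le> C * L) \<and>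
      (LINT x:\<Omega>|lebesgue. \<bar>(\<Sum>i\<in>UNIV. \<psi>' x (axis i 1) $ i) - (ball_avg \<epsilon> (f n) x - f n x)\<bar>) \<le> C * measure lebesgue \<Omega> / L + 1 / real (Suc n)"
    for n \<psi> \<psi>'
  have "\<exists>\<psi> \<psi>'. P n \<psi> \<psi>'" for n
  proof -
    have "1 / real (Suc n) > 0" by simp
    show ?thesis unfolding P_def C_def
    proof (rule truncated_test_field[OF f(1)[of n] f(2)[of n] \<epsilon>(1,2) \<Sigma> _ \<Omega> _ L \<open>1 / real (Suc n) > 0\<close>])
      show "x \<notin> \<Sigma> \<Longrightarrow> f n x = 0" for x by (rule f(3))
      show "infdist x \<Sigma> \<le> 3 * \<epsilon> \<Longrightarrow> x \<in> \<Omega>" for x by (rule \<Sigma>near)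
    qed (intro exI conjI allI)
  qed
  then obtain \<psi> \<psi>' where "\<And>n. P n (\<psi> n) (\<psi>' n)" by metis
  note PP = this[unfolded P_def]
  have \<psi>: "\<And>n. test_fun \<Omega> (\<psi> n)" "\<And>n. C1_deriv (\<psi> n) (\<psi>' n)" "\<And>n x i j. \<bar>\<psi>' n x (axis j 1) $ i\<bar> \<le> C * L"
    and \<psi>int: "\<And>n. (LINT x:\<Omega>|lebesgue. \<bar>(\<Sum>i\<in>UNIV. \<psi>' n x (axis i 1) $ i) - (ball_avg \<epsilon> (f n) x - f n x)\<bar>) \<le> C * measure lebesgue \<Omega> / L + 1 / real (Suc n)"
    using PP by simp_all
  define dv where "dv n x = (\<Sum>i\<in>UNIV. \<psi>' n x (axis i 1) $ i)" for n x
  have dvc: "continuous_on UNIV (dv n)" for n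
    unfolding dv_def by (intro continuous_intros C1dD(2)[OF \<psi>(2)])
  have Sc: "continuous_on UNIV (ball_avg \<epsilon> (f n))" for n by (rule ball_avg_continuous[OF fc])
  have Sb: "\<bar>ball_avg \<epsilon> (f n) x\<bar> \<le> 1" for n x by (rule ball_avg_bound[OF fc f(2)])
  have [measurable]: "dv n \<in> borel_measurable lebesgue" "ball_avg \<epsilon> (f n) \<in> borel_measurable lebesgue" for n
    using dvc Sc by (auto intro: continuous_borel_measurable_lebesgue)
  obtain R where R: "\<And>x. x \<in> \<Omega> \<Longrightarrow> norm x \<le> R" using \<Omega>(2) bounded_iff by metis
  have iO: "integrable lebesgue (\<lambda>x. indicator \<Omega> x * g x)" if g: "continuous_on UNIV g" for g :: "_ \<Rightarrow> real"
  proof -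
    obtain M where M: "\<And>x. x \<in> cball 0 R \<Longrightarrow> \<bar>g x\<bar> \<le> M"
      using continuous_bounded_on_cball[OF g] by blast
    have m: "g \<in> borel_measurable lebesgue" using g by (rule continuous_borel_measurable_lebesgue)
    show ?thesis
    proof (rule Bochner_Integration.integrable_bound[where f="\<lambda>x. M * indicator \<Omega> x"])
      show "integrable lebesgue (\<lambda>x. M * indicator \<Omega> x)"
        using \<Omega>m by (auto simp: lmeasurable_iff_integrable)
      show "AE x in lebesgue. norm (indicator \<Omega> x * g x) \<le> norm (M * indicator \<Omega> x :: real)"
      proof (rule AE_I2)
        fix x
        show "norm (indicator \<Omega> x * g x) \<le> norm (M * indicator \<Omega> x :: real)"
        proof (cases "x \<in> \<Omega>")
          case True
          then show ?thesis using M[of x] R[of x] by simp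
        qed simp
      qed
      show "(\<lambda>x. indicator \<Omega> x * g x) \<in> borel_measurable lebesgue" using m by measurable
    qed
  qed
  have i\<mu>: "integrable lebesgue (\<lambda>x. \<mu> n x * g x)" if g: "continuous_on UNIV g" for g :: "_ \<Rightarrow> real" and n
  proof (rule Bochner_Integration.integrable_bound[OF iO[OF g]])
    have m: "g \<in> borel_measurable lebesgue" using g by (rule continuous_borel_measurable_lebesgue)
    then show "(\<lambda>x. \<mu> n x * g x) \<in> borel_measurable lebesgue" by measurable
    show "AE x in lebesgue. norm (\<mu> n x * g x) \<le> norm (indicator \<Omega> x * g x)"
      using \<mu>(2,3) by (intro AE_I2) (auto simp: abs_mult indicator_def mult_left_le_one_le)
  qed
  have S0: "(\<lambda>n. LINT x|lebesgue. indicator \<Omega> x * \<bar>ball_avg \<epsilon> (f n) x\<bar>) \<longlonglongrightarrow> 0"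
  proof -
    have pt: "(\<lambda>n. ball_avg \<epsilon> (f n) x) \<longlonglongrightarrow> 0" for x
    proof -
      define E where "E p = eta ((1 / \<epsilon>) *\<^sub>R (x - p))" for p
      have Ec: "continuous_on UNIV E" unfolding E_def by (intro continuous_intros)
      have E0: "E p = 0" if "norm p > norm x + \<epsilon>" for p
      proof -
        have "norm (x - p) \<ge> \<epsilon>" using that norm_triangle_ineq2[of p x] by (simp add: norm_minus_commute)
        then show ?thesis using \<epsilon> by (auto simp: E_def intro!: eta_outside)
      qed
      have iE: "integrable lebesgue E" by (rule integrable_continuous_compact[OF Ec E0])
      obtain M where M: "\<And>p. p \<in> cball 0 (norm x + \<epsilon>) \<Longrightarrow> \<bar>E p\<bar> \<le> M"
        using continuous_bounded_on_cball[OF Ec] by blast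
      have M': "\<bar>E p\<bar> \<le> \<bar>M\<bar>" for p
        using M[of p] E0[of p] by (cases "norm p \<le> norm x + \<epsilon>") auto
      have [measurable]: "E \<in> borel_measurable lebesgue" using Ec by (rule continuous_borel_measurable_lebesgue)
      have ifn: "integrable lebesgue (\<lambda>p. f n p * E p)" for n
        by (rule integrable_continuous_compact[where R="norm x + \<epsilon>"]) (auto simp: E0 intro!: continuous_intros fc Ec)
      have i\<mu>n: "integrable lebesgue (\<lambda>p. \<mu>0 n p * E p)" for n
      proof (rule Bochner_Integration.integrable_bound[OF iE])
        show "AE p in lebesgue. norm (\<mu>0 n p * E p) \<le> norm (E p)"
          using \<mu>0b by (intro AE_I2) (simp add: abs_mult mult_left_le_one_le)
      qed measurable
      have iab: "integrable lebesgue (\<lambda>p. \<bar>f n p - \<mu>0 n p\<bar>)" for n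
      proof (rule Bochner_Integration.integrable_bound[where f="\<lambda>x. 2 * indicator \<Omega> x :: real"])
        show "integrable lebesgue (\<lambda>x. 2 * indicator \<Omega> x :: real)"
          using \<Omega>m by (auto simp: lmeasurable_iff_integrable)
        show "AE p in lebesgue. norm \<bar>f n p - \<mu>0 n p\<bar> \<le> norm (2 * indicator \<Omega> p :: real)"
        proof (rule AE_I2)
          fix p
          show "norm \<bar>f n p - \<mu>0 n p\<bar> \<le> norm (2 * indicator \<Omega> p :: real)"
            using f(2)[of n p] f(3)[of p n] \<mu>0b[of n p] \<Sigma>sub \<Sigma>0(3)
            by (cases "p \<in> \<Omega>") (auto simp: \<mu>0_def indicator_def split: if_splits)
        qed
      qed measurable
      have lim1: "(\<lambda>n. LINT p|lebesgue. \<mu>0 n p * E p) \<longlonglongrightarrow> 0"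
      proof -
        have "integrable lebesgue (\<lambda>p. indicator \<Sigma>0 p * E p)"
        proof (rule Bochner_Integration.integrable_bound[OF iE])
          show "AE p in lebesgue. norm (indicator \<Sigma>0 p * E p) \<le> norm (E p)"
            by (intro AE_I2) (simp add: indicator_def)
        qed measurable
        from weak[OF this] show ?thesis by (simp add: \<mu>0_def mult_ac)
      qed
      have bd: "\<bar>(LINT p|lebesgue. f n p * E p) - (LINT p|lebesgue. \<mu>0 n p * E p)\<bar> \<le> \<bar>M\<bar> * (1 / real (Suc n))" for n
      proof -
        have "\<bar>(LINT p|lebesgue. f n p * E p) - (LINT p|lebesgue. \<mu>0 n p * E p)\<bar> = \<bar>LINT p|lebesgue. (f n p - \<mu>0 n p) * E p\<bar>"
          using ifn i\<mu>n by (simp add: left_diff_distrib)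
        also have "\<dots> \<le> (LINT p|lebesgue. \<bar>(f n p - \<mu>0 n p) * E p\<bar>)"
          by (rule integral_abs_bound)
        also have "\<dots> \<le> (LINT p|lebesgue. \<bar>M\<bar> * \<bar>f n p - \<mu>0 n p\<bar>)"
        proof (intro integral_mono_AE' integrable_mult_right iab AE_I2)
          fix p
          show "\<bar>(f n p - \<mu>0 n p) * E p\<bar> \<le> \<bar>M\<bar> * \<bar>f n p - \<mu>0 n p\<bar>"
            using mult_left_mono[OF M'[of p] abs_ge_zero[of "f n p - \<mu>0 n p"]] by (simp add: abs_mult mult.commute)
        qed simp
        also have "\<dots> \<le> \<bar>M\<bar> * (1 / real (Suc n))"
          using mult_left_mono[OF f\<mu>[of n] abs_ge_zero[of M]] by simp
        finally show ?thesis .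
      qed
      have "(\<lambda>n. \<bar>M\<bar> * (1 / real (Suc n))) \<longlonglongrightarrow> \<bar>M\<bar> * 0"
        using LIMSEQ_inverse_real_of_nat by (intro tendsto_mult tendsto_const) (simp add: inverse_eq_divide)
      then have l0: "(\<lambda>n. \<bar>M\<bar> * (1 / real (Suc n))) \<longlonglongrightarrow> 0" by (simp only: mult_zero_right)
      have "(\<lambda>n. (LINT p|lebesgue. f n p * E p) - (LINT p|lebesgue. \<mu>0 n p * E p)) \<longlonglongrightarrow> 0"
      proof (rule Lim_null_comparison[OF _ l0])
        show "\<forall>\<^sub>F n in sequentially. norm ((LINT p|lebesgue. f n p * E p) - (LINT p|lebesgue. \<mu>0 n p * E p)) \<le> \<bar>M\<bar> * (1 / real (Suc n))"
          unfolding real_norm_def by (intro always_eventually allI bd)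
      qed
      from tendsto_add[OF this lim1] have "(\<lambda>n. LINT p|lebesgue. f n p * E p) \<longlonglongrightarrow> 0" by simp
      from tendsto_mult[OF tendsto_const[of "1 / \<epsilon> ^ CARD('d)"] this]
      show ?thesis by (simp only: ball_avg_eq_lebesgue[OF fc \<epsilon>(1)] E_def mult_zero_right)
    qed
    have "(\<lambda>n. LINT x|lebesgue. indicator \<Omega> x * \<bar>ball_avg \<epsilon> (f n) x\<bar>) \<longlonglongrightarrow> (LINT x::real^'d|lebesgue. 0)"
    proof (rule integral_dominated_convergence[where w="\<lambda>x. indicator \<Omega> x :: real"])
      show "integrable lebesgue (\<lambda>x. indicator \<Omega> x :: real)"
        using \<Omega>m by (auto simp: lmeasurable_iff_integrable)
      show "AE x in lebesgue. (\<lambda>n. indicator \<Omega> x * \<bar>ball_avg \<epsilon> (f n) x\<bar>) \<longlonglongrightarrow> 0"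
        using pt by (intro AE_I2 tendsto_mult_right_zero tendsto_rabs_zero)
      show "AE x in lebesgue. norm (indicator \<Omega> x * \<bar>ball_avg \<epsilon> (f n) x\<bar>) \<le> indicator \<Omega> x" for n
        using Sb by (intro AE_I2) (simp add: indicator_def)
    qed measurable
    then show ?thesis by simp
  qed
  have main: "(LINT x|lebesgue. (\<mu> n x)\<^sup>2) \<le> (LINT x|lebesgue. indicator \<Omega> x * \<bar>ball_avg \<epsilon> (f n) x\<bar>) + C * L * D n
     + (C * measure lebesgue \<Omega> / L + 1 / real (Suc n)) + (1 / real (Suc n) + e / 4)" for n
  proof -
    let ?r = "\<lambda>x. \<bar>dv n x - (ball_avg \<epsilon> (f n) x - f n x)\<bar>"
    have rc: "continuous_on UNIV ?r" by (intro continuous_intros dvc Sc fc)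
    have Sabs: "continuous_on UNIV (\<lambda>x. \<bar>ball_avg \<epsilon> (f n) x\<bar>)" by (intro continuous_intros Sc)
    have i\<mu>2: "integrable lebesgue (\<lambda>x. (\<mu> n x)\<^sup>2)"
    proof (rule Bochner_Integration.integrable_bound[where f="\<lambda>x. indicator \<Omega> x :: real"])
      show "integrable lebesgue (\<lambda>x. indicator \<Omega> x :: real)"
        using \<Omega>m by (auto simp: lmeasurable_iff_integrable)
      show "AE x in lebesgue. norm ((\<mu> n x)\<^sup>2) \<le> norm (indicator \<Omega> x :: real)"
        using \<mu>(2,3) by (intro AE_I2) (auto simp: indicator_def abs_square_le_1)
    qed measurable
    have iT: "integrable lebesgue (\<lambda>x. indicator (\<Omega> - T) x :: real)"
      using T(3) by (simp add: lmeasurable_iff_integrable)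
    have iab: "integrable lebesgue (\<lambda>x. \<bar>f n x - \<mu>0 n x\<bar>)"
    proof (rule Bochner_Integration.integrable_bound[where f="\<lambda>x. 2 * indicator \<Omega> x :: real"])
      show "integrable lebesgue (\<lambda>x. 2 * indicator \<Omega> x :: real)"
        using \<Omega>m by (auto simp: lmeasurable_iff_integrable)
      show "AE p in lebesgue. norm \<bar>f n p - \<mu>0 n p\<bar> \<le> norm (2 * indicator \<Omega> p :: real)"
      proof (rule AE_I2)
        fix p
        show "norm \<bar>f n p - \<mu>0 n p\<bar> \<le> norm (2 * indicator \<Omega> p :: real)"
          using f(2)[of n p] f(3)[of p n] \<mu>0b[of n p] \<Sigma>sub \<Sigma>0(3)
          by (cases "p \<in> \<Omega>") (auto simp: \<mu>0_def indicator_def split: if_splits)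
      qed
    qed measurable
    have pt: "(\<mu> n x)\<^sup>2 \<le> indicator \<Omega> x * \<bar>ball_avg \<epsilon> (f n) x\<bar> - \<mu> n x * dv n x + indicator \<Omega> x * ?r x
       + (\<bar>f n x - \<mu>0 n x\<bar> + indicator (\<Omega> - T) x)" for x
    proof (cases "x \<in> \<Omega>")
      case True
      have m: "\<mu> n x * t \<le> \<bar>t\<bar>" for t
        using \<mu>(2)[of n x] by (metis abs_ge_self abs_mult mult_left_le_one_le abs_ge_zero order_trans)
      have "(\<mu> n x)\<^sup>2 = \<mu> n x * ball_avg \<epsilon> (f n) x - \<mu> n x * dv n x + \<mu> n x * (dv n x - (ball_avg \<epsilon> (f n) x - f n x)) + \<mu> n x * (\<mu> n x - f n x)"
        by (simp add: algebra_simps power2_eq_square)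
      also have "\<dots> \<le> \<bar>ball_avg \<epsilon> (f n) x\<bar> - \<mu> n x * dv n x + ?r x + \<bar>\<mu> n x - f n x\<bar>"
        using m by (intro add_mono diff_mono order_refl) auto
      also have "\<bar>\<mu> n x - f n x\<bar> \<le> \<bar>f n x - \<mu>0 n x\<bar> + indicator (\<Omega> - T) x"
      proof (cases "x \<in> \<Sigma>0")
        case False
        then have "\<mu>0 n x = 0" "x \<in> \<Omega> - T" using True by (auto simp: \<mu>0_def \<Sigma>0_def)
        then show ?thesis using \<mu>(2)[of n x] by simp
      next
        case True
        then have "\<mu>0 n x = \<mu> n x" by (simp add: \<mu>0_def)
        then show ?thesis by (simp add: abs_minus_commute indicator_def)
      qed
      finally show ?thesis using True by simp
    qed (simp add: \<mu>(3))
    have "(LINT x|lebesgue. (\<mu> n x)\<^sup>2) \<le> (LINT x|lebesgue. indicator \<Omega> x * \<bar>ball_avg \<epsilon> (f n) x\<bar> - \<mu> n x * dv n x + indicator \<Omega> x * ?r x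
       + (\<bar>f n x - \<mu>0 n x\<bar> + indicator (\<Omega> - T) x))"
      by (intro integral_mono i\<mu>2 Bochner_Integration.integrable_add Bochner_Integration.integrable_diff iO[OF Sabs] i\<mu>[OF dvc] iO[OF rc] iab iT pt)
    also have "\<dots> = (LINT x|lebesgue. indicator \<Omega> x * \<bar>ball_avg \<epsilon> (f n) x\<bar>) - (LINT x|lebesgue. \<mu> n x * dv n x) + (LINT x|lebesgue. indicator \<Omega> x * ?r x)
       + ((LINT x|lebesgue. \<bar>f n x - \<mu>0 n x\<bar>) + measure lebesgue (\<Omega> - T))"
      using iO[OF Sabs] i\<mu>[OF dvc, of n] iO[OF rc] iab iT T(3) by simp
    also have "\<dots> \<le> (LINT x|lebesgue. indicator \<Omega> x * \<bar>ball_avg \<epsilon> (f n) x\<bar>) + C * L * D n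
     + (C * measure lebesgue \<Omega> / L + 1 / real (Suc n)) + (1 / real (Suc n) + e / 4)"
    proof -
      have "\<bar>LINT x|lebesgue. \<mu> n x * dv n x\<bar> \<le> C * L * D n"
        unfolding dv_def by (rule pair[OF \<psi>(1,2,3)])
      moreover have "(LINT x|lebesgue. indicator \<Omega> x * ?r x) \<le> C * measure lebesgue \<Omega> / L + 1 / real (Suc n)"
        using \<psi>int[of n] by (simp add: set_lebesgue_integral_def dv_def)
      ultimately show ?thesis using f\<mu>[of n] \<Omega>T by linarith
    qed
    finally show ?thesis .
  qed
  have i0: "(\<lambda>n. 1 / real (Suc n)) \<longlonglongrightarrow> 0"
    using LIMSEQ_inverse_real_of_nat by (simp add: inverse_eq_divide)
  have "(\<lambda>n. (LINT x|lebesgue. indicator \<Omega> x * \<bar>ball_avg \<epsilon> (f n) x\<bar>) + C * L * D n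
     + (C * measure lebesgue \<Omega> / L + 1 / real (Suc n)) + (1 / real (Suc n) + e / 4))
     \<longlonglongrightarrow> 0 + C * L * D\<^sub>0 + (C * measure lebesgue \<Omega> / L + 0) + (0 + e / 4)"
    by (intro tendsto_add S0 tendsto_mult tendsto_const D(1) i0)
  moreover have "0 + C * L * D\<^sub>0 + (C * measure lebesgue \<Omega> / L + 0) + (0 + e / 4) < C * (L * D\<^sub>0 + measure lebesgue \<Omega> / L) + e"
    using e by (simp add: algebra_simps)
  ultimately have "\<forall>\<^sub>F n in sequentially. (LINT x|lebesgue. indicator \<Omega> x * \<bar>ball_avg \<epsilon> (f n) x\<bar>) + C * L * D n
     + (C * measure lebesgue \<Omega> / L + 1 / real (Suc n)) + (1 / real (Suc n) + e / 4) < C * (L * D\<^sub>0 + measure lebesgue \<Omega> / L) + e"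
    by (rule order_tendstoD(2))
  then show ?thesis
    unfolding C_def[symmetric]
  proof eventually_elim
    case (elim n)
    then show ?case using main[of n] by linarith
  qed
qed

section \<open>Wave cone and ridge functions\<close>

text \<open>Averaging over the translations by \<open>s *\<^sub>R \<xi>\<close> with \<open>s \<in> [0, 1]\<close> turns the integral over the ball into one-dimensional integrals of \<open>F\<close>.\<close>

lemma nn_integral_ridge_le:
  fixes F :: "real \<Rightarrow> ennreal" and \<xi> :: "'a::euclidean_space"
  assumes [measurable]: "F \<in> borel_measurable borel" and \<xi>: "\<xi> \<noteq> 0"
  shows "(\<integral>\<^sup>+x. indicator (cball 0 R) x * F (x \<bullet> \<xi>) \<partial>lborel)
     \<le> emeasure lborel (cball (0::'a) (R + norm \<xi>)) * (ennreal (1 / (\<xi> \<bullet> \<xi>)) * (\<integral>\<^sup>+t. F t \<partial>lborel))"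
proof -
  have c: "\<xi> \<bullet> \<xi> > 0" using \<xi> by simp
  have [measurable]: "indicator (cball (0::'a) r) \<in> borel_measurable borel" for r
    by (intro borel_measurable_indicator borel_closed) auto
  have m: "(\<lambda>z::real \<times> 'a. indicator (cball 0 r) (snd z) * (indicator {0..1} (fst z) * F (snd z \<bullet> \<xi> + (\<xi> \<bullet> \<xi>) * fst z)))
      \<in> borel_measurable (lborel \<Otimes>\<^sub>M lborel)" for r
    by measurable
  have shift: "(\<integral>\<^sup>+x. indicator (cball 0 R) x * F (x \<bullet> \<xi>) \<partial>lborel)
     \<le> (\<integral>\<^sup>+x. indicator (cball 0 (R + norm \<xi>)) x * F (x \<bullet> \<xi> + (\<xi> \<bullet> \<xi>) * s) \<partial>lborel)" if s: "0 \<le> s" "s \<le> 1" for s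
  proof -
    have "(\<integral>\<^sup>+x. indicator (cball 0 R) x * F (x \<bullet> \<xi>) \<partial>lborel)
      = (\<integral>\<^sup>+x. indicator (cball 0 R) (s *\<^sub>R \<xi> + 1 *\<^sub>R x) * F ((s *\<^sub>R \<xi> + 1 *\<^sub>R x) \<bullet> \<xi>) \<partial>lborel)"
      by (subst nn_integral_lborel_affine[where s=1 and x="s *\<^sub>R \<xi>"]) auto
    also have "\<dots> \<le> (\<integral>\<^sup>+x. indicator (cball 0 (R + norm \<xi>)) x * F (x \<bullet> \<xi> + (\<xi> \<bullet> \<xi>) * s) \<partial>lborel)"
    proof (intro nn_integral_mono mult_mono)
      fix x :: 'a
      have "norm x \<le> norm (s *\<^sub>R \<xi> + x) + norm (s *\<^sub>R \<xi>)"
        using norm_triangle_ineq4[of "s *\<^sub>R \<xi> + x" "s *\<^sub>R \<xi>"] by simp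
      moreover have "norm (s *\<^sub>R \<xi>) \<le> norm \<xi>" using s by (simp add: mult_left_le_one_le)
      ultimately show "indicator (cball 0 R) (s *\<^sub>R \<xi> + 1 *\<^sub>R x) \<le> (indicator (cball 0 (R + norm \<xi>)) x :: ennreal)"
        by (auto simp: indicator_def)
      show "F ((s *\<^sub>R \<xi> + 1 *\<^sub>R x) \<bullet> \<xi>) \<le> F (x \<bullet> \<xi> + (\<xi> \<bullet> \<xi>) * s)"
        by (simp add: inner_add_left algebra_simps)
    qed auto
    finally show ?thesis .
  qed
  have "(\<integral>\<^sup>+x. indicator (cball 0 R) x * F (x \<bullet> \<xi>) \<partial>lborel)
    = (\<integral>\<^sup>+s. indicator {0..1::real} s * (\<integral>\<^sup>+x. indicator (cball 0 R) x * F (x \<bullet> \<xi>) \<partial>lborel) \<partial>lborel)"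
    by (subst nn_integral_multc) auto
  also have "\<dots> \<le> (\<integral>\<^sup>+s. (\<integral>\<^sup>+x. indicator (cball 0 (R + norm \<xi>)) x * (indicator {0..1} s * F (x \<bullet> \<xi> + (\<xi> \<bullet> \<xi>) * s)) \<partial>lborel) \<partial>lborel)"
    using shift by (intro nn_integral_mono) (auto simp: indicator_def)
  also have "\<dots> = (\<integral>\<^sup>+x. (\<integral>\<^sup>+s. indicator (cball 0 (R + norm \<xi>)) x * (indicator {0..1} s * F (x \<bullet> \<xi> + (\<xi> \<bullet> \<xi>) * s)) \<partial>lborel) \<partial>lborel)"
    by (rule lborel_pair.Fubini'[symmetric]) (use m in \<open>simp add: case_prod_beta\<close>)
  also have "\<dots> \<le> (\<integral>\<^sup>+x. indicator (cball 0 (R + norm \<xi>)) (x::'a) * (ennreal (1 / (\<xi> \<bullet> \<xi>)) * (\<integral>\<^sup>+t. F t \<partial>lborel)) \<partial>lborel)"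
  proof (intro nn_integral_mono)
    fix x :: 'a
    have "(\<integral>\<^sup>+t. F t \<partial>lborel) = ennreal (\<xi> \<bullet> \<xi>) * (\<integral>\<^sup>+s. F (x \<bullet> \<xi> + (\<xi> \<bullet> \<xi>) * s) \<partial>lborel)"
      using c by (subst nn_integral_real_affine[of F "\<xi> \<bullet> \<xi>" "x \<bullet> \<xi>"]) auto
    then have "ennreal (1 / (\<xi> \<bullet> \<xi>)) * (\<integral>\<^sup>+t. F t \<partial>lborel) = (\<integral>\<^sup>+s. F (x \<bullet> \<xi> + (\<xi> \<bullet> \<xi>) * s) \<partial>lborel)"
      using c by (simp add: mult.assoc[symmetric] ennreal_mult[symmetric])
    moreover have "(\<integral>\<^sup>+s. indicator (cball 0 (R + norm \<xi>)) x * (indicator {0..1} s * F (x \<bullet> \<xi> + (\<xi> \<bullet> \<xi>) * s)) \<partial>lborel)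
      \<le> (\<integral>\<^sup>+s. indicator (cball 0 (R + norm \<xi>)) x * F (x \<bullet> \<xi> + (\<xi> \<bullet> \<xi>) * s) \<partial>lborel)"
      by (intro nn_integral_mono) (auto simp: indicator_def)
    ultimately show "(\<integral>\<^sup>+s. indicator (cball 0 (R + norm \<xi>)) x * (indicator {0..1} s * F (x \<bullet> \<xi> + (\<xi> \<bullet> \<xi>) * s)) \<partial>lborel)
      \<le> indicator (cball 0 (R + norm \<xi>)) x * (ennreal (1 / (\<xi> \<bullet> \<xi>)) * (\<integral>\<^sup>+t. F t \<partial>lborel))"
      by (simp add: nn_integral_cmult)
  qed
  also have "\<dots> = emeasure lborel (cball (0::'a) (R + norm \<xi>)) * (ennreal (1 / (\<xi> \<bullet> \<xi>)) * (\<integral>\<^sup>+t. F t \<partial>lborel))"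
    by (subst nn_integral_multc) auto
  finally show ?thesis .
qed

text \<open>\<open>h\<close> is only Lebesgue measurable, and composing it with x \<mapsto> x
  \<bullet> \<xi> could destroy measurability. It is replaced by a Borel function that agrees with
  it off a Borel null set; \<open>nn_integral_ridge_le\<close> with the indicator of this set shows
  that its preimage is null, and with the absolute value of the Borel function that the integral is
  finite.\<close>

lemma integrable_ridge:
  fixes h :: "real \<Rightarrow> real" and \<xi> :: "'a::euclidean_space"
  assumes h: "locally_integrable h" and \<xi>: "\<xi> \<noteq> 0"
  shows "integrable lebesgue (\<lambda>x. indicator (cball 0 R) x * h (x \<bullet> \<xi>))"
proof -
  have [measurable]: "indicator (cball (0::'a) r) \<in> borel_measurable borel" for r
    by (intro borel_measurable_indicator borel_closed) auto
  define b where "b = \<bar>R\<bar> * norm \<xi>"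
  define h1 where "h1 t = indicator {- b..b} t * h t" for t
  have h1: "integrable lebesgue h1"
  proof -
    have "set_integrable lebesgue {- b..b} h"
      using h compact_Icc unfolding locally_integrable_def by blast
    then show ?thesis by (simp add: set_integrable_def h1_def[abs_def])
  qed
  then obtain h2 where h2[measurable]: "h2 \<in> borel_measurable borel" and eq: "AE t in lborel. h1 t = h2 t"
    using completion_ex_borel_measurable_real[of h1 lborel] by (auto simp: borel_measurable_integrable)
  obtain N where N: "{t \<in> space lborel. h1 t \<noteq> h2 t} \<subseteq> N" "emeasure lborel N = 0" "N \<in> sets lborel"
    using AE_E[OF eq] by blast
  have [measurable]: "N \<in> sets borel" using N(3) by simp
  have ball: "\<bar>x \<bullet> \<xi>\<bar> \<le> b" if "x \<in> cball 0 R" for x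
  proof -
    have "norm x * norm \<xi> \<le> \<bar>R\<bar> * norm \<xi>" using that by (intro mult_right_mono) auto
    then show ?thesis
      using Cauchy_Schwarz_ineq2[of x \<xi>] unfolding b_def by linarith
  qed
  have "(\<integral>\<^sup>+x. indicator (cball 0 R) (x::'a) * indicator N (x \<bullet> \<xi>) \<partial>lborel) \<le> 0"
    using nn_integral_ridge_le[of "indicator N" \<xi> R] N \<xi> by simp
  then have "AE x in lborel. indicator (cball 0 R) (x::'a) * indicator N (x \<bullet> \<xi>) = (0::ennreal)"
    by (subst (asm) le_zero_eq, subst (asm) nn_integral_0_iff_AE) measurable
  then have ae: "AE x in lborel. indicator (cball 0 R) x * h (x \<bullet> \<xi>) = indicator (cball 0 R) (x::'a) * h2 (x \<bullet> \<xi>)"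
  proof eventually_elim
    case (elim x)
    show ?case
    proof (cases "x \<in> cball 0 R")
      case True
      then have "x \<bullet> \<xi> \<notin> N" using elim by (auto simp: indicator_def split: if_splits)
      then have "h1 (x \<bullet> \<xi>) = h2 (x \<bullet> \<xi>)" using N(1) by auto
      moreover have "h1 (x \<bullet> \<xi>) = h (x \<bullet> \<xi>)" using ball[OF True] by (auto simp: h1_def indicator_def abs_le_iff)
      ultimately show ?thesis by simp
    qed simp
  qed
  have h2i: "integrable lborel h2"
  proof -
    have "integrable lebesgue h2"
    proof (rule integrable_cong_AE_imp[OF h1])
      show "h2 \<in> borel_measurable lebesgue" by (rule measurable_completion) (use h2 in simp)
      show "AE t in lebesgue. h1 t = h2 t" by (rule AE_completion[OF eq])
    qed
    then show ?thesis by (simp add: integrable_completion)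
  qed
  have "integrable lborel (\<lambda>x::'a. indicator (cball 0 R) x * h2 (x \<bullet> \<xi>))"
  proof (rule integrableI_bounded)
    have "(\<integral>\<^sup>+x. ennreal (norm (indicator (cball 0 R) (x::'a) * h2 (x \<bullet> \<xi>))) \<partial>lborel)
      = (\<integral>\<^sup>+x. indicator (cball 0 R) (x::'a) * ennreal \<bar>h2 (x \<bullet> \<xi>)\<bar> \<partial>lborel)"
      by (intro nn_integral_cong) (simp add: indicator_def)
    also have "\<dots> \<le> emeasure lborel (cball (0::'a) (R + norm \<xi>)) * (ennreal (1 / (\<xi> \<bullet> \<xi>)) * (\<integral>\<^sup>+t. ennreal \<bar>h2 t\<bar> \<partial>lborel))"
      by (rule nn_integral_ridge_le[OF _ \<xi>]) measurable
    also have "\<dots> < \<infinity>"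
    proof -
      have "(\<integral>\<^sup>+t. ennreal \<bar>h2 t\<bar> \<partial>lborel) < \<infinity>"
        using h2i by (simp add: integrable_iff_bounded)
      moreover have "emeasure lborel (cball (0::'a) (R + norm \<xi>)) < \<infinity>"
        by (rule emeasure_bounded_finite) simp
      ultimately show ?thesis by (simp add: ennreal_mult_less_top)
    qed
    finally show "(\<integral>\<^sup>+x. ennreal (norm (indicator (cball 0 R) (x::'a) * h2 (x \<bullet> \<xi>))) \<partial>lborel) < \<infinity>" .
  qed measurable
  then have i: "integrable lebesgue (\<lambda>x::'a. indicator (cball 0 R) x * h2 (x \<bullet> \<xi>))"
    by (subst integrable_completion) auto
  have ae': "AE x in lebesgue. indicator (cball 0 R) (x::'a) * h2 (x \<bullet> \<xi>) = indicator (cball 0 R) x * h (x \<bullet> \<xi>)"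
    using AE_completion[OF ae] by eventually_elim (rule sym)
  have m: "(\<lambda>x::'a. indicator (cball 0 R) x * h (x \<bullet> \<xi>)) \<in> borel_measurable lebesgue"
    by (rule borel_measurable_AE[OF borel_measurable_integrable[OF i] ae'])
  show ?thesis
    using i integrable_cong_AE[OF borel_measurable_integrable[OF i] m ae'] by simp
qed

text \<open>The ridge function is constant along v, so translating by multiples of v affects only
  \<open>u\<close>, and the difference quotients integrate to zero. The radius \<open>R0\<close>
  leaves enough room that cutting the ridge function off is not noticed by these
  translations.\<close>

lemma integral_ridge_derivative_eq_0:
  fixes u :: "'a::euclidean_space \<Rightarrow> real"
  assumes h: "locally_integrable h" and \<xi>: "\<xi> \<noteq> 0" and u: "C1_deriv u u'" and supp: "\<And>x. norm x > R \<Longrightarrow> u x = 0"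
    and v: "v \<bullet> \<xi> = 0"
  shows "integrable lebesgue (\<lambda>x. h (x \<bullet> \<xi>) * u' x v)" "(LINT x|lebesgue. h (x \<bullet> \<xi>) * u' x v) = 0"
proof -
  define R0 where "R0 = \<bar>R\<bar> + 2 * norm v"
  define G where "G x = indicator (cball 0 R0) x * h (x \<bullet> \<xi>)" for x
  have iG: "integrable lebesgue G" unfolding G_def by (rule integrable_ridge[OF h \<xi>])
  have R0: "R0 \<ge> R" unfolding R0_def using norm_ge_zero[of v] by linarith
  have [measurable]: "G \<in> borel_measurable lebesgue" using iG by (rule borel_measurable_integrable)
  have bd: "integrable lebesgue (\<lambda>x. g x * G x)" if g: "continuous_on UNIV g" for g :: "'a \<Rightarrow> real"
  proof -
    obtain M where M: "\<And>x. x \<in> cball 0 R0 \<Longrightarrow> \<bar>g x\<bar> \<le> M"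
      using continuous_bounded_on_cball[OF g] by blast
    show ?thesis
    proof (rule Bochner_Integration.integrable_bound[where f="\<lambda>x. M * G x"])
      show "integrable lebesgue (\<lambda>x. M * G x)" using iG by simp
      have [measurable]: "g \<in> borel_measurable lebesgue" using g by (rule continuous_borel_measurable_lebesgue)
      show "(\<lambda>x. g x * G x) \<in> borel_measurable lebesgue" by measurable
      show "AE x in lebesgue. norm (g x * G x) \<le> norm (M * G x)"
      proof (rule AE_I2)
        fix x
        show "norm (g x * G x) \<le> norm (M * G x)"
        proof (cases "x \<in> cball 0 R0")
          case True
          then have "\<bar>g x\<bar> \<le> \<bar>M\<bar>" using M[OF True] by linarith
          then show ?thesis by (simp add: abs_mult mult_right_mono)
        qed (simp add: G_def)
      qed
    qed
  qed
  have u'0: "u' x v = 0" if "norm x > R" for x by (rule C1_deriv_zero_outside[OF u supp that])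
  have eq: "h (x \<bullet> \<xi>) * u' x v = u' x v * G x" for x
    using u'0[of x] R0 by (cases "norm x \<le> R0") (auto simp: G_def)
  show "integrable lebesgue (\<lambda>x. h (x \<bullet> \<xi>) * u' x v)"
    unfolding eq by (rule bd[OF C1dD(2)[OF u]])
  have "(\<lambda>n. LINT x|lebesgue. (u (x + (1 / real (Suc n)) *\<^sub>R v) - u x) / (1 / real (Suc n)) * G x)
           \<longlonglongrightarrow> (LINT x|lebesgue. u' x v * G x)"
  proof (rule difference_quotient_integral[OF u, where R=R0])
    have "(\<lambda>x. indicator (cball 0 R0) x * G x) = G" by (simp add: G_def fun_eq_iff indicator_def)
    then show "integrable lebesgue (\<lambda>x. indicator (cball 0 R0) x * G x)" using iG by simp
    show "(u (x + s *\<^sub>R v) - u x) * G x = 0" if "R0 < norm x" for x s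
      using that by (simp add: G_def)
  qed measurable
  moreover have zero: "(LINT x|lebesgue. (u (x + s *\<^sub>R v) - u x) / s * G x) = 0" if s: "0 \<le> s" "s \<le> 1" for s
  proof -
    have cu: "continuous_on UNIV (\<lambda>x. u (x + s *\<^sub>R v))"
      by (intro continuous_on_UNIV_compose[OF C1dD(3)[OF u]] continuous_intros)
    have [measurable]: "u \<in> borel_measurable lebesgue"
      using C1dD(3)[OF u] by (rule continuous_borel_measurable_lebesgue)
    have sv: "norm (s *\<^sub>R v) \<le> norm v" using s by (simp add: mult_left_le_one_le)
    have "u (x + s *\<^sub>R v) * G x = u (s *\<^sub>R v + x) * G (s *\<^sub>R v + x)" for x
    proof (cases "norm (x + s *\<^sub>R v) > R")
      case True
      then show ?thesis using supp[OF True] by (simp add: add.commute)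
    next
      case False
      then have "norm (s *\<^sub>R v + x) \<le> R0" unfolding R0_def using norm_ge_zero[of v]
        by (subst add.commute) linarith
      moreover have "norm x \<le> R0"
        using norm_triangle_ineq4[of "x + s *\<^sub>R v" "s *\<^sub>R v"] sv False norm_ge_zero[of v]
        unfolding R0_def add_diff_cancel_right' by linarith
      ultimately show ?thesis using v by (simp add: G_def inner_add_left add.commute)
    qed
    then have "(LINT x|lebesgue. u (x + s *\<^sub>R v) * G x) = (LINT x|lebesgue. u (s *\<^sub>R v + x) * G (s *\<^sub>R v + x))"
      by simp
    also have "\<dots> = (LINT x|lebesgue. u x * G x)"
      by (rule integral_lebesgue_translate[of "\<lambda>x. u x * G x"]) measurable
    finally have "(LINT x|lebesgue. u (x + s *\<^sub>R v) * G x) = (LINT x|lebesgue. u x * G x)" .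
    moreover have "(LINT x|lebesgue. (u (x + s *\<^sub>R v) - u x) / s * G x) = (LINT x|lebesgue. (u (x + s *\<^sub>R v) * G x - u x * G x) / s)"
      by (simp add: left_diff_distrib)
    ultimately show ?thesis
      using bd[OF cu] bd[OF C1dD(3)[OF u]] by simp
  qed
  then have "(LINT x|lebesgue. (u (x + (1 / real (Suc n)) *\<^sub>R v) - u x) / (1 / real (Suc n)) * G x) = 0" for n
    by (intro zero) auto
  ultimately have "(\<lambda>n::nat. 0) \<longlonglongrightarrow> (LINT x|lebesgue. u' x v * G x)"
    by (simp only:)
  then show "(LINT x|lebesgue. h (x \<bullet> \<xi>) * u' x v) = 0"
    unfolding eq by (simp add: LIMSEQ_const_iff)
qed

section \<open>Test functions and the kernel of the symbol\<close>

lemma test_fun_C1_deriv: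
  assumes "test_fun U \<phi>"
  obtains \<phi>' where "C1_deriv \<phi> \<phi>'" "\<And>b x. partial b \<phi> x = \<phi>' x b"
proof -
  have "Cn (Suc 0) \<phi>" using assms by (simp add: test_fun_def smooth_def)
  from Cn_1_C1_deriv[OF this] show thesis
    by (rule that) (simp add: partial_def)
qed

lemma test_fun_outside:
  assumes "test_fun U \<phi>"
  shows "x \<notin> U \<Longrightarrow> \<phi> x = 0" "\<exists>R. \<forall>x. norm x > R \<longrightarrow> \<phi> x = 0"
proof -
  have s: "{x. \<phi> x \<noteq> 0} \<subseteq> closure {x. \<phi> x \<noteq> 0}" by (rule closure_subset)
  show "x \<notin> U \<Longrightarrow> \<phi> x = 0" using assms s by (auto simp: test_fun_def)
  have "bounded (closure {x. \<phi> x \<noteq> 0})" using assms by (simp add: test_fun_def compact_imp_bounded)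
  then obtain R where "\<forall>x\<in>closure {x. \<phi> x \<noteq> 0}. norm x \<le> R" unfolding bounded_iff by blast
  then show "\<exists>R. \<forall>x. norm x > R \<longrightarrow> \<phi> x = 0"
    using s by (intro exI[of _ R]) (auto simp: not_le[symmetric])
qed

text \<open>For each component j of the test function the coefficients of its partial derivatives
  form a vector \<open>v j\<close>, and the equation for the symbol says precisely that
  \<open>v j\<close> is orthogonal to \<xi>. The pairing is then a sum of ridge integrals that
  vanish. Read contrapositively, a nonzero vector off the cone makes the symbol injective in the
  frequency.\<close>

lemma symbol_kernel_in_wave_cone:
  fixes A :: "'d::finite \<Rightarrow> real^'m^'k"
  assumes z: "z \<noteq> 0" and \<xi>: "\<xi> \<noteq> 0" and sym: "symbol A \<xi> *v z = 0"
  shows "z \<in> wave_cone A"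
  unfolding wave_cone_def
proof (intro CollectI conjI exI[of _ \<xi>] allI impI z \<xi>)
  fix h and \<phi> :: "real^'d \<Rightarrow> real^'k"
  assume h: "locally_integrable h" and \<phi>: "test_fun UNIV \<phi>"
  obtain \<phi>' where \<phi>': "C1_deriv \<phi> \<phi>'" "\<And>b x. partial b \<phi> x = \<phi>' x b" by (rule test_fun_C1_deriv[OF \<phi>]) blast
  obtain R where R: "\<And>x. norm x > R \<Longrightarrow> \<phi> x = 0" using test_fun_outside(2)[OF \<phi>] by blast
  define v where "v j = (\<chi> l. (A l *v z) $ j)" for j
  have Cj: "C1_deriv (\<lambda>x. \<phi> x $ j) (\<lambda>x h. \<phi>' x h $ j)" for j
    using \<phi>'(1) unfolding C1_deriv_def
    by (auto intro!: continuous_intros bounded_linear.has_derivative[OF bounded_linear_vec_nth])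
  have v\<xi>: "v j \<bullet> \<xi> = 0" for j
  proof -
    have "v j \<bullet> \<xi> = (\<Sum>l\<in>UNIV. \<xi> $ l * (A l *v z) $ j)"
      by (simp add: v_def inner_vec_def mult.commute)
    also have "\<dots> = (symbol A \<xi> *v z) $ j"
      by (simp add: symbol_def matrix_vector_mult_def sum_distrib_left sum_distrib_right mult_ac)
         (rule sum.swap)
    finally show ?thesis using sym by simp
  qed
  have "(\<Sum>l\<in>UNIV. (A l *v (h (x \<bullet> \<xi>) *\<^sub>R z)) \<bullet> partial (axis l 1) \<phi> x)
      = (\<Sum>j\<in>UNIV. h (x \<bullet> \<xi>) * (\<phi>' x (v j) $ j))" for x
  proof -
    have lin: "linear (\<lambda>h. \<phi>' x h $ j)" for j by (rule C1dD(4)[OF Cj])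
    have "\<phi>' x (v j) $ j = (\<Sum>l\<in>UNIV. (A l *v z) $ j * \<phi>' x (axis l 1) $ j)" for j
    proof -
      have "v j = (\<Sum>l\<in>UNIV. (v j $ l) *\<^sub>R axis l 1)"
        by (simp add: basis_expansion scalar_mult_eq_scaleR[symmetric])
      then have "\<phi>' x (v j) $ j = (\<Sum>l\<in>UNIV. (v j $ l) * \<phi>' x (axis l 1) $ j)"
        using linear_sum[OF lin, of "\<lambda>l. (v j $ l) *\<^sub>R axis l 1" UNIV j] linear_scale[OF lin] by simp
      then show ?thesis by (simp add: v_def)
    qed
    then show ?thesis
      by (simp add: \<phi>'(2) matrix_vector_mult_scaleR inner_vec_def sum_distrib_left mult.assoc)
         (rule sum.swap)
  qed
  then have "op_pairing A (\<lambda>x. h (x \<bullet> \<xi>) *\<^sub>R z) \<phi> = - (LINT x|lebesgue. (\<Sum>j\<in>UNIV. h (x \<bullet> \<xi>) * (\<phi>' x (v j) $ j)))"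
    by (simp add: op_pairing_def)
  also have "\<dots> = 0"
    using integral_ridge_derivative_eq_0[OF h \<xi> Cj _ v\<xi>, of R] R
    by (simp add: Bochner_Integration.integral_sum)
  finally show "op_pairing A (\<lambda>x. h (x \<bullet> \<xi>) *\<^sub>R z) \<phi> = 0" .
qed

section \<open>Generated Young measures\<close>

text \<open>The complement of the support is covered by open null balls, and by the Lindelof
  property countably many of them suffice.\<close>

lemma AE_measure_support:
  fixes M :: "'a::{metric_space, second_countable_topology} measure"
  assumes sets: "sets M = sets borel"
  shows "AE y in M. y \<in> measure_support M"
proof -
  let ?F = "{ball y e |y e. e > 0 \<and> emeasure M (ball y e) = 0}"
  have "\<And>S. S \<in> ?F \<Longrightarrow> open S" by auto
  then obtain F' where F': "F' \<subseteq> ?F" "countable F'" "\<Union> F' = \<Union> ?F"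
    by (rule Lindelof)
  have "\<Union> F' \<in> null_sets M"
  proof -
    have "(\<Union>B\<in>F'. B) \<in> null_sets M"
    proof (rule null_sets_UN'[OF F'(2)])
      fix B assume "B \<in> F'"
      then show "B \<in> null_sets M" using F'(1) sets by (auto simp: null_sets_def)
    qed
    then show ?thesis by simp
  qed
  then have "AE y in M. y \<notin> \<Union> F'" by (rule AE_not_in)
  then show ?thesis
  proof eventually_elim
    case (elim y)
    show ?case
      unfolding measure_support_def
    proof (intro CollectI allI impI)
      fix e :: real assume e: "e > 0"
      show "emeasure M (ball y e) > 0"
      proof (rule ccontr)
        assume "\<not> emeasure M (ball y e) > 0"
        then have "emeasure M (ball y e) = 0" by (simp add: not_gr_zero)
        then have "ball y e \<in> ?F" using e by blast
        moreover have "y \<in> ball y e" using e by simp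
        ultimately have "y \<in> \<Union> ?F" by (rule UnionI)
        then show False using elim unfolding F'(3)[symmetric] by simp
      qed
    qed
  qed
qed

section \<open>Truncation of the generating sequence\<close>

definition norm_cutoff :: "real \<Rightarrow> 'a::real_normed_vector \<Rightarrow> real" where
  "norm_cutoff \<rho> y = max 0 (min 1 (\<rho> + 1 - norm y))"

lemma norm_cutoff_props:
  "0 \<le> norm_cutoff \<rho> y" "norm_cutoff \<rho> y \<le> 1" "norm y \<le> \<rho> \<Longrightarrow> norm_cutoff \<rho> y = 1" "norm y \<ge> \<rho> + 1 \<Longrightarrow> norm_cutoff \<rho> y = 0"
  by (auto simp: norm_cutoff_def)

lemma continuous_norm_cutoff: "continuous_on S (norm_cutoff \<rho>)"
  unfolding norm_cutoff_def by (intro continuous_intros)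

text \<open>The identity on the ball of radius \<rho>, but continuous with compact support, unlike
  the projection onto a ball. Composing any continuous function with it gives a function that is
  constant near infinity.\<close>

definition norm_truncation :: "real \<Rightarrow> 'a::real_normed_vector \<Rightarrow> 'a" where
  "norm_truncation \<rho> y = norm_cutoff \<rho> y *\<^sub>R y"

lemma continuous_norm_truncation: "continuous_on S (norm_truncation \<rho>)"
  unfolding norm_truncation_def by (intro continuous_intros continuous_norm_cutoff)

lemma C0_compact_support:
  fixes f :: "'a::euclidean_space \<Rightarrow> real"
  assumes "continuous_on UNIV f" "\<And>y. norm y \<ge> r \<Longrightarrow> f y = 0"
  shows "f \<in> C0"
  unfolding C0_def
proof (intro CollectI conjI assms(1))
  have "\<forall>\<^sub>F y in at_infinity. f y = 0"
    unfolding eventually_at_infinity using assms(2) by blast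
  then show "(f \<longlongrightarrow> 0) at_infinity"
    by (rule tendsto_eventually)
qed

locale generated_young_measure =
  fixes \<Omega> :: "(real^'d::finite) set" and z :: "nat \<Rightarrow> real^'d \<Rightarrow> real^'m::finite"
    and \<nu> :: "real^'d \<Rightarrow> (real^'m) measure" and \<rho> :: real
  assumes \<Omega>_open: "open \<Omega>" and \<Omega>_bounded: "bounded \<Omega>"
    and z_meas: "\<And>n. set_borel_measurable lebesgue \<Omega> (z n)"
    and z_int: "\<And>n. set_integrable lebesgue \<Omega> (z n)"
    and equi: "equi_integrable \<Omega> z"
    and gen: "generates \<Omega> z \<nu>"
    and supp: "\<And>x. x \<in> \<Omega> \<Longrightarrow> measure_support (\<nu> x) \<subseteq> cball 0 \<rho>"
begin

lemma \<Omega>_lmeasurable: "\<Omega> \<in> lmeasurable"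
  by (simp add: \<Omega>_open \<Omega>_bounded lmeasurable_open)

lemma \<Omega>_sets [measurable]: "\<Omega> \<in> sets lebesgue"
  using \<Omega>_lmeasurable by blast

lemma prob: "x \<in> \<Omega> \<Longrightarrow> prob_space (\<nu> x)" and sets_\<nu>: "x \<in> \<Omega> \<Longrightarrow> sets (\<nu> x) = sets borel"
  using gen unfolding generates_def young_measure_def by blast+

lemma AE_norm_le: assumes "x \<in> \<Omega>" shows "AE y in \<nu> x. norm y \<le> \<rho>"
  using AE_measure_support[OF sets_\<nu>[OF assms]]
proof eventually_elim
  case (elim y)
  then show ?case using supp[OF assms] by auto
qed

lemma measurable_\<nu>: "x \<in> \<Omega> \<Longrightarrow> continuous_on UNIV g \<Longrightarrow> g \<in> borel_measurable (\<nu> x)"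
  using borel_measurable_continuous_onI[of g] measurable_cong_sets[OF sets_\<nu> refl] by blast

lemma \<nu>_bounded:
  fixes g :: "real^'m \<Rightarrow> real"
  assumes "continuous_on UNIV g"
  obtains M where "M \<ge> 0" "\<And>y. norm y \<le> \<rho> \<Longrightarrow> \<bar>g y\<bar> \<le> M"
    "\<And>x. x \<in> \<Omega> \<Longrightarrow> integrable (\<nu> x) g" "\<And>x. x \<in> \<Omega> \<Longrightarrow> \<bar>LINT y|\<nu> x. g y\<bar> \<le> M"
proof -
  obtain M where M: "\<And>y. y \<in> cball 0 \<rho> \<Longrightarrow> \<bar>g y\<bar> \<le> M"
    using continuous_bounded_on_cball[OF assms] by blast
  define M' where "M' = \<bar>M\<bar>"
  have M': "\<bar>g y\<bar> \<le> M'" if "norm y \<le> \<rho>" for y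
    using M[of y] that by (simp add: M'_def)
  have ae: "AE y in \<nu> x. \<bar>g y\<bar> \<le> M'" if "x \<in> \<Omega>" for x
    using AE_norm_le[OF that] by eventually_elim (rule M')
  have i: "integrable (\<nu> x) g" if x: "x \<in> \<Omega>" for x
  proof -
    interpret prob_space "\<nu> x" by (rule prob[OF x])
    show ?thesis using ae[OF x] measurable_\<nu>[OF x assms] by (intro integrable_const_bound[where B=M']) auto
  qed
  have b: "\<bar>LINT y|\<nu> x. g y\<bar> \<le> M'" if x: "x \<in> \<Omega>" for x
  proof -
    interpret prob_space "\<nu> x" by (rule prob[OF x])
    have "\<bar>LINT y|\<nu> x. g y\<bar> \<le> (LINT y|\<nu> x. \<bar>g y\<bar>)" by (rule integral_abs_bound)
    also have "\<dots> \<le> M'" using ae[OF x] i[OF x] by (intro integral_le_const) auto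
    finally show ?thesis .
  qed
  show thesis by (rule that[of M']) (use M' i b in \<open>auto simp: M'_def\<close>)
qed

text \<open>The truncation starts one unit outside the supports of the measures. Thus
  \<open>z\<close> and \<open>v\<close> can differ only where \<open>norm_cutoff \<rho>\<close>
  vanishes, a set that the Young measure detects.\<close>

definition v :: "nat \<Rightarrow> real^'d \<Rightarrow> real^'m" where
  "v n x = norm_truncation (\<rho> + 1) (z n x)"

text \<open>Generation of a Young measure is tested with functions vanishing at infinity only.
  Subtracting the value at 0 makes arbitrary continuous functions accessible along the truncated
  sequence.\<close>

lemma norm_truncation_C0:
  assumes "continuous_on UNIV g"
  shows "(\<lambda>y::real^'m. g (norm_truncation (\<rho> + 1) y) - g 0) \<in> C0"
proof (rule C0_compact_support[where r="\<rho> + 2"])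
  show "continuous_on UNIV (\<lambda>y::real^'m. g (norm_truncation (\<rho> + 1) y) - g 0)"
    by (intro continuous_intros continuous_on_UNIV_compose[OF assms] continuous_norm_truncation)
qed (simp add: norm_truncation_def norm_cutoff_props)

lemma integral_norm_truncation:
  assumes x: "x \<in> \<Omega>" and g: "continuous_on UNIV (g :: real^'m \<Rightarrow> real)"
  shows "(LINT y|\<nu> x. g (norm_truncation (\<rho> + 1) y) - g 0) = (LINT y|\<nu> x. g y) - g 0"
proof -
  interpret prob_space "\<nu> x" by (rule prob[OF x])
  have "(LINT y|\<nu> x. g (norm_truncation (\<rho> + 1) y) - g 0) = (LINT y|\<nu> x. g y - g 0)"
  proof (rule integral_cong_AE)
    show "AE y in \<nu> x. g (norm_truncation (\<rho> + 1) y) - g 0 = g y - g 0"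
      using AE_norm_le[OF x] by eventually_elim (simp add: norm_truncation_def norm_cutoff_props)
    show "(\<lambda>y. g (norm_truncation (\<rho> + 1) y) - g 0) \<in> borel_measurable (\<nu> x)"
      by (intro measurable_\<nu>[OF x] continuous_intros continuous_on_UNIV_compose[OF g] continuous_norm_truncation)
    show "(\<lambda>y. g y - g 0) \<in> borel_measurable (\<nu> x)"
      by (intro measurable_\<nu>[OF x] continuous_intros g)
  qed
  also have "\<dots> = (LINT y|\<nu> x. g y) - g 0"
  proof -
    have "integrable (\<nu> x) g" using \<nu>_bounded[OF g] x by metis
    then show ?thesis by (simp add: prob_space)
  qed
  finally show ?thesis .
qed

lemma mean_meas:
  assumes g: "continuous_on UNIV (g :: real^'m \<Rightarrow> real)"
  shows "(\<lambda>x. indicator \<Omega> x * (LINT y|\<nu> x. g y)) \<in> borel_measurable lebesgue"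
proof -
  have "set_borel_measurable lebesgue \<Omega> (\<lambda>x. LINT y|\<nu> x. g (norm_truncation (\<rho> + 1) y) - g 0)"
    using gen norm_truncation_C0[OF g] unfolding generates_def young_measure_def by blast
  then have [measurable]: "(\<lambda>x. indicator \<Omega> x *\<^sub>R (LINT y|\<nu> x. g (norm_truncation (\<rho> + 1) y) - g 0)) \<in> borel_measurable lebesgue"
    unfolding set_borel_measurable_def .
  have eq: "(\<lambda>x. indicator \<Omega> x * (LINT y|\<nu> x. g y))
     = (\<lambda>x. indicator \<Omega> x *\<^sub>R (LINT y|\<nu> x. g (norm_truncation (\<rho> + 1) y) - g 0) + indicator \<Omega> x * g 0)"
  proof
    fix x
    show "indicator \<Omega> x * (LINT y|\<nu> x. g y) = indicator \<Omega> x *\<^sub>R (LINT y|\<nu> x. g (norm_truncation (\<rho> + 1) y) - g 0) + indicator \<Omega> x * g 0"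
      using integral_norm_truncation[OF _ g, of x] by (cases "x \<in> \<Omega>") simp_all
  qed
  show ?thesis unfolding eq by measurable
qed

lemma z_comp_meas:
  assumes g: "continuous_on UNIV (g :: real^'m \<Rightarrow> real)"
  shows "(\<lambda>x. indicator \<Omega> x * g (z n x)) \<in> borel_measurable lebesgue"
proof -
  have [measurable]: "(\<lambda>x. indicator \<Omega> x *\<^sub>R z n x) \<in> borel_measurable lebesgue"
    using z_meas unfolding set_borel_measurable_def .
  have [measurable]: "g \<in> borel_measurable borel" using g by (rule borel_measurable_continuous_onI)
  have "(\<lambda>x. indicator \<Omega> x * g (z n x)) = (\<lambda>x. indicator \<Omega> x * g (indicator \<Omega> x *\<^sub>R z n x))"
    by (auto simp: fun_eq_iff indicator_def)
  then show ?thesis by simp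
qed

lemma v_comp_meas:
  assumes g: "continuous_on UNIV (g :: real^'m \<Rightarrow> real)"
  shows "(\<lambda>x. indicator \<Omega> x * g (v n x)) \<in> borel_measurable lebesgue"
  unfolding v_def by (rule z_comp_meas) (intro continuous_on_UNIV_compose[OF g] continuous_norm_truncation)

lemma norm_v_le: "norm (v n x) \<le> \<bar>\<rho>\<bar> + 2"
proof (cases "norm (z n x) \<ge> \<rho> + 1 + 1")
  case False
  have "norm (v n x) \<le> 1 * norm (z n x)"
    unfolding v_def norm_truncation_def norm_scaleR using norm_cutoff_props(1,2)[of "\<rho> + 1" "z n x"]
    by (intro mult_right_mono) auto
  then show ?thesis using False by simp
qed (simp add: v_def norm_truncation_def norm_cutoff_props)

lemma v_comp_bounded:
  fixes g :: "real^'m \<Rightarrow> real"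
  assumes "continuous_on UNIV g"
  obtains M where "M \<ge> 0" "\<And>n x. \<bar>g (v n x)\<bar> \<le> M"
proof -
  obtain M where M: "\<And>y. y \<in> cball 0 (\<bar>\<rho>\<bar> + 2) \<Longrightarrow> \<bar>g y\<bar> \<le> M"
    using continuous_bounded_on_cball[OF assms] by blast
  then have "\<bar>g (v n x)\<bar> \<le> M" for n x using norm_v_le[of n x] by simp
  then show thesis using that[of "\<bar>M\<bar>"] by (meson abs_ge_self abs_ge_zero order_trans)
qed

lemma integrable_times_bounded:
  assumes i\<phi>: "integrable lebesgue (\<lambda>x. indicator \<Omega> x * \<phi> x :: real)"
    and q: "(\<lambda>x. indicator \<Omega> x * q x) \<in> borel_measurable lebesgue" and b: "\<And>x. x \<in> \<Omega> \<Longrightarrow> \<bar>q x\<bar> \<le> M"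
  shows "integrable lebesgue (\<lambda>x. indicator \<Omega> x * (\<phi> x * q x))"
proof (rule Bochner_Integration.integrable_bound[where f="\<lambda>x. M * (indicator \<Omega> x * \<phi> x)"])
  have [measurable]: "(\<lambda>x. indicator \<Omega> x * \<phi> x) \<in> borel_measurable lebesgue"
    using i\<phi> by (rule borel_measurable_integrable)
  show "integrable lebesgue (\<lambda>x. M * (indicator \<Omega> x * \<phi> x))" using i\<phi> by simp
  have "(\<lambda>x. indicator \<Omega> x * (\<phi> x * q x)) = (\<lambda>x. (indicator \<Omega> x * \<phi> x) * (indicator \<Omega> x * q x))"
    by (auto simp: fun_eq_iff indicator_def)
  then show "(\<lambda>x. indicator \<Omega> x * (\<phi> x * q x)) \<in> borel_measurable lebesgue" using q by simp
  show "AE x in lebesgue. norm (indicator \<Omega> x * (\<phi> x * q x)) \<le> norm (M * (indicator \<Omega> x * \<phi> x))"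
  proof (rule AE_I2)
    fix x
    show "norm (indicator \<Omega> x * (\<phi> x * q x)) \<le> norm (M * (indicator \<Omega> x * \<phi> x))"
    proof (cases "x \<in> \<Omega>")
      case True
      have "\<bar>q x\<bar> \<le> \<bar>M\<bar>" using b[OF True] by linarith
      from mult_left_mono[OF this abs_ge_zero[of "\<phi> x"]] show ?thesis using True by (simp add: abs_mult mult.commute)
    qed simp
  qed
qed

text \<open>The constant \<open>g 0\<close> removed in \<open>norm_truncation_C0\<close> is restored
  on both sides through the integral of \<phi>. On the right the truncation leaves no trace because
  each \<open_placeholder>\<close>

lemma young_limit:
  assumes g: "continuous_on UNIV (g :: real^'m \<Rightarrow> real)" and \<phi>: "set_integrable lebesgue \<Omega> \<phi>"
  shows "(\<lambda>n. LINT x|lebesgue. indicator \<Omega> x * (\<phi> x * g (v n x)))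
     \<longlonglongrightarrow> (LINT x|lebesgue. indicator \<Omega> x * (\<phi> x * (LINT y|\<nu> x. g y)))"
proof -
  have i\<phi>: "integrable lebesgue (\<lambda>x. indicator \<Omega> x * \<phi> x)"
    using \<phi> by (simp add: set_integrable_def)
  let ?f = "\<lambda>y. g (norm_truncation (\<rho> + 1) y) - g 0"
  have "(\<lambda>n. LINT x:\<Omega>|lebesgue. \<phi> x * ?f (z n x)) \<longlonglongrightarrow> (LINT x:\<Omega>|lebesgue. \<phi> x * (LINT y|\<nu> x. ?f y))"
    using gen \<phi> norm_truncation_C0[OF g] unfolding generates_def by blast
  then have 1: "(\<lambda>n. (LINT x:\<Omega>|lebesgue. \<phi> x * ?f (z n x)) + g 0 * (LINT x|lebesgue. indicator \<Omega> x * \<phi> x))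
      \<longlonglongrightarrow> (LINT x:\<Omega>|lebesgue. \<phi> x * (LINT y|\<nu> x. ?f y)) + g 0 * (LINT x|lebesgue. indicator \<Omega> x * \<phi> x)"
    by (intro tendsto_add tendsto_const)
  obtain M where M: "M \<ge> 0" "\<And>n x. \<bar>g (v n x)\<bar> \<le> M" by (rule v_comp_bounded[OF g]) blast
  obtain M' where M': "\<And>x. x \<in> \<Omega> \<Longrightarrow> \<bar>LINT y|\<nu> x. g y\<bar> \<le> M'" by (rule \<nu>_bounded[OF g]) blast
  have 2: "(LINT x:\<Omega>|lebesgue. \<phi> x * ?f (z n x)) + g 0 * (LINT x|lebesgue. indicator \<Omega> x * \<phi> x)
     = (LINT x|lebesgue. indicator \<Omega> x * (\<phi> x * g (v n x)))" for n
  proof -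
    have "(LINT x:\<Omega>|lebesgue. \<phi> x * ?f (z n x)) = (LINT x|lebesgue. indicator \<Omega> x * (\<phi> x * g (v n x)) - g 0 * (indicator \<Omega> x * \<phi> x))"
      unfolding set_lebesgue_integral_def v_def by (intro Bochner_Integration.integral_cong) (auto simp: algebra_simps)
    also have "\<dots> = (LINT x|lebesgue. indicator \<Omega> x * (\<phi> x * g (v n x))) - (LINT x|lebesgue. g 0 * (indicator \<Omega> x * \<phi> x))"
      using integrable_times_bounded[OF i\<phi> v_comp_meas[OF g] M(2)] i\<phi>
      by (intro Bochner_Integration.integral_diff integrable_mult_right) auto
    finally show ?thesis by simp
  qed
  have 3: "(LINT x:\<Omega>|lebesgue. \<phi> x * (LINT y|\<nu> x. ?f y)) + g 0 * (LINT x|lebesgue. indicator \<Omega> x * \<phi> x)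
     = (LINT x|lebesgue. indicator \<Omega> x * (\<phi> x * (LINT y|\<nu> x. g y)))"
  proof -
    have "(LINT x:\<Omega>|lebesgue. \<phi> x * (LINT y|\<nu> x. ?f y)) = (LINT x|lebesgue. indicator \<Omega> x * (\<phi> x * (LINT y|\<nu> x. g y)) - g 0 * (indicator \<Omega> x * \<phi> x))"
      unfolding set_lebesgue_integral_def
    proof (intro Bochner_Integration.integral_cong refl)
      fix x
      show "indicator \<Omega> x *\<^sub>R (\<phi> x * (LINT y|\<nu> x. ?f y)) = indicator \<Omega> x * (\<phi> x * (LINT y|\<nu> x. g y)) - g 0 * (indicator \<Omega> x * \<phi> x)"
      proof (cases "x \<in> \<Omega>")
        case True
        show ?thesis unfolding integral_norm_truncation[OF True g] using True by (simp add: algebra_simps)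
      qed simp
    qed
    also have "\<dots> = (LINT x|lebesgue. indicator \<Omega> x * (\<phi> x * (LINT y|\<nu> x. g y))) - (LINT x|lebesgue. g 0 * (indicator \<Omega> x * \<phi> x))"
      using integrable_times_bounded[OF i\<phi> mean_meas[OF g] M'] i\<phi>
      by (intro Bochner_Integration.integral_diff integrable_mult_right) auto
    finally show ?thesis by simp
  qed
  show ?thesis using 1 unfolding 2 3 .
qed

lemma norm_z_minus_v_le: "norm (z n x - v n x) \<le> norm (z n x)"
proof -
  have "z n x - v n x = (1 - norm_cutoff (\<rho> + 1) (z n x)) *\<^sub>R z n x" by (simp add: v_def norm_truncation_def scaleR_diff_left)
  then have "norm (z n x - v n x) = \<bar>1 - norm_cutoff (\<rho> + 1) (z n x)\<bar> * norm (z n x)" by (simp only: norm_scaleR)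
  also have "\<dots> \<le> 1 * norm (z n x)"
    using norm_cutoff_props(1,2)[of "\<rho> + 1" "z n x"] by (intro mult_right_mono) auto
  finally show ?thesis by simp
qed

lemma z_minus_v_integrable:
  "integrable lebesgue (\<lambda>x. indicator \<Omega> x * norm (z n x - v n x))"
proof (rule Bochner_Integration.integrable_bound[where f="\<lambda>x. norm (indicator \<Omega> x *\<^sub>R z n x)"])
  show "integrable lebesgue (\<lambda>x. norm (indicator \<Omega> x *\<^sub>R z n x))"
    using z_int unfolding set_integrable_def by (rule integrable_norm)
  show "(\<lambda>x. indicator \<Omega> x * norm (z n x - v n x)) \<in> borel_measurable lebesgue"
    unfolding v_def by (rule z_comp_meas[of "\<lambda>y. norm (y - norm_truncation (\<rho> + 1) y)"]) (intro continuous_intros continuous_norm_truncation)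
  show "AE x in lebesgue. norm (indicator \<Omega> x * norm (z n x - v n x)) \<le> norm (norm (indicator \<Omega> x *\<^sub>R z n x))"
    using norm_z_minus_v_le by (intro AE_I2) (simp add: indicator_def)
qed

lemma z_minus_v_limit:
  "(\<lambda>n. LINT x|lebesgue. indicator \<Omega> x * norm (z n x - v n x)) \<longlonglongrightarrow> 0"
proof (rule tendstoI)
  fix e :: real assume e: "e > 0"
  then obtain \<delta> where \<delta>: "\<delta> > 0" "\<And>E n. E \<in> sets lebesgue \<Longrightarrow> E \<subseteq> \<Omega> \<Longrightarrow> measure lebesgue E < \<delta> \<Longrightarrow> (LINT x:E|lebesgue. norm (z n x)) < e"
    using equi unfolding equi_integrable_def by metis
  define E where "E n = {x \<in> \<Omega>. norm (z n x) > \<rho> + 1}" for n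
  have [measurable]: "(\<lambda>x. indicator \<Omega> x *\<^sub>R z n x) \<in> borel_measurable lebesgue" for n
    using z_meas unfolding set_borel_measurable_def .
  have Es: "E n \<in> sets lebesgue" for n
  proof -
    have "E n = \<Omega> \<inter> {x \<in> space lebesgue. norm (indicator \<Omega> x *\<^sub>R z n x) > \<rho> + 1}"
      by (auto simp: E_def)
    also have "\<dots> \<in> sets lebesgue" by measurable
    finally show ?thesis .
  qed
  have "norm_cutoff \<rho> \<in> (C0 :: (real^'m \<Rightarrow> real) set)"
    by (rule C0_compact_support[where r="\<rho> + 1"]) (auto simp: norm_cutoff_props continuous_norm_cutoff)
  moreover have "set_integrable lebesgue \<Omega> (\<lambda>x. 1::real)"
    using \<Omega>_lmeasurable by (simp add: set_integrable_def lmeasurable_iff_integrable)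
  ultimately have "(\<lambda>n. LINT x:\<Omega>|lebesgue. 1 * norm_cutoff \<rho> (z n x)) \<longlonglongrightarrow> (LINT x:\<Omega>|lebesgue. 1 * (LINT y|\<nu> x. norm_cutoff \<rho> y))"
    using gen unfolding generates_def by blast
  moreover have "(LINT x:\<Omega>|lebesgue. 1 * (LINT y|\<nu> x. norm_cutoff \<rho> y)) = measure lebesgue \<Omega>"
  proof -
    have one: "(LINT y|\<nu> x. norm_cutoff \<rho> y) = 1" if x: "x \<in> \<Omega>" for x
    proof -
      interpret prob_space "\<nu> x" by (rule prob[OF x])
      have "(LINT y|\<nu> x. norm_cutoff \<rho> y) = (LINT y|\<nu> x. 1)"
      proof (rule integral_cong_AE)
        show "AE y in \<nu> x. norm_cutoff \<rho> y = 1"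
          using AE_norm_le[OF x] by eventually_elim (rule norm_cutoff_props)
      qed (auto intro: measurable_\<nu>[OF x] continuous_norm_cutoff)
      then show ?thesis by (simp add: prob_space)
    qed
    have "(LINT x:\<Omega>|lebesgue. 1 * (LINT y|\<nu> x. norm_cutoff \<rho> y)) = (LINT x|lebesgue. indicator \<Omega> x)"
      unfolding set_lebesgue_integral_def
    proof (intro Bochner_Integration.integral_cong refl)
      fix x
      show "indicator \<Omega> x *\<^sub>R (1 * (LINT y|\<nu> x. norm_cutoff \<rho> y)) = indicator \<Omega> x"
        using one[of x] by (cases "x \<in> \<Omega>") simp_all
    qed
    then show ?thesis by simp
  qed
  ultimately have "(\<lambda>n. LINT x|lebesgue. indicator \<Omega> x * norm_cutoff \<rho> (z n x)) \<longlonglongrightarrow> measure lebesgue \<Omega>"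
    by (simp add: set_lebesgue_integral_def)
  then have "\<forall>\<^sub>F n in sequentially. (LINT x|lebesgue. indicator \<Omega> x * norm_cutoff \<rho> (z n x)) > measure lebesgue \<Omega> - \<delta>"
    using \<delta>(1) by (intro order_tendstoD(1)) auto
  then show "\<forall>\<^sub>F n in sequentially. dist (LINT x|lebesgue. indicator \<Omega> x * norm (z n x - v n x)) 0 < e"
  proof eventually_elim
    case (elim n)
    have iO: "integrable lebesgue (\<lambda>x. indicator \<Omega> x :: real)"
      using \<Omega>_lmeasurable by (simp add: lmeasurable_iff_integrable)
    have En: "E n \<in> lmeasurable"
      by (rule fmeasurableI2[OF \<Omega>_lmeasurable _ Es]) (auto simp: E_def)
    have ic: "integrable lebesgue (\<lambda>x. indicator \<Omega> x * norm_cutoff \<rho> (z n x))"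
    proof (rule Bochner_Integration.integrable_bound[OF iO])
      show "(\<lambda>x. indicator \<Omega> x * norm_cutoff \<rho> (z n x)) \<in> borel_measurable lebesgue"
        by (rule z_comp_meas[OF continuous_norm_cutoff])
      show "AE x in lebesgue. norm (indicator \<Omega> x * norm_cutoff \<rho> (z n x)) \<le> norm (indicator \<Omega> x :: real)"
        by (intro AE_I2) (simp add: indicator_def abs_of_nonneg norm_cutoff_props(1,2))
    qed
    have "measure lebesgue (E n) = (LINT x|lebesgue. indicator (E n) x)" by simp
    also have "\<dots> \<le> (LINT x|lebesgue. indicator \<Omega> x - indicator \<Omega> x * norm_cutoff \<rho> (z n x))"
    proof (rule integral_mono)
      show "integrable lebesgue (\<lambda>x. indicator (E n) x :: real)" using En by (simp add: lmeasurable_iff_integrable)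
      show "integrable lebesgue (\<lambda>x. indicator \<Omega> x - indicator \<Omega> x * norm_cutoff \<rho> (z n x))"
        using iO ic by (rule Bochner_Integration.integrable_diff)
      show "indicator (E n) x \<le> indicator \<Omega> x - indicator \<Omega> x * norm_cutoff \<rho> (z n x)" for x
        using norm_cutoff_props(1,2)[of \<rho> "z n x"] norm_cutoff_props(4)[of \<rho> "z n x"] by (auto simp: E_def indicator_def)
    qed
    also have "\<dots> = measure lebesgue \<Omega> - (LINT x|lebesgue. indicator \<Omega> x * norm_cutoff \<rho> (z n x))"
      using iO ic by (subst Bochner_Integration.integral_diff) auto
    finally have "measure lebesgue (E n) < \<delta>" using elim by simp
    then have small: "(LINT x:E n|lebesgue. norm (z n x)) < e"
      using Es by (intro \<delta>(2)) (auto simp: E_def)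
    have iE: "integrable lebesgue (\<lambda>x. indicator (E n) x * norm (z n x))"
    proof -
      have "set_integrable lebesgue (E n) (z n)"
        by (rule set_integrable_subset[OF z_int Es]) (auto simp: E_def)
      from integrable_norm[OF this[unfolded set_integrable_def]] show ?thesis
        by simp
    qed
    have "(LINT x|lebesgue. indicator \<Omega> x * norm (z n x - v n x)) \<le> (LINT x|lebesgue. indicator (E n) x * norm (z n x))"
    proof (rule integral_mono[OF z_minus_v_integrable iE])
      fix x
      show "indicator \<Omega> x * norm (z n x - v n x) \<le> indicator (E n) x * norm (z n x)"
      proof (cases "x \<in> E n")
        case True
        then show ?thesis using norm_z_minus_v_le[of n x] by (simp add: E_def)
      next
        case False
        then show ?thesis by (cases "x \<in> \<Omega>") (auto simp: E_def v_def norm_truncation_def norm_cutoff_props)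
      qed
    qed
    also have "\<dots> < e" using small by (simp add: set_lebesgue_integral_def)
    finally have "(LINT x|lebesgue. indicator \<Omega> x * norm (z n x - v n x)) < e" .
    moreover have "(LINT x|lebesgue. indicator \<Omega> x * norm (z n x - v n x)) \<ge> 0"
      by (intro Bochner_Integration.integral_nonneg) auto
    ultimately show ?case by simp
  qed
qed

end

section \<open>Pairing with the differential operator\<close>

lemma C1_deriv_linear:
  assumes "C1_deriv f f'" "bounded_linear T"
  shows "C1_deriv (\<lambda>x. T (f x)) (\<lambda>x h. T (f' x h))"
  unfolding C1_deriv_def
  by (intro conjI allI bounded_linear.has_derivative[OF assms(2) C1dD(1)[OF assms(1)]]
      bounded_linear.continuous_on[OF assms(2) C1dD(2)[OF assms(1)]])

lemma Cn_linear:
  assumes T: "bounded_linear T" and "Cn n f"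
  shows "Cn n (\<lambda>x. T (f x))"
  using assms(2)
proof (induction n arbitrary: f)
  case 0
  then show ?case using bounded_linear.continuous_on[OF T] by auto
next
  case (Suc n)
  then have C: "C1_deriv f (\<lambda>x. frechet_derivative f (at x))"
    by (intro C1_deriv_frechet) (auto intro: Cn_continuous)
  note C' = C1_deriv_linear[OF C T]
  have "partial b (\<lambda>x. T (f x)) = (\<lambda>x. T (partial b f x))" for b
    using has_derivative_partial[OF C1dD(1)[OF C']] by (simp add: fun_eq_iff partial_def[abs_def])
  then show ?case
    using Suc C1dD[OF C'] by (auto simp: differentiable_def)
qed

lemma test_fun_linear:
  assumes T: "bounded_linear T" and f: "test_fun U f"
  shows "test_fun U (\<lambda>x. T (f x))"
proof -
  have T0: "T 0 = 0" using T by (simp add: linear_simps)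
  have sub: "closure {x. T (f x) \<noteq> 0} \<subseteq> closure {x. f x \<noteq> 0}"
    using T0 by (intro closure_mono) auto
  have "compact (closure {x. f x \<noteq> 0})" using f by (simp add: test_fun_def)
  then have "compact (closure {x. T (f x) \<noteq> 0})"
    using sub by (metis closed_closure compact_Int_closed inf.absorb_iff2)
  then show ?thesis
    using f sub Cn_linear[OF T] by (auto simp: test_fun_def smooth_def)
qed

lemma test_fun_deriv_outside:
  assumes f: "test_fun U f" "C1_deriv f f'" and x: "x \<notin> U"
  shows "f' x h = 0"
proof -
  let ?C = "closure {x. f x \<noteq> 0}"
  have "x \<notin> ?C" using f x by (auto simp: test_fun_def)
  have "((\<lambda>x. 0) has_derivative f' x) (at x)"
  proof (rule has_derivative_transform_within_open[OF C1dD(1)[OF f(2)], of "- ?C"])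
    show "f y = 0" if "y \<in> - ?C" for y
      using that closure_subset[of "{x. f x \<noteq> 0}"] by auto
  qed (use \<open>x \<notin> ?C\<close> in auto)
  then have "f' x = (\<lambda>h. 0)"
    using has_derivative_const has_derivative_unique by blast
  then show ?thesis by simp
qed

lemma pairing_le_Wm1_norm:
  fixes A :: "'d::finite \<Rightarrow> real^'m^'k" and \<Omega> :: "(real^'d) set"
  assumes \<Omega>: "open \<Omega>" "bounded \<Omega>" and r: "r > 1"
  obtains Cw where "Cw \<ge> 0"
    "\<And>\<phi> \<phi>' B u w. test_fun \<Omega> \<phi> \<Longrightarrow> C1_deriv \<phi> \<phi>' \<Longrightarrow> (\<And>x l. norm (\<phi>' x (axis l 1)) \<le> B) \<Longrightarrow>
      Wm1_norm A \<Omega> r u \<le> ereal w \<Longrightarrow> \<bar>op_pairing A u \<phi>\<bar> \<le> Cw * B * w"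
proof -
  obtain R where R: "R > 0" "\<And>x. x \<in> \<Omega> \<Longrightarrow> norm x \<le> R"
    using \<Omega>(2) bounded_pos[of \<Omega>] by blast
  define V where "V = measure lebesgue \<Omega>"
  have V: "V \<ge> 0" by (simp add: V_def)
  have \<Omega>m: "\<Omega> \<in> lmeasurable" by (simp add: \<Omega> lmeasurable_open)
  define c1 where "c1 = 2 * R + 2"
  define d where "d = real CARD('d)"
  have d: "d \<ge> 0" by (simp add: d_def)
  define t where "t = 1 / (1 + V * (1 + d))"
  have den: "1 + V * (1 + d) \<ge> 1" using V d by simp
  have t: "t > 0" "t \<le> 1" using den by (auto simp: t_def)
  define q where "q = r / (r - 1)"
  have q: "q \<ge> 1" using r by (simp add: q_def field_simps)
  show thesis
  proof (rule that[of "c1 / t"])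
    show "c1 / t \<ge> 0" using t R by (simp add: c1_def)
    fix \<phi> :: "real^'d \<Rightarrow> real^'k" and \<phi>' B and u :: "real^'d \<Rightarrow> real^'m" and w
    assume \<phi>: "test_fun \<Omega> \<phi>" "C1_deriv \<phi> \<phi>'" and B: "\<And>x l. norm (\<phi>' x (axis l 1)) \<le> B"
      and w: "Wm1_norm A \<Omega> r u \<le> ereal w"
    have B0: "B \<ge> 0" by (rule order_trans[OF norm_ge_zero B])
    have part: "partial b \<phi> x = \<phi>' x b" for b x
      by (rule has_derivative_partial[OF C1dD(1)[OF \<phi>(2)]])
    have bd: "norm (\<phi> x) \<le> B * (2 * R + 1)" for x
    proof (cases "x \<in> \<Omega>")
      case False
      then have "\<phi> x = 0" by (rule test_fun_outside(1)[OF \<phi>(1)])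
      then show ?thesis using B0 R(1) by simp
    next
      case True
      define e where "e = axis (undefined::'d) (1::real)"
      define s where "s = 2 * R + 1"
      have s: "s > 0" using R(1) by (simp add: s_def)
      have "norm (x + s *\<^sub>R e) \<ge> s - R"
        using norm_triangle_ineq4[of "x + s *\<^sub>R e" x] R(2)[OF True] s by (simp add: e_def)
      then have "norm (x + s *\<^sub>R e) > R" using R(1) by (simp add: s_def)
      then have "x + s *\<^sub>R e \<notin> \<Omega>" using R(2) by force
      then have z: "\<phi> (x + s *\<^sub>R e) = 0" by (rule test_fun_outside(1)[OF \<phi>(1)])
      have C: "C1_deriv (\<lambda>y. \<phi> y \<bullet> \<phi> x) (\<lambda>y h. \<phi>' y h \<bullet> \<phi> x)"
        using \<phi>(2) by (rule C1_deriv_linear) (rule bounded_linear_inner_left)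
      have "\<bar>\<phi> (x + s *\<^sub>R e) \<bullet> \<phi> x - \<phi> x \<bullet> \<phi> x\<bar> \<le> (B * norm (\<phi> x)) * s"
      proof (rule C1_deriv_diff_bound[OF C _ s])
        fix t
        have "\<bar>\<phi>' (x + t *\<^sub>R e) e \<bullet> \<phi> x\<bar> \<le> norm (\<phi>' (x + t *\<^sub>R e) e) * norm (\<phi> x)"
          by (rule Cauchy_Schwarz_ineq2)
        also have "\<dots> \<le> B * norm (\<phi> x)" unfolding e_def by (intro mult_right_mono B) auto
        finally show "\<bar>\<phi>' (x + t *\<^sub>R e) e \<bullet> \<phi> x\<bar> \<le> B * norm (\<phi> x)" .
      qed
      then have "norm (\<phi> x) * norm (\<phi> x) \<le> (B * s) * norm (\<phi> x)"
        by (simp add: z power2_norm_eq_inner[symmetric] power2_eq_square mult_ac)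
      then show ?thesis
        unfolding s_def[symmetric] using B0 s
        by (cases "\<phi> x = 0") (auto simp: mult_le_cancel_right)
    qed
    show "\<bar>op_pairing A u \<phi>\<bar> \<le> c1 / t * B * w"
    proof (cases "B = 0")
      case True
      then have "\<phi>' x (axis l 1) = 0" for x l using B[of x l] by simp
      then have "op_pairing A u \<phi> = 0" by (simp add: op_pairing_def part)
      then show ?thesis using True by simp
    next
      case False
      then have Bp: "B > 0" using B0 by simp
      define k where "k = t / (c1 * B)"
      have c1: "c1 > 0" using R(1) by (simp add: c1_def)
      have k: "k > 0" using t Bp c1 by (simp add: k_def)
      define fk where "fk x = k *\<^sub>R \<phi> x" for x
      have fkt: "test_fun \<Omega> fk" unfolding fk_def by (rule test_fun_linear[OF bounded_linear_scaleR_right \<phi>(1)])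
      have fkC: "C1_deriv fk (\<lambda>x h. k *\<^sub>R \<phi>' x h)" unfolding fk_def by (rule C1_deriv_linear[OF \<phi>(2) bounded_linear_scaleR_right])
      have fkp: "partial b fk x = k *\<^sub>R \<phi>' x b" for b x
        by (rule has_derivative_partial[OF C1dD(1)[OF fkC]])
      have kc: "k * (c1 * B) = t" using Bp c1 by (simp add: k_def)
      have b1: "norm (fk x) \<le> t" for x
      proof -
        have "norm (\<phi> x) \<le> c1 * B" using bd[of x] B0 by (simp add: c1_def algebra_simps)
        from mult_left_mono[OF this, of k] show ?thesis using k kc by (simp add: fk_def)
      qed
      have b2: "norm (partial (axis l 1) fk x) \<le> t" for l x
      proof -
        have "1 * B \<le> c1 * B" using B0 R(1) by (intro mult_right_mono) (auto simp: c1_def)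
        then have "norm (\<phi>' x (axis l 1)) \<le> c1 * B" using B[of x l] by simp
        from mult_left_mono[OF this, of k] show ?thesis using k kc by (simp add: fkp)
      qed
      have pw: "s powr q \<le> t" if "0 \<le> s" "s \<le> t" for s
      proof -
        have "s powr q \<le> t powr q" using that q by (intro powr_mono2) auto
        also have "\<dots> \<le> t powr 1" using t q by (intro powr_mono') auto
        finally show ?thesis using t by simp
      qed
      let ?F = "\<lambda>x. norm (fk x) powr q + (\<Sum>l\<in>UNIV. norm (partial (axis l 1) fk x) powr q)"
      have Fle: "?F x \<le> ((1 + d) * t) * indicator \<Omega> x" for x
      proof (cases "x \<in> \<Omega>")
        case True
        have "?F x \<le> t + (\<Sum>l\<in>(UNIV::'d set). t)"
          using b1 b2 by (intro add_mono sum_mono pw) auto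
        then show ?thesis using True by (simp add: d_def algebra_simps)
      next
        case False
        then have "fk x = 0" "partial (axis l 1) fk x = 0" for l
          using test_fun_outside(1)[OF fkt] test_fun_deriv_outside[OF \<phi> False] fkp by auto
        then show ?thesis using False by simp
      qed
      have F0: "?F x \<ge> 0" for x by (intro add_nonneg_nonneg sum_nonneg) auto
      have "(LINT x|lebesgue. ?F x) \<le> (LINT x|lebesgue. ((1 + d) * t) * indicator \<Omega> x)"
      proof (rule integral_mono_AE')
        show "integrable lebesgue (\<lambda>x. ((1 + d) * t) * indicator \<Omega> x)"
          using \<Omega>m by (intro integrable_mult_right) (simp add: lmeasurable_iff_integrable)
      qed (use Fle d t in \<open>auto intro!: AE_I2\<close>)
      also have "\<dots> = (1 + d) * t * V" by (simp add: V_def)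
      also have "\<dots> = (V * (1 + d)) / (1 + V * (1 + d))" by (simp add: t_def mult_ac)
      also have "\<dots> \<le> 1" using den by simp
      finally have I1: "(LINT x|lebesgue. ?F x) \<le> 1" .
      have I0: "(LINT x|lebesgue. ?F x) \<ge> 0" using F0 by (intro Bochner_Integration.integral_nonneg)
      have "W1_norm q fk \<le> 1"
        unfolding W1_norm_def using I0 I1 q by (intro powr_le1) auto
      then have "ereal \<bar>op_pairing A u fk\<bar> \<le> Wm1_norm A \<Omega> r u"
        unfolding Wm1_norm_def q_def[symmetric] using fkt by (intro SUP_upper) auto
      then have "\<bar>op_pairing A u fk\<bar> \<le> w" using w by (metis ereal_less_eq(3) order_trans)
      moreover have "op_pairing A u fk = k * op_pairing A u \<phi>"
        unfolding op_pairing_def fkp part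
        by (simp add: sum_distrib_left[symmetric])
      ultimately have "k * \<bar>op_pairing A u \<phi>\<bar> \<le> w" using k by (simp add: abs_mult)
      then have "\<bar>op_pairing A u \<phi>\<bar> \<le> w / k" using k by (simp add: field_simps)
      also have "w / k = c1 / t * B * w" using t Bp c1 by (simp add: k_def field_simps)
      finally show ?thesis .
    qed
  qed
qed

definition seg_coord :: "'a::real_inner \<Rightarrow> 'a \<Rightarrow> 'a \<Rightarrow> real" where
  "seg_coord a \<zeta> y = max 0 (min 1 (((y - a) \<bullet> \<zeta>) / (\<zeta> \<bullet> \<zeta>)))"

definition seg_err :: "'a::real_inner \<Rightarrow> 'a \<Rightarrow> 'a \<Rightarrow> real" where
  "seg_err a \<zeta> y = norm (y - a - seg_coord a \<zeta> y *\<^sub>R \<zeta>)"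

lemma continuous_seg: 
  "continuous_on S (seg_coord a \<zeta>)" "continuous_on S (seg_err a \<zeta>)"
proof -
  show *: "continuous_on S (seg_coord a \<zeta>)" for S
    unfolding seg_coord_def divide_inverse by (intro continuous_intros)
  show "continuous_on S (seg_err a \<zeta>)"
    unfolding seg_err_def by (intro continuous_intros *)
qed

lemma seg_coord_bounds: "0 \<le> seg_coord a \<zeta> y" "seg_coord a \<zeta> y \<le> 1"
  by (auto simp: seg_coord_def)

context generated_young_measure
begin

text \<open>The matrix \<open>N\<close> converts a test field with divergence \<open>g\<close> into a test function on which the operator, applied to a scalar multiple of \<open>\<zeta>\<close>, acts as \<open>g\<close>.\<close>

lemma coordinate_pairing_bound:
  fixes A :: "'d \<Rightarrow> real^'m^'k" and N :: "real^'d^'k"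
  assumes N: "\<And>l i. (A l *v \<zeta>) \<bullet> (N *v axis i 1) = (if l = i then 1 else 0)" and r: "r > 1"
  obtains Ca Cw where "Ca \<ge> 0" "Cw \<ge> 0"
    "\<And>\<Omega>' \<psi> \<psi>' B w n. open \<Omega>' \<Longrightarrow> \<Omega>' \<subseteq> \<Omega> \<Longrightarrow> test_fun \<Omega>' \<psi> \<Longrightarrow> C1_deriv \<psi> \<psi>' \<Longrightarrow> (\<And>x i j. \<bar>\<psi>' x (axis j 1) $ i\<bar> \<le> B) \<Longrightarrow>
      Wm1_norm A \<Omega> r (z n) \<le> ereal w \<Longrightarrow>
      \<bar>LINT x|lebesgue. indicator \<Omega>' x * (seg_coord a \<zeta> (v n x) * (\<Sum>i\<in>UNIV. \<psi>' x (axis i 1) $ i))\<bar>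
       \<le> B * (Cw * w + Ca * ((LINT x|lebesgue. indicator \<Omega> x * norm (z n x - v n x))
          + (LINT x|lebesgue. indicator \<Omega>' x * seg_err a \<zeta> (v n x))))"
proof -
  obtain C0 where C0: "C0 \<ge> 0"
    "\<And>\<phi> \<phi>' B u w. test_fun \<Omega> \<phi> \<Longrightarrow> C1_deriv \<phi> \<phi>' \<Longrightarrow> (\<And>x l. norm (\<phi>' x (axis l 1)) \<le> B) \<Longrightarrow>
      Wm1_norm A \<Omega> r u \<le> ereal w \<Longrightarrow> \<bar>op_pairing A u \<phi>\<bar> \<le> C0 * B * w"
    by (rule pairing_le_Wm1_norm[OF \<Omega>_open \<Omega>_bounded r, where A=A]) blast
  define d where "d = real CARD('d)"
  have d0: "d \<ge> 0" by (simp add: d_def)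
  define nN where "nN = onorm (\<lambda>y. N *v y)"
  have nN: "norm (N *v y) \<le> nN * norm y" for y
    unfolding nN_def by (rule onorm[OF matrix_vector_mul_bounded_linear])
  have nN0: "nN \<ge> 0" unfolding nN_def by (rule onorm_pos_le[OF matrix_vector_mul_bounded_linear])
  define nA where "nA l = onorm (\<lambda>y. A l *v y)" for l
  have nA: "norm (A l *v y) \<le> nA l * norm y" for l y
    unfolding nA_def by (rule onorm[OF matrix_vector_mul_bounded_linear])
  have nA0: "nA l \<ge> 0" for l unfolding nA_def by (rule onorm_pos_le[OF matrix_vector_mul_bounded_linear])
  define Ca where "Ca = (\<Sum>l\<in>UNIV. nA l) * (nN * d)"
  have Ca0: "Ca \<ge> 0" using nA0 nN0 d0 by (simp add: Ca_def sum_nonneg)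
  show thesis
  proof (rule that[OF Ca0, of "C0 * (nN * d)"])
    show "C0 * (nN * d) \<ge> 0" using C0(1) nN0 d0 by simp
    fix \<Omega>' :: "(real^'d) set" and \<psi> :: "real^'d \<Rightarrow> real^'d" and \<psi>' B w n
    assume \<Omega>': "open \<Omega>'" "\<Omega>' \<subseteq> \<Omega>" and \<psi>: "test_fun \<Omega>' \<psi>" "C1_deriv \<psi> \<psi>'"
      and B: "\<And>x i j. \<bar>\<psi>' x (axis j 1) $ i\<bar> \<le> B" and w: "Wm1_norm A \<Omega> r (z n) \<le> ereal w"
    have \<psi>\<Omega>: "test_fun \<Omega> \<psi>" using \<psi>(1) \<Omega>'(2) by (auto simp: test_fun_def)
    have B0: "B \<ge> 0" by (rule order_trans[OF abs_ge_zero B])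
    have nB: "norm (\<psi>' x (axis l 1)) \<le> d * B" for x l
    proof -
      have "(\<Sum>i\<in>UNIV. \<bar>\<psi>' x (axis l 1) $ i\<bar>) \<le> (\<Sum>i\<in>(UNIV::'d set). B)" by (intro sum_mono B)
      then show ?thesis using norm_le_l1_cart[of "\<psi>' x (axis l 1)"] by (simp add: d_def)
    qed
    define W where "W x l = N *v \<psi>' x (axis l 1)" for x l
    have WB: "norm (W x l) \<le> (nN * d) * B" for x l
    proof -
      have "norm (W x l) \<le> nN * norm (\<psi>' x (axis l 1))" unfolding W_def by (rule nN)
      also have "\<dots> \<le> nN * (d * B)" by (intro mult_left_mono nB nN0)
      finally show ?thesis by (simp add: mult.assoc)
    qed
    have W0: "W x l = 0" if "x \<notin> \<Omega>'" for x l
      using test_fun_deriv_outside[OF \<psi> that] by (simp add: W_def)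
    define Q where "Q x = N *v \<psi> x" for x
    have Qt: "test_fun \<Omega> Q" unfolding Q_def by (rule test_fun_linear[OF matrix_vector_mul_bounded_linear \<psi>\<Omega>])
    have QC: "C1_deriv Q (\<lambda>x h. N *v \<psi>' x h)" unfolding Q_def by (rule C1_deriv_linear[OF \<psi>(2) matrix_vector_mul_bounded_linear])
    have op1: "\<bar>op_pairing A (z n) Q\<bar> \<le> C0 * ((nN * d) * B) * w"
      by (rule C0(2)[OF Qt QC _ w]) (use WB in \<open>simp add: W_def\<close>)
    have Wc: "continuous_on UNIV (\<lambda>x. W x l)" for l
      unfolding W_def using C1dD(2)[OF QC] .
    have Wm: "(\<lambda>x. W x l) \<in> borel_measurable lebesgue" for l
      by (rule continuous_borel_measurable_lebesgue[OF Wc])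
    define s where "s x = (\<Sum>l\<in>UNIV. (A l *v z n x) \<bullet> W x l)" for x
    have op2: "op_pairing A (z n) Q = - (LINT x|lebesgue. s x)"
      unfolding op_pairing_def s_def W_def
      using has_derivative_partial[OF C1dD(1)[OF QC]] by simp
    define K where "K x = (\<Sum>l\<in>UNIV. (A l *v a) \<bullet> W x l)" for x
    define dv where "dv x = (\<Sum>i\<in>UNIV. \<psi>' x (axis i 1) $ i)" for x
    define P where "P x = indicator \<Omega>' x * (seg_coord a \<zeta> (v n x) * dv x)" for x
    obtain R where R: "\<And>x. x \<in> \<Omega> \<Longrightarrow> norm x \<le> R" using \<Omega>_bounded bounded_iff by metis
    have out: "x \<notin> \<Omega>'" if "R < norm x" for x
      using R[of x] that \<Omega>'(2) by auto
    have iK: "integrable lebesgue K"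
    proof (rule integrable_continuous_compact[where R=R])
      show "continuous_on UNIV K" unfolding K_def by (intro continuous_intros Wc)
      show "K x = 0" if "R < norm x" for x
        using W0[OF out[OF that]] by (simp add: K_def)
    qed
    have K0: "(LINT x|lebesgue. K x) = 0"
    proof -
      have "integrable lebesgue (\<lambda>x. (A l *v a) \<bullet> W x l)" for l
      proof (rule integrable_continuous_compact[where R=R])
        show "continuous_on UNIV (\<lambda>x. (A l *v a) \<bullet> W x l)" by (intro continuous_intros Wc)
        show "(A l *v a) \<bullet> W x l = 0" if "R < norm x" for x
          using W0[OF out[OF that]] by simp
      qed
      moreover have "(LINT x|lebesgue. (A l *v a) \<bullet> W x l) = 0" for l
      proof -
        have C: "C1_deriv (\<lambda>x. (A l *v a) \<bullet> Q x) (\<lambda>x h. (A l *v a) \<bullet> (N *v \<psi>' x h))"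
          by (rule C1_deriv_linear[OF QC bounded_linear_inner_right])
        show ?thesis unfolding W_def
        proof (rule integral_partial_eq_0[OF C, where R=R])
          show "(A l *v a) \<bullet> Q x = 0" if "R < norm x" for x
            using test_fun_outside(1)[OF \<psi>(1) out[OF that]] by (simp add: Q_def)
        qed
      qed
      ultimately show ?thesis unfolding K_def by (subst Bochner_Integration.integral_sum) auto
    qed
    have Wsum: "(\<Sum>l\<in>UNIV. (A l *v \<zeta>) \<bullet> W x l) = dv x" for x
    proof -
      have "(A l *v \<zeta>) \<bullet> W x l = \<psi>' x (axis l 1) $ l" for l
      proof -
        define y where "y = \<psi>' x (axis l 1)"
        have "N *v y = (\<Sum>i\<in>UNIV. (y $ i) *\<^sub>R (N *v axis i 1))"
        proof -
          have "N *v y = N *v (\<Sum>i\<in>UNIV. (y $ i) *\<^sub>R axis i 1)"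
            by (simp add: basis_expansion scalar_mult_eq_scaleR[symmetric])
          then show ?thesis
            by (simp add: linear_sum[OF matrix_vector_mul_linear] matrix_vector_mult_scaleR)
        qed
        then have "(A l *v \<zeta>) \<bullet> (N *v y) = (\<Sum>i\<in>UNIV. (y $ i) * (if l = i then 1 else 0))"
          by (simp add: inner_sum_right N)
        also have "\<dots> = y $ l" by (simp add: if_distrib cong: if_cong)
        finally show ?thesis by (simp add: W_def y_def)
      qed
      then show ?thesis by (simp add: dv_def)
    qed
    let ?b = "\<lambda>x. indicator \<Omega> x * norm (z n x - v n x) + indicator \<Omega>' x * seg_err a \<zeta> (v n x)"
    have pt: "\<bar>s x - K x - P x\<bar> \<le> (B * Ca) * ?b x" for x
    proof (cases "x \<in> \<Omega>'")
      case False
      have "seg_err a \<zeta> y \<ge> 0" for y by (simp add: seg_err_def)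
      then have "?b x \<ge> 0" by (simp add: indicator_def)
      then show ?thesis using False B0 Ca0 by (simp add: s_def K_def P_def W0)
    next
      case True
      define e where "e = (z n x - v n x) + (v n x - a - seg_coord a \<zeta> (v n x) *\<^sub>R \<zeta>)"
      have zz: "z n x = e + a + seg_coord a \<zeta> (v n x) *\<^sub>R \<zeta>" by (simp add: e_def)
      have "s x = (\<Sum>l\<in>UNIV. (A l *v e) \<bullet> W x l) + K x + P x"
        unfolding s_def K_def
        by (subst zz) (simp add: matrix_vector_right_distrib inner_add_left sum.distrib matrix_vector_mult_scaleR
           sum_distrib_left[symmetric] Wsum P_def True)
      then have "s x - K x - P x = (\<Sum>l\<in>UNIV. (A l *v e) \<bullet> W x l)" by simp
      also have "\<bar>\<dots>\<bar> \<le> (\<Sum>l\<in>UNIV. (nA l * norm e) * ((nN * d) * B))"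
      proof (rule order_trans[OF sum_abs], rule sum_mono)
        fix l
        have "\<bar>(A l *v e) \<bullet> W x l\<bar> \<le> norm (A l *v e) * norm (W x l)" by (rule Cauchy_Schwarz_ineq2)
        also have "\<dots> \<le> (nA l * norm e) * ((nN * d) * B)"
          by (intro mult_mono nA WB) (auto simp: nA0)
        finally show "\<bar>(A l *v e) \<bullet> W x l\<bar> \<le> (nA l * norm e) * ((nN * d) * B)" .
      qed
      also have "\<dots> = (B * Ca) * norm e"
        by (simp add: Ca_def sum_distrib_left sum_distrib_right mult_ac)
      also have "\<dots> \<le> (B * Ca) * ?b x"
      proof (rule mult_left_mono)
        have "norm e \<le> norm (z n x - v n x) + seg_err a \<zeta> (v n x)"
          unfolding e_def seg_err_def by (rule norm_triangle_ineq)
        then show "norm e \<le> ?b x" using True \<Omega>'(2) by auto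
      qed (use B0 Ca0 in auto)
      finally show ?thesis .
    qed
    have [measurable]: "\<Omega>' \<in> sets lebesgue" using \<Omega>'(1) by (simp add: borel_open)
    have vm: "(\<lambda>x. indicator \<Omega>' x * g (v n x)) \<in> borel_measurable lebesgue" if g: "continuous_on UNIV g" for g :: "_ \<Rightarrow> real"
    proof -
      have "(\<lambda>x. indicator \<Omega>' x * g (v n x)) = (\<lambda>x. indicator \<Omega>' x * (indicator \<Omega> x * g (v n x)))"
        using \<Omega>'(2) by (auto simp: fun_eq_iff indicator_def)
      moreover note v_comp_meas[OF g, of n, measurable]
      ultimately show ?thesis by simp
    qed
    have \<Omega>'m: "\<Omega>' \<in> lmeasurable" using \<Omega>' by (intro lmeasurable_open bounded_subset[OF \<Omega>_bounded])
    have vi: "integrable lebesgue (\<lambda>x. indicator \<Omega>' x * g (v n x))" if g: "continuous_on UNIV g" for g :: "_ \<Rightarrow> real"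
    proof -
      obtain M where M: "M \<ge> 0" "\<And>n x. \<bar>g (v n x)\<bar> \<le> M" by (rule v_comp_bounded[OF g]) blast
      show ?thesis
      proof (rule Bochner_Integration.integrable_bound[where f="\<lambda>x. M * indicator \<Omega>' x :: real"])
        show "integrable lebesgue (\<lambda>x. M * indicator \<Omega>' x :: real)"
          using \<Omega>'m by (intro integrable_mult_right) (simp add: lmeasurable_iff_integrable)
        show "AE x in lebesgue. norm (indicator \<Omega>' x * g (v n x)) \<le> norm (M * indicator \<Omega>' x :: real)"
          using M by (intro AE_I2) (simp add: indicator_def)
      qed (rule vm[OF g])
    qed
    have ib: "integrable lebesgue ?b"
      by (intro Bochner_Integration.integrable_add z_minus_v_integrable vi continuous_seg)
    have dvc: "continuous_on UNIV dv" unfolding dv_def by (intro continuous_intros C1dD(2)[OF \<psi>(2)])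
    have dvi: "integrable lebesgue dv"
    proof (rule integrable_continuous_compact[OF dvc, where R=R])
      show "dv x = 0" if "R < norm x" for x
        using test_fun_deriv_outside[OF \<psi> out[OF that]] by (simp add: dv_def)
    qed
    have iP: "integrable lebesgue P"
    proof (rule Bochner_Integration.integrable_bound[OF dvi])
      have "(\<lambda>x. dv x * (indicator \<Omega>' x * seg_coord a \<zeta> (v n x))) \<in> borel_measurable lebesgue"
        using vm[OF continuous_seg(1)] continuous_borel_measurable_lebesgue[OF dvc] by (rule borel_measurable_times[rotated])
      then show "P \<in> borel_measurable lebesgue" unfolding P_def by (simp add: mult_ac)
      show "AE x in lebesgue. norm (P x) \<le> norm (dv x)"
        using seg_coord_bounds[of a \<zeta>] by (intro AE_I2) (simp add: P_def indicator_def abs_mult mult_left_le_one_le)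
    qed
    have s_meas: "s \<in> borel_measurable lebesgue"
    proof -
      have zm: "(\<lambda>x. indicator \<Omega> x *\<^sub>R z n x) \<in> borel_measurable lebesgue"
        using z_meas unfolding set_borel_measurable_def .
      have "(\<lambda>x. A l *v (indicator \<Omega> x *\<^sub>R z n x)) \<in> borel_measurable lebesgue" for l
        by (rule borel_measurable_continuous_on[OF _ zm])
           (rule linear_continuous_on[OF matrix_vector_mul_bounded_linear])
      then have "(\<lambda>x. \<Sum>l\<in>UNIV. (A l *v (indicator \<Omega> x *\<^sub>R z n x)) \<bullet> W x l) \<in> borel_measurable lebesgue"
        using Wm by (intro borel_measurable_sum borel_measurable_inner)
      moreover have "(\<lambda>x. \<Sum>l\<in>UNIV. (A l *v (indicator \<Omega> x *\<^sub>R z n x)) \<bullet> W x l) = s"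
      proof
        fix x
        show "(\<Sum>l\<in>UNIV. (A l *v (indicator \<Omega> x *\<^sub>R z n x)) \<bullet> W x l) = s x"
        proof (cases "x \<in> \<Omega>'")
          case True
          then show ?thesis using \<Omega>'(2) by (simp add: s_def subset_iff)
        qed (simp add: s_def W0)
      qed
      ultimately show ?thesis by simp
    qed
    have ir: "integrable lebesgue (\<lambda>x. s x - K x - P x)"
    proof (rule Bochner_Integration.integrable_bound[OF integrable_mult_right[OF ib]])
      show "(\<lambda>x. s x - K x - P x) \<in> borel_measurable lebesgue"
        by (intro borel_measurable_diff s_meas borel_measurable_integrable[OF iK] borel_measurable_integrable[OF iP])
      show "AE x in lebesgue. norm (s x - K x - P x) \<le> norm ((B * Ca) * ?b x)"
        using pt by (intro AE_I2) (metis abs_ge_self order_trans real_norm_def)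
    qed
    have "(LINT x|lebesgue. s x) = (LINT x|lebesgue. (s x - K x - P x) + K x + P x)" by simp
    also have "\<dots> = (LINT x|lebesgue. s x - K x - P x) + (LINT x|lebesgue. K x) + (LINT x|lebesgue. P x)"
      using ir iK iP by (simp only: Bochner_Integration.integral_add Bochner_Integration.integrable_add)
    finally have "(LINT x|lebesgue. P x) = - op_pairing A (z n) Q - (LINT x|lebesgue. s x - K x - P x)"
      using op2 K0 by simp
    then have "\<bar>LINT x|lebesgue. P x\<bar> \<le> \<bar>op_pairing A (z n) Q\<bar> + \<bar>LINT x|lebesgue. s x - K x - P x\<bar>"
      by linarith
    also have "\<bar>LINT x|lebesgue. s x - K x - P x\<bar> \<le> (LINT x|lebesgue. \<bar>s x - K x - P x\<bar>)"
      by (rule integral_abs_bound)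
    also have "\<dots> \<le> (LINT x|lebesgue. (B * Ca) * ?b x)"
      by (intro integral_mono integrable_abs ir integrable_mult_right ib pt)
    also have "\<dots> = (B * Ca) * ((LINT x|lebesgue. indicator \<Omega> x * norm (z n x - v n x))
          + (LINT x|lebesgue. indicator \<Omega>' x * seg_err a \<zeta> (v n x)))"
      by (simp only: Bochner_Integration.integral_mult_right_zero
           Bochner_Integration.integral_add[OF z_minus_v_integrable vi[OF continuous_seg(2)]])
    finally show "\<bar>LINT x|lebesgue. indicator \<Omega>' x * (seg_coord a \<zeta> (v n x) * (\<Sum>i\<in>UNIV. \<psi>' x (axis i 1) $ i))\<bar>
       \<le> B * (C0 * (nN * d) * w + Ca * ((LINT x|lebesgue. indicator \<Omega> x * norm (z n x - v n x))
          + (LINT x|lebesgue. indicator \<Omega>' x * seg_err a \<zeta> (v n x))))"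
      using op1 unfolding P_def dv_def by (simp add: algebra_simps)
  qed
qed

end

section \<open>Variance of the Young measure\<close>

context generated_young_measure
begin

lemma integrable_sub_times_bounded:
  assumes "\<Omega>' \<in> sets lebesgue" "\<Omega>' \<subseteq> \<Omega>" and i\<phi>: "integrable lebesgue (\<lambda>x. indicator \<Omega>' x * \<phi> x :: real)"
    and q: "(\<lambda>x. indicator \<Omega> x * q x) \<in> borel_measurable lebesgue" and b: "\<And>x. x \<in> \<Omega> \<Longrightarrow> \<bar>q x\<bar> \<le> M"
  shows "integrable lebesgue (\<lambda>x. indicator \<Omega>' x * (\<phi> x * q x))"
proof -
  have eq: "indicator \<Omega> x * (indicator \<Omega>' x * \<phi> x) = indicator \<Omega>' x * \<phi> x"
    "indicator \<Omega> x * ((indicator \<Omega>' x * \<phi> x) * q x) = indicator \<Omega>' x * (\<phi> x * q x)" for x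
    using assms(2) by (auto simp: indicator_def)
  show ?thesis
    using integrable_times_bounded[of "\<lambda>x. indicator \<Omega>' x * \<phi> x", OF _ q b] i\<phi> unfolding eq by blast
qed

lemma young_limit_sub:
  assumes "\<Omega>' \<in> sets lebesgue" "\<Omega>' \<subseteq> \<Omega>" and i\<phi>: "integrable lebesgue (\<lambda>x. indicator \<Omega>' x * \<phi> x :: real)"
    and g: "continuous_on UNIV (g :: real^'m \<Rightarrow> real)"
  shows "integrable lebesgue (\<lambda>x. indicator \<Omega>' x * (\<phi> x * g (v n x)))"
    "integrable lebesgue (\<lambda>x. indicator \<Omega>' x * (\<phi> x * (LINT y|\<nu> x. g y)))"
    "(\<lambda>n. LINT x|lebesgue. indicator \<Omega>' x * (\<phi> x * g (v n x)))
     \<longlonglongrightarrow> (LINT x|lebesgue. indicator \<Omega>' x * (\<phi> x * (LINT y|\<nu> x. g y)))"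
proof -
  obtain M where M: "\<And>n x. \<bar>g (v n x)\<bar> \<le> M" by (rule v_comp_bounded[OF g]) blast
  show "integrable lebesgue (\<lambda>x. indicator \<Omega>' x * (\<phi> x * g (v n x)))"
    by (rule integrable_sub_times_bounded[OF assms(1,2) i\<phi> v_comp_meas[OF g] M])
  obtain M' where M': "\<And>x. x \<in> \<Omega> \<Longrightarrow> \<bar>LINT y|\<nu> x. g y\<bar> \<le> M'" by (rule \<nu>_bounded[OF g]) blast
  show "integrable lebesgue (\<lambda>x. indicator \<Omega>' x * (\<phi> x * (LINT y|\<nu> x. g y)))"
    by (rule integrable_sub_times_bounded[OF assms(1,2) i\<phi> mean_meas[OF g] M'])
  have eq: "indicator \<Omega> x * (indicator \<Omega>' x * \<phi> x) = indicator \<Omega>' x * \<phi> x"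
    "indicator \<Omega> x * ((indicator \<Omega>' x * \<phi> x) * t) = indicator \<Omega>' x * (\<phi> x * t)" for x t
    using assms(2) by (auto simp: indicator_def)
  have "set_integrable lebesgue \<Omega> (\<lambda>x. indicator \<Omega>' x * \<phi> x)"
    unfolding set_integrable_def real_scaleR_def eq by (rule i\<phi>)
  from young_limit[OF g this]
  show "(\<lambda>n. LINT x|lebesgue. indicator \<Omega>' x * (\<phi> x * g (v n x)))
     \<longlonglongrightarrow> (LINT x|lebesgue. indicator \<Omega>' x * (\<phi> x * (LINT y|\<nu> x. g y)))"
    unfolding eq .
qed

lemma integrable_indicator_sub:
  assumes "\<Omega>' \<in> sets lebesgue" "\<Omega>' \<subseteq> \<Omega>"
  shows "integrable lebesgue (\<lambda>x. indicator \<Omega>' x * (c::real))" "\<Omega>' \<in> lmeasurable"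
proof -
  show 1: "\<Omega>' \<in> lmeasurable" by (rule fmeasurableI2[OF \<Omega>_lmeasurable assms(2,1)])
  then show "integrable lebesgue (\<lambda>x. indicator \<Omega>' x * (c::real))"
    by (intro integrable_mult_left) (simp add: lmeasurable_iff_integrable)
qed

definition var :: "(real^'m \<Rightarrow> real) \<Rightarrow> real^'d \<Rightarrow> real" where
  "var g x = (LINT y|\<nu> x. (g y)\<^sup>2) - (LINT y|\<nu> x. g y)\<^sup>2"

lemma var_eq:
  assumes x: "x \<in> \<Omega>" and g: "continuous_on UNIV g"
  shows "integrable (\<nu> x) (\<lambda>y. (g y - c)\<^sup>2)"
    "(LINT y|\<nu> x. (g y - c)\<^sup>2) = var g x + ((LINT y|\<nu> x. g y) - c)\<^sup>2"
proof -
  interpret prob_space "\<nu> x" by (rule prob[OF x])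
  have ci: "integrable (\<nu> x) h" if "continuous_on UNIV h" for h :: "real^'m \<Rightarrow> real"
    using \<nu>_bounded[OF that] x by metis
  have g2: "continuous_on UNIV (\<lambda>y. (g y)\<^sup>2)" by (intro continuous_intros g)
  show "integrable (\<nu> x) (\<lambda>y. (g y - c)\<^sup>2)" by (intro ci continuous_intros g)
  have "(LINT y|\<nu> x. (g y - c)\<^sup>2) = (LINT y|\<nu> x. (g y)\<^sup>2 - (2 * c) * g y + c\<^sup>2)"
    by (simp add: power2_diff algebra_simps)
  also have "\<dots> = (LINT y|\<nu> x. (g y)\<^sup>2) - (2 * c) * (LINT y|\<nu> x. g y) + c\<^sup>2"
    using ci[OF g2] ci[OF g] by (simp add: prob_space)
  finally show "(LINT y|\<nu> x. (g y - c)\<^sup>2) = var g x + ((LINT y|\<nu> x. g y) - c)\<^sup>2"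
    by (simp add: var_def power2_diff algebra_simps)
qed

lemma var_nonneg: "x \<in> \<Omega> \<Longrightarrow> continuous_on UNIV g \<Longrightarrow> var g x \<ge> 0"
  using var_eq(2)[of x g "LINT y|\<nu> x. g y"] Bochner_Integration.integral_nonneg[of "\<nu> x" "\<lambda>y. (g y - (LINT y|\<nu> x. g y))\<^sup>2"]
  by simp

lemma var_integrable:
  assumes "\<Omega>' \<in> sets lebesgue" "\<Omega>' \<subseteq> \<Omega>" "continuous_on UNIV g"
  shows "integrable lebesgue (\<lambda>x. indicator \<Omega>' x * var g x)"
    "(\<lambda>n. LINT x|lebesgue. indicator \<Omega>' x * (g (v n x) - (LINT y|\<nu> x. g y))\<^sup>2)
      \<longlonglongrightarrow> (LINT x|lebesgue. indicator \<Omega>' x * var g x)"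
    "integrable lebesgue (\<lambda>x. indicator \<Omega>' x * (g (v n x) - (LINT y|\<nu> x. g y))\<^sup>2)"
proof -
  let ?Q = "\<lambda>x. LINT y|\<nu> x. g y"
  have g2: "continuous_on UNIV (\<lambda>y. (g y)\<^sup>2)" by (intro continuous_intros assms(3))
  note Y2 = young_limit_sub[OF assms(1,2) integrable_indicator_sub(1)[OF assms(1,2), of 1] g2]
  note Y0 = young_limit_sub[OF assms(1,2) integrable_indicator_sub(1)[OF assms(1,2), of 1] assms(3)]
  have iQ: "integrable lebesgue (\<lambda>x. indicator \<Omega>' x * ?Q x)" using Y0(2) by simp
  note Y1 = young_limit_sub[OF assms(1,2) iQ assms(3)]
  have e1: "indicator \<Omega>' x * (g (v n x) - ?Q x)\<^sup>2 = indicator \<Omega>' x * (1 * (g (v n x))\<^sup>2)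
     - 2 * (indicator \<Omega>' x * (?Q x * g (v n x))) + indicator \<Omega>' x * (?Q x * ?Q x)" for n x
    by (simp add: power2_eq_square algebra_simps)
  have e2: "indicator \<Omega>' x * var g x = indicator \<Omega>' x * (1 * (LINT y|\<nu> x. (g y)\<^sup>2)) - indicator \<Omega>' x * (?Q x * ?Q x)" for x
    by (simp add: var_def power2_eq_square algebra_simps)
  show "integrable lebesgue (\<lambda>x. indicator \<Omega>' x * var g x)"
    unfolding e2 by (intro Bochner_Integration.integrable_diff Y2(2) Y1(2))
  show "integrable lebesgue (\<lambda>x. indicator \<Omega>' x * (g (v n x) - ?Q x)\<^sup>2)"
    unfolding e1 by (intro Bochner_Integration.integrable_add Bochner_Integration.integrable_diff integrable_mult_right Y2(1) Y1)
  have "(LINT x|lebesgue. indicator \<Omega>' x * (g (v n x) - ?Q x)\<^sup>2)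
     = (LINT x|lebesgue. indicator \<Omega>' x * (1 * (g (v n x))\<^sup>2)) - 2 * (LINT x|lebesgue. indicator \<Omega>' x * (?Q x * g (v n x)))
       + (LINT x|lebesgue. indicator \<Omega>' x * (?Q x * ?Q x))" for n
    unfolding e1
    by (subst Bochner_Integration.integral_add, intro Bochner_Integration.integrable_diff integrable_mult_right Y2(1) Y1(1), rule Y1(2),
        subst Bochner_Integration.integral_diff, rule Y2(1), intro integrable_mult_right Y1(1),
        subst Bochner_Integration.integral_mult_right_zero, rule refl)
  moreover have "(LINT x|lebesgue. indicator \<Omega>' x * var g x)
     = (LINT x|lebesgue. indicator \<Omega>' x * (1 * (LINT y|\<nu> x. (g y)\<^sup>2))) - 2 * (LINT x|lebesgue. indicator \<Omega>' x * (?Q x * ?Q x))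
       + (LINT x|lebesgue. indicator \<Omega>' x * (?Q x * ?Q x))"
    unfolding e2 by (subst Bochner_Integration.integral_diff[OF Y2(2) Y1(2)]) simp
  ultimately show "(\<lambda>n. LINT x|lebesgue. indicator \<Omega>' x * (g (v n x) - ?Q x)\<^sup>2)
      \<longlonglongrightarrow> (LINT x|lebesgue. indicator \<Omega>' x * var g x)"
    using Y2(3) Y1(3) by (simp only:) (intro tendsto_intros)
qed

lemma variance_bound:
  fixes A :: "'d \<Rightarrow> real^'m^'k" and N :: "real^'d^'k"
  assumes N: "\<And>l i. (A l *v \<zeta>) \<bullet> (N *v axis i 1) = (if l = i then 1 else 0)" and r: "r > 1"
    and W: "(\<lambda>n. Wm1_norm A \<Omega> r (z n)) \<longlonglongrightarrow> 0"
  obtains C where "C \<ge> 0"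
    "\<And>\<Omega>' L. open \<Omega>' \<Longrightarrow> \<Omega>' \<subseteq> \<Omega> \<Longrightarrow> L \<ge> 1 \<Longrightarrow>
      (LINT x|lebesgue. indicator \<Omega>' x * var (seg_coord a \<zeta>) x)
      \<le> C * (L * (LINT x|lebesgue. indicator \<Omega>' x * (LINT y|\<nu> x. seg_err a \<zeta> y)) + measure lebesgue \<Omega>' / L)"
proof -
  obtain Ca Cw where Ca: "Ca \<ge> 0" and Cw: "Cw \<ge> 0" and pairing:
    "\<And>\<Omega>' \<psi> \<psi>' B w n. open \<Omega>' \<Longrightarrow> \<Omega>' \<subseteq> \<Omega> \<Longrightarrow> test_fun \<Omega>' \<psi> \<Longrightarrow> C1_deriv \<psi> \<psi>' \<Longrightarrow> (\<And>x i j. \<bar>\<psi>' x (axis j 1) $ i\<bar> \<le> B) \<Longrightarrow>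
      Wm1_norm A \<Omega> r (z n) \<le> ereal w \<Longrightarrow>
      \<bar>LINT x|lebesgue. indicator \<Omega>' x * (seg_coord a \<zeta> (v n x) * (\<Sum>i\<in>UNIV. \<psi>' x (axis i 1) $ i))\<bar>
       \<le> B * (Cw * w + Ca * ((LINT x|lebesgue. indicator \<Omega> x * norm (z n x - v n x))
          + (LINT x|lebesgue. indicator \<Omega>' x * seg_err a \<zeta> (v n x))))"
    using coordinate_pairing_bound[OF N r, of a] by blast
  define q where "q = seg_coord a \<zeta>"
  have qc: "continuous_on UNIV q" unfolding q_def by (rule continuous_seg)
  have q01: "0 \<le> q y" "q y \<le> 1" for y by (simp_all add: q_def seg_coord_bounds)
  define w where "w n = real_of_ereal (Wm1_norm A \<Omega> r (z n))" for n
  have w0: "w \<longlonglongrightarrow> 0"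
    using lim_real_of_ereal[of "\<lambda>n. Wm1_norm A \<Omega> r (z n)" 0 sequentially] W unfolding w_def by (simp add: zero_ereal_def)
  have "\<forall>\<^sub>F n in sequentially. Wm1_norm A \<Omega> r (z n) < 1" "\<forall>\<^sub>F n in sequentially. Wm1_norm A \<Omega> r (z n) > - 1"
    by (rule order_tendstoD[OF W], simp)+
  then have "\<forall>\<^sub>F n in sequentially. Wm1_norm A \<Omega> r (z n) \<le> ereal (w n)"
  proof eventually_elim
    case (elim n)
    then have "\<bar>Wm1_norm A \<Omega> r (z n)\<bar> \<noteq> \<infinity>" by auto
    then show ?case by (simp add: w_def ereal_real)
  qed
  then obtain n0 where n0: "\<And>n. n \<ge> n0 \<Longrightarrow> Wm1_norm A \<Omega> r (z n) \<le> ereal (w n)"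
    unfolding eventually_sequentially by blast
  define T where "T = trunc_const CARD('d)"
  have T: "T \<ge> 0" by (simp add: T_def trunc_const_nonneg)
  show thesis
  proof (rule that[of "T * (2 * Ca + 1)"])
    show "T * (2 * Ca + 1) \<ge> 0" using T Ca by simp
    fix \<Omega>' :: "(real^'d) set" and L :: real
    assume \<Omega>': "open \<Omega>'" "\<Omega>' \<subseteq> \<Omega>" and L: "L \<ge> 1"
    have \<Omega>'s: "\<Omega>' \<in> sets lebesgue" using \<Omega>'(1) by (simp add: borel_open)
    have \<Omega>'b: "bounded \<Omega>'" using \<Omega>'(2) \<Omega>_bounded by (rule bounded_subset[rotated])
    define E where "E = (LINT x|lebesgue. indicator \<Omega>' x * (LINT y|\<nu> x. seg_err a \<zeta> y))"
    have E0: "E \<ge> 0" unfolding E_def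
      by (intro Bochner_Integration.integral_nonneg mult_nonneg_nonneg) (auto simp: seg_err_def)
    define Q where "Q x = (LINT y|\<nu> x. q y)" for x
    define D where "D n = Cw * w n + Ca * ((LINT x|lebesgue. indicator \<Omega> x * norm (z n x - v n x))
          + (LINT x|lebesgue. indicator \<Omega>' x * seg_err a \<zeta> (v n x)))" for n
    have "(\<lambda>n. LINT x|lebesgue. indicator \<Omega>' x * seg_err a \<zeta> (v n x)) \<longlonglongrightarrow> E"
      using young_limit_sub(3)[OF \<Omega>'s \<Omega>'(2) integrable_indicator_sub(1)[OF \<Omega>'s \<Omega>'(2), of 1] continuous_seg(2)]
      unfolding E_def by simp
    then have Dlim: "D \<longlonglongrightarrow> Cw * 0 + Ca * (0 + E)"
      unfolding D_def by (intro tendsto_intros w0 z_minus_v_limit)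
    note yl = young_limit_sub[OF \<Omega>'s \<Omega>'(2) _ qc]
    have Q01: "0 \<le> Q x \<and> Q x \<le> 1" if x: "x \<in> \<Omega>" for x
    proof -
      interpret prob_space "\<nu> x" by (rule prob[OF x])
      have "integrable (\<nu> x) q" using \<nu>_bounded[OF qc] x by metis
      then show ?thesis unfolding Q_def using q01
        by (auto intro!: Bochner_Integration.integral_nonneg integral_le_const)
    qed
    have ig: "integrable lebesgue (\<lambda>x. indicator \<Omega>' x * g x)" if "integrable lebesgue g" for g :: "_ \<Rightarrow> real"
      using integrable_real_mult_indicator[OF \<Omega>'s that] by (simp add: mult.commute)
    have dvi: "integrable lebesgue (\<lambda>x. \<Sum>i\<in>UNIV. \<psi>' x (axis i 1) $ i)" if \<psi>: "test_fun \<Omega>' \<psi>" "C1_deriv \<psi> \<psi>'"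
      for \<psi> :: "real^'d \<Rightarrow> real^'d" and \<psi>'
    proof -
      obtain R where R: "\<And>x. x \<in> \<Omega>' \<Longrightarrow> norm x \<le> R" using \<Omega>'b bounded_iff by metis
      show ?thesis
      proof (rule integrable_continuous_compact[where R=R])
        show "continuous_on UNIV (\<lambda>x. \<Sum>i\<in>UNIV. \<psi>' x (axis i 1) $ i)"
          by (intro continuous_intros C1dD(2)[OF \<psi>(2)])
        fix x :: "real^'d" assume "norm x > R"
        then have "x \<notin> \<Omega>'" using R[of x] by auto
        then show "(\<Sum>i\<in>UNIV. \<psi>' x (axis i 1) $ i) = 0" using test_fun_deriv_outside[OF \<psi>] by simp
      qed
    qed
    have pv: "\<bar>LINT x|lebesgue. indicator \<Omega>' x * ((\<Sum>i\<in>UNIV. \<psi>' x (axis i 1) $ i) * q (v n x))\<bar> \<le> B * D n"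
      if "n \<ge> n0" "test_fun \<Omega>' \<psi>" "C1_deriv \<psi> \<psi>'" "\<And>x i j. \<bar>\<psi>' x (axis j 1) $ i\<bar> \<le> B" for n \<psi> \<psi>' B
      using pairing[OF \<Omega>' that(2-4) n0[OF that(1)]] unfolding D_def q_def by (simp add: mult.commute)
    have pQ: "\<bar>LINT x|lebesgue. indicator \<Omega>' x * ((\<Sum>i\<in>UNIV. \<psi>' x (axis i 1) $ i) * Q x)\<bar> \<le> B * (Ca * E)"
      if \<psi>: "test_fun \<Omega>' \<psi>" "C1_deriv \<psi> \<psi>'" "\<And>x i j. \<bar>\<psi>' x (axis j 1) $ i\<bar> \<le> B" for \<psi> \<psi>' B
    proof (rule tendsto_le[OF sequentially_bot])
      show "(\<lambda>n. B * D n) \<longlonglongrightarrow> B * (Ca * E)"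
        using tendsto_mult[OF tendsto_const Dlim] by simp
      show "(\<lambda>n. \<bar>LINT x|lebesgue. indicator \<Omega>' x * ((\<Sum>i\<in>UNIV. \<psi>' x (axis i 1) $ i) * q (v n x))\<bar>)
         \<longlonglongrightarrow> \<bar>LINT x|lebesgue. indicator \<Omega>' x * ((\<Sum>i\<in>UNIV. \<psi>' x (axis i 1) $ i) * Q x)\<bar>"
        unfolding Q_def by (intro tendsto_rabs yl(3) ig dvi[OF \<psi>(1,2)])
      show "\<forall>\<^sub>F n in sequentially. \<bar>LINT x|lebesgue. indicator \<Omega>' x * ((\<Sum>i\<in>UNIV. \<psi>' x (axis i 1) $ i) * q (v n x))\<bar> \<le> B * D n"
        unfolding eventually_sequentially using pv[OF _ \<psi>] by blast
    qed
    define \<mu> where "\<mu> n x = indicator \<Omega>' x * (q (v (n + n0) x) - Q x)" for n x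
    have split: "g x * \<mu> n x = indicator \<Omega>' x * (g x * q (v (n + n0) x)) - indicator \<Omega>' x * (g x * Q x)" for g n x
      by (simp add: \<mu>_def algebra_simps)
    have intsplit: "(LINT x|lebesgue. g x * \<mu> n x) = (LINT x|lebesgue. indicator \<Omega>' x * (g x * q (v (n + n0) x)))
        - (LINT x|lebesgue. indicator \<Omega>' x * (g x * Q x))" if "integrable lebesgue g" for g n
      unfolding split using yl(1)[OF ig[OF that]] yl(2)[OF ig[OF that]] unfolding Q_def
      by (rule Bochner_Integration.integral_diff)
    have ev: "\<forall>\<^sub>F n in sequentially. (LINT x|lebesgue. (\<mu> n x)\<^sup>2) \<le> T * (L * (2 * Ca * E) + measure lebesgue \<Omega>' / L) + e"
      if e: "e > 0" for e
      unfolding T_def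
    proof (rule asymptotic_L2_bound[where D="\<lambda>n. D (n + n0) + Ca * E"])
      show "open \<Omega>'" "bounded \<Omega>'" "L \<ge> 1" "e > 0" using \<Omega>' \<Omega>'b L e by auto
      show "\<mu> n \<in> borel_measurable lebesgue" for n
      proof -
        have "(\<lambda>x. indicator \<Omega>' x * (1 * q (v (n + n0) x)) - indicator \<Omega>' x * (1 * Q x)) \<in> borel_measurable lebesgue"
          unfolding Q_def using yl(1,2)[OF integrable_indicator_sub(1)[OF \<Omega>'s \<Omega>'(2), of 1]]
          by (intro borel_measurable_diff borel_measurable_integrable)
        then show ?thesis unfolding \<mu>_def[abs_def] by (simp add: algebra_simps)
      qed
      show "\<bar>\<mu> n x\<bar> \<le> 1" for n x
      proof (cases "x \<in> \<Omega>'")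
        case True
        then have "0 \<le> Q x \<and> Q x \<le> 1" using Q01 \<Omega>'(2) by blast
        then show ?thesis using True q01[of "v (n + n0) x"] by (simp add: \<mu>_def abs_le_iff)
      qed (simp add: \<mu>_def)
      show "\<mu> n x = 0" if "x \<notin> \<Omega>'" for n x using that by (simp add: \<mu>_def)
      show "(\<lambda>n. LINT x|lebesgue. g x * \<mu> n x) \<longlonglongrightarrow> 0" if g: "integrable lebesgue g" for g
      proof -
        have "(\<lambda>n. LINT x|lebesgue. indicator \<Omega>' x * (g x * q (v (n + n0) x))) \<longlonglongrightarrow> (LINT x|lebesgue. indicator \<Omega>' x * (g x * Q x))"
          unfolding Q_def by (rule LIMSEQ_ignore_initial_segment[OF yl(3)[OF ig[OF g]]])
        then show ?thesis unfolding intsplit[OF g] by (rule LIM_zero)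
      qed
      show "\<bar>LINT x|lebesgue. \<mu> n x * (\<Sum>i\<in>UNIV. \<psi>' x (axis i 1) $ i)\<bar> \<le> B * (D (n + n0) + Ca * E)"
        if \<psi>: "test_fun \<Omega>' \<psi>" "C1_deriv \<psi> \<psi>'" "\<And>x i j. \<bar>\<psi>' x (axis j 1) $ i\<bar> \<le> B" for n \<psi> \<psi>' B
      proof -
        have "(LINT x|lebesgue. \<mu> n x * (\<Sum>i\<in>UNIV. \<psi>' x (axis i 1) $ i)) = (LINT x|lebesgue. (\<Sum>i\<in>UNIV. \<psi>' x (axis i 1) $ i) * \<mu> n x)"
          by (simp add: mult.commute)
        then show ?thesis
          unfolding intsplit[OF dvi[OF \<psi>(1,2)]] distrib_left
          using pv[of "n + n0", OF _ \<psi>] pQ[OF \<psi>] by linarith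
      qed
      show "(\<lambda>n. D (n + n0) + Ca * E) \<longlonglongrightarrow> 2 * Ca * E"
        using tendsto_add[OF LIMSEQ_ignore_initial_segment[OF Dlim, of n0] tendsto_const[of "Ca * E"]] by (simp add: mult.assoc)
      show "0 \<le> 2 * Ca * E" using Ca E0 by simp
    qed
    have lim: "(\<lambda>n. LINT x|lebesgue. (\<mu> n x)\<^sup>2) \<longlonglongrightarrow> (LINT x|lebesgue. indicator \<Omega>' x * var q x)"
    proof -
      have "(\<mu> n x)\<^sup>2 = indicator \<Omega>' x * (q (v (n + n0) x) - (LINT y|\<nu> x. q y))\<^sup>2" for n x
        by (simp add: \<mu>_def Q_def indicator_def)
      then show ?thesis
        using LIMSEQ_ignore_initial_segment[OF var_integrable(2)[OF \<Omega>'s \<Omega>'(2) qc], of n0] by simp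
    qed
    have "(LINT x|lebesgue. indicator \<Omega>' x * var q x) \<le> T * (L * (2 * Ca * E) + measure lebesgue \<Omega>' / L)"
    proof (rule field_le_epsilon)
      fix e :: real assume "e > 0"
      from tendsto_upperbound[OF lim ev[OF this] sequentially_bot]
      show "(LINT x|lebesgue. indicator \<Omega>' x * var q x) \<le> T * (L * (2 * Ca * E) + measure lebesgue \<Omega>' / L) + e" .
    qed
    also have "\<dots> \<le> T * ((2 * Ca + 1) * (L * E + measure lebesgue \<Omega>' / L))"
    proof (rule mult_left_mono[OF _ T])
      have "measure lebesgue \<Omega>' / L \<ge> 0" using L by simp
      then have "2 * Ca * (measure lebesgue \<Omega>' / L) \<ge> 0" "L * E \<ge> 0" using Ca L E0 by simp_all
      then show "L * (2 * Ca * E) + measure lebesgue \<Omega>' / L \<le> (2 * Ca + 1) * (L * E + measure lebesgue \<Omega>' / L)"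
        by (simp add: algebra_simps)
    qed
    finally show "(LINT x|lebesgue. indicator \<Omega>' x * var (seg_coord a \<zeta>) x)
      \<le> T * (2 * Ca + 1) * (L * (LINT x|lebesgue. indicator \<Omega>' x * (LINT y|\<nu> x. seg_err a \<zeta> y)) + measure lebesgue \<Omega>' / L)"
      unfolding q_def E_def by (simp add: mult.assoc)
  qed
qed

definition tot_var :: "real^'d \<Rightarrow> real" where
  "tot_var x = (\<Sum>i\<in>UNIV. var (\<lambda>y. y $ i) x)"

lemma tot_var_le:
  assumes x: "x \<in> \<Omega>"
  shows "integrable (\<nu> x) (\<lambda>y. (norm (y - c))\<^sup>2)" "tot_var x \<le> (LINT y|\<nu> x. (norm (y - c))\<^sup>2)"
proof -
  have c: "continuous_on UNIV (\<lambda>y::real^'m. y $ i)" for i by (intro continuous_intros)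
  have n: "(norm (y - c))\<^sup>2 = (\<Sum>i\<in>UNIV. (y $ i - c $ i)\<^sup>2)" for y
    by (simp add: norm_vec_def L2_set_def sum_nonneg)
  show "integrable (\<nu> x) (\<lambda>y. (norm (y - c))\<^sup>2)"
    unfolding n by (intro Bochner_Integration.integrable_sum var_eq(1)[OF x c])
  have "(LINT y|\<nu> x. (norm (y - c))\<^sup>2) = (\<Sum>i\<in>UNIV. LINT y|\<nu> x. (y $ i - c $ i)\<^sup>2)"
    unfolding n by (rule Bochner_Integration.integral_sum) (rule var_eq(1)[OF x c])
  also have "\<dots> \<ge> tot_var x"
    unfolding tot_var_def var_eq(2)[OF x c] by (intro sum_mono) simp
  finally show "tot_var x \<le> (LINT y|\<nu> x. (norm (y - c))\<^sup>2)" .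
qed

end

lemma seg_err_le:
  fixes \<zeta> :: "'a::real_inner"
  assumes \<zeta>: "\<zeta> \<noteq> 0" and t: "0 \<le> t" "t \<le> 1" and k: "norm (y - a - t *\<^sub>R \<zeta>) \<le> k"
  shows "seg_err a \<zeta> y \<le> 2 * k"
proof -
  define e where "e = y - a - t *\<^sub>R \<zeta>"
  define u where "u = ((y - a) \<bullet> \<zeta>) / (\<zeta> \<bullet> \<zeta>)"
  have z: "\<zeta> \<bullet> \<zeta> > 0" using \<zeta> by simp
  have ya: "y - a = t *\<^sub>R \<zeta> + e" by (simp add: e_def)
  have "u = t + (e \<bullet> \<zeta>) / (\<zeta> \<bullet> \<zeta>)"
    using z unfolding u_def ya by (simp add: inner_add_left add_divide_distrib)
  then have "\<bar>u - t\<bar> = \<bar>e \<bullet> \<zeta>\<bar> / (\<zeta> \<bullet> \<zeta>)" using z by simp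
  also have "\<dots> \<le> (norm e * norm \<zeta>) / (\<zeta> \<bullet> \<zeta>)"
    using z by (intro divide_right_mono Cauchy_Schwarz_ineq2) auto
  finally have "\<bar>u - t\<bar> \<le> norm e / norm \<zeta>"
    using \<zeta> by (simp add: power2_norm_eq_inner[symmetric] power2_eq_square)
  moreover have "\<bar>seg_coord a \<zeta> y - t\<bar> \<le> \<bar>u - t\<bar>"
    using t unfolding seg_coord_def u_def[symmetric] by (simp add: max_def min_def abs_if)
  ultimately have "\<bar>t - seg_coord a \<zeta> y\<bar> \<le> norm e / norm \<zeta>" by linarith
  then have "\<bar>t - seg_coord a \<zeta> y\<bar> * norm \<zeta> \<le> norm e"
    using \<zeta> by (simp add: le_divide_eq)
  moreover have "y - a - seg_coord a \<zeta> y *\<^sub>R \<zeta> = e + (t - seg_coord a \<zeta> y) *\<^sub>R \<zeta>"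
    by (simp add: e_def algebra_simps)
  then have "seg_err a \<zeta> y \<le> norm e + \<bar>t - seg_coord a \<zeta> y\<bar> * norm \<zeta>"
    unfolding seg_err_def by (metis norm_scaleR norm_triangle_ineq)
  ultimately show ?thesis using k by (simp add: e_def)
qed

context generated_young_measure
begin

lemma concentrated_null:
  fixes A :: "'d \<Rightarrow> real^'m^'k" and N :: "real^'d^'k"
  assumes N: "\<And>l i. (A l *v \<zeta>) \<bullet> (N *v axis i 1) = (if l = i then 1 else 0)" and r: "r > 1"
    and W: "(\<lambda>n. Wm1_norm A \<Omega> r (z n)) \<longlonglongrightarrow> 0" and th: "th > 0"
  obtains k where "k > 0"
    "\<And>P. P \<in> sets lebesgue \<Longrightarrow> P \<subseteq> \<Omega> \<Longrightarrow>
      (\<And>x. x \<in> P \<Longrightarrow> AE y in \<nu> x. \<exists>t. 0 \<le> t \<and> t \<le> 1 \<and> norm (y - a - t *\<^sub>R \<zeta>) \<le> k) \<Longrightarrow>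
      (\<And>x. x \<in> P \<Longrightarrow> th \<le> tot_var x) \<Longrightarrow> P \<in> null_sets lebesgue"
proof -
  have \<zeta>: "\<zeta> \<noteq> 0"
  proof
    assume "\<zeta> = 0"
    then show False using N[of undefined undefined] by simp
  qed
  define q where "q = seg_coord a \<zeta>"
  have qc: "continuous_on UNIV q" unfolding q_def by (rule continuous_seg)
  have ec: "continuous_on UNIV (seg_err a \<zeta>)" by (rule continuous_seg)
  obtain C where C: "C \<ge> 0"
    "\<And>\<Omega>' L. open \<Omega>' \<Longrightarrow> \<Omega>' \<subseteq> \<Omega> \<Longrightarrow> L \<ge> 1 \<Longrightarrow>
      (LINT x|lebesgue. indicator \<Omega>' x * var (seg_coord a \<zeta>) x)
      \<le> C * (L * (LINT x|lebesgue. indicator \<Omega>' x * (LINT y|\<nu> x. seg_err a \<zeta> y)) + measure lebesgue \<Omega>' / L)"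
    using variance_bound[OF N r W, of a] by blast
  obtain M where M: "M \<ge> 0" "\<And>x. x \<in> \<Omega> \<Longrightarrow> \<bar>LINT y|\<nu> x. seg_err a \<zeta> y\<bar> \<le> M" by (rule \<nu>_bounded[OF ec]) blast
  define Z where "Z = (norm \<zeta>)\<^sup>2"
  have Z: "Z > 0" using \<zeta> by (simp add: Z_def)
  define L where "L = 1 + 16 * Z * C / th"
  have L: "L \<ge> 1" using Z C(1) th by (simp add: L_def)
  have CL: "C / L \<le> th / (16 * Z)"
  proof -
    have "16 * Z * C / th \<le> L" by (simp add: L_def)
    then have "16 * Z * C \<le> L * th" using th by (simp add: divide_le_eq)
    then show ?thesis using L Z by (simp add: field_simps)
  qed
  define k where "k = min (sqrt (th / 16)) (th / (32 * Z * (C * L + 1)))"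
  have CL1: "C * L + 1 > 0" using C(1) L by (simp add: add_nonneg_pos)
  have k: "k > 0" using th Z CL1 by (simp add: k_def)
  have k1: "8 * k\<^sup>2 \<le> th / 2"
  proof -
    have "k\<^sup>2 \<le> (sqrt (th / 16))\<^sup>2" using k by (intro power_mono) (auto simp: k_def)
    then show ?thesis using th by simp
  qed
  have k2: "C * L * (2 * k) \<le> th / (16 * Z)"
  proof -
    have "k \<le> th / (32 * Z * (C * L + 1))" by (simp add: k_def)
    then have "k * (32 * Z * (C * L + 1)) \<le> th" using Z CL1 by (simp add: le_divide_eq)
    moreover have "(C * L * (2 * k)) * (16 * Z) \<le> k * (32 * Z * (C * L + 1))"
      using k Z by (simp add: algebra_simps)
    ultimately show ?thesis using Z by (simp add: le_divide_eq)
  qed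
  show thesis
  proof (rule that[OF k])
    fix P assume P: "P \<in> sets lebesgue" "P \<subseteq> \<Omega>"
      and conc: "\<And>x. x \<in> P \<Longrightarrow> AE y in \<nu> x. \<exists>t. 0 \<le> t \<and> t \<le> 1 \<and> norm (y - a - t *\<^sub>R \<zeta>) \<le> k"
      and thP: "\<And>x. x \<in> P \<Longrightarrow> th \<le> tot_var x"
    define p where "p = measure lebesgue P"
    have p0: "p \<ge> 0" by (simp add: p_def)
    have Pm: "P \<in> lmeasurable" by (rule integrable_indicator_sub(2)[OF P])
    have err: "AE y in \<nu> x. seg_err a \<zeta> y \<le> 2 * k" if "x \<in> P" for x
      using conc[OF that]
    proof eventually_elim
      case (elim y)
      then show ?case using seg_err_le[OF \<zeta>] by blast
    qed
    have eint: "(LINT y|\<nu> x. seg_err a \<zeta> y) \<le> 2 * k" if x: "x \<in> P" for x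
    proof -
      have x\<Omega>: "x \<in> \<Omega>" using x P by blast
      interpret prob_space "\<nu> x" by (rule prob[OF x\<Omega>])
      have "integrable (\<nu> x) (seg_err a \<zeta>)" using \<nu>_bounded[OF ec] x\<Omega> by metis
      then show ?thesis by (rule integral_le_const[OF _ err[OF x]])
    qed
    have low: "th / (4 * Z) \<le> var q x" if x: "x \<in> P" for x
    proof -
      have x\<Omega>: "x \<in> \<Omega>" using x P by blast
      interpret prob_space "\<nu> x" by (rule prob[OF x\<Omega>])
      define Q where "Q = (LINT y|\<nu> x. q y)"
      have iq: "integrable (\<nu> x) (\<lambda>y. (q y - Q)\<^sup>2)" "(LINT y|\<nu> x. (q y - Q)\<^sup>2) = var q x"
        using var_eq[OF x\<Omega> qc, of Q] by (simp_all add: Q_def)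
      have "th \<le> tot_var x" by (rule thP[OF x])
      also have "\<dots> \<le> (LINT y|\<nu> x. (norm (y - (a + Q *\<^sub>R \<zeta>)))\<^sup>2)" by (rule tot_var_le(2)[OF x\<Omega>])
      also have "\<dots> \<le> (LINT y|\<nu> x. 8 * k\<^sup>2 + 2 * Z * (q y - Q)\<^sup>2)"
      proof (rule integral_mono_AE[OF tot_var_le(1)[OF x\<Omega>]])
        show "integrable (\<nu> x) (\<lambda>y. 8 * k\<^sup>2 + 2 * Z * (q y - Q)\<^sup>2)" using iq(1) by simp
        show "AE y in \<nu> x. (norm (y - (a + Q *\<^sub>R \<zeta>)))\<^sup>2 \<le> 8 * k\<^sup>2 + 2 * Z * (q y - Q)\<^sup>2"
          using err[OF x]
        proof eventually_elim
          case (elim y)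
          define s where "s = seg_err a \<zeta> y"
          have s: "0 \<le> s" "s \<le> 2 * k" using elim by (auto simp: s_def seg_err_def)
          define t where "t = \<bar>q y - Q\<bar> * norm \<zeta>"
          have "y - (a + Q *\<^sub>R \<zeta>) = (y - a - q y *\<^sub>R \<zeta>) + (q y - Q) *\<^sub>R \<zeta>" by (simp add: algebra_simps)
          then have "norm (y - (a + Q *\<^sub>R \<zeta>)) \<le> s + t"
            unfolding s_def t_def seg_err_def q_def[symmetric] by (metis norm_scaleR norm_triangle_ineq)
          then have "(norm (y - (a + Q *\<^sub>R \<zeta>)))\<^sup>2 \<le> (s + t)\<^sup>2" by (intro power_mono) auto
          also have "\<dots> \<le> 2 * s\<^sup>2 + 2 * t\<^sup>2"
            using zero_le_power2[of "s - t"] by (simp add: power2_sum power2_diff)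
          also have "s\<^sup>2 \<le> (2 * k)\<^sup>2" using s by (intro power_mono) auto
          also have "t\<^sup>2 = Z * (q y - Q)\<^sup>2" by (simp add: t_def Z_def power_mult_distrib mult.commute)
          finally show ?case by (simp add: power_mult_distrib)
        qed
      qed
      also have "\<dots> = 8 * k\<^sup>2 + 2 * Z * var q x"
        using iq by (simp add: prob_space)
      finally have "th / 2 \<le> 2 * Z * var q x" using k1 by linarith
      then show ?thesis using Z by (simp add: field_simps)
    qed
    have ineq: "p * (th / (4 * Z)) \<le> p * (th / (8 * Z)) + e" if e: "e > 0" for e
    proof -
      define K where "K = C * L * M + C / L + 1"
      have K: "K > 0" using C(1) L M(1) by (simp add: K_def add_nonneg_pos)
      define \<eta> where "\<eta> = e / K"
      have \<eta>: "\<eta> > 0" using e K by (simp add: \<eta>_def)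
      obtain U where U: "open U" "P \<subseteq> U" "U - P \<in> lmeasurable" "emeasure lebesgue (U - P) < ennreal \<eta>"
        using sets_lebesgue_outer_open[OF P(1) \<eta>] by blast
      define \<Omega>' where "\<Omega>' = U \<inter> \<Omega>"
      have \<Omega>': "open \<Omega>'" "\<Omega>' \<subseteq> \<Omega>" "P \<subseteq> \<Omega>'" using U P \<Omega>_open by (auto simp: \<Omega>'_def)
      have \<Omega>'s: "\<Omega>' \<in> sets lebesgue" using \<Omega>'(1) by (simp add: borel_open)
      note \<Omega>'m = integrable_indicator_sub(2)[OF \<Omega>'s \<Omega>'(2)]
      have Us: "\<Omega>' - P \<in> sets lebesgue" using \<Omega>'s P by blast
      have dm: "\<Omega>' - P \<in> lmeasurable" by (rule fmeasurableI2[OF \<Omega>'m _ Us]) auto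
      have "measure lebesgue (\<Omega>' - P) \<le> measure lebesgue (U - P)"
        by (rule measure_mono_fmeasurable[OF _ Us U(3)]) (auto simp: \<Omega>'_def)
      also have "\<dots> < \<eta>"
        using U(4) \<eta> unfolding emeasure_eq_measure2[OF U(3)] by (simp add: ennreal_less_iff)
      finally have dle: "measure lebesgue (\<Omega>' - P) \<le> \<eta>" by simp
      have iP: "integrable lebesgue (\<lambda>x. indicator P x :: real)" and iD: "integrable lebesgue (\<lambda>x. indicator (\<Omega>' - P) x :: real)"
        using Pm dm by (simp_all add: lmeasurable_iff_integrable)
      have split: "(indicator \<Omega>' x :: real) = indicator P x + indicator (\<Omega>' - P) x" for x
        using \<Omega>'(3) by (auto simp: indicator_def)
      have m\<Omega>': "measure lebesgue \<Omega>' \<le> p + \<eta>"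
      proof -
        have "measure lebesgue \<Omega>' = (LINT x|lebesgue. indicator \<Omega>' x)" by simp
        also have "\<dots> = p + measure lebesgue (\<Omega>' - P)"
          unfolding split by (subst Bochner_Integration.integral_add[OF iP iD]) (simp add: p_def)
        finally show ?thesis using dle by simp
      qed
      have ie: "integrable lebesgue (\<lambda>x. indicator \<Omega>' x * (LINT y|\<nu> x. seg_err a \<zeta> y))"
        using young_limit_sub(2)[OF \<Omega>'s \<Omega>'(2) integrable_indicator_sub(1)[OF \<Omega>'s \<Omega>'(2), of 1] ec] by simp
      have E: "(LINT x|lebesgue. indicator \<Omega>' x * (LINT y|\<nu> x. seg_err a \<zeta> y)) \<le> 2 * k * p + M * \<eta>"
      proof -
        have "(LINT x|lebesgue. indicator \<Omega>' x * (LINT y|\<nu> x. seg_err a \<zeta> y))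
           \<le> (LINT x|lebesgue. 2 * k * indicator P x + M * indicator (\<Omega>' - P) x)"
        proof (rule integral_mono[OF ie])
          show "integrable lebesgue (\<lambda>x. 2 * k * indicator P x + M * indicator (\<Omega>' - P) x)"
            using iP iD by (intro Bochner_Integration.integrable_add integrable_mult_right)
          fix x
          show "indicator \<Omega>' x * (LINT y|\<nu> x. seg_err a \<zeta> y) \<le> 2 * k * indicator P x + M * indicator (\<Omega>' - P) x"
          proof (cases "x \<in> \<Omega>'")
            case True
            then have "\<bar>LINT y|\<nu> x. seg_err a \<zeta> y\<bar> \<le> M" using M(2) \<Omega>'(2) by blast
            then show ?thesis using True eint[of x] by (cases "x \<in> P") auto
          next
            case False
            then have "x \<notin> P" using \<Omega>'(3) by blast
            then show ?thesis using False by simp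
          qed
        qed
        also have "\<dots> = 2 * k * p + M * measure lebesgue (\<Omega>' - P)"
          using iP iD by (subst Bochner_Integration.integral_add) (simp_all add: p_def)
        also have "\<dots> \<le> 2 * k * p + M * \<eta>" using dle M(1) by (intro add_left_mono mult_left_mono)
        finally show ?thesis .
      qed
      have "p * (th / (4 * Z)) = (LINT x|lebesgue. (th / (4 * Z)) * indicator P x)"
        by (simp add: p_def)
      also have "\<dots> \<le> (LINT x|lebesgue. indicator \<Omega>' x * var q x)"
      proof (rule integral_mono[OF integrable_mult_right[OF iP] var_integrable(1)[OF \<Omega>'s \<Omega>'(2) qc]])
        fix x
        show "th / (4 * Z) * indicator P x \<le> indicator \<Omega>' x * var q x"
        proof (cases "x \<in> P")
          case True
          then show ?thesis using low[OF True] \<Omega>'(3) by (simp add: subset_iff)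
        next
          case False
          show ?thesis using False var_nonneg[OF _ qc, of x] \<Omega>'(2) by (cases "x \<in> \<Omega>'") (auto simp: subset_iff)
        qed
      qed
      also have "\<dots> \<le> C * (L * (LINT x|lebesgue. indicator \<Omega>' x * (LINT y|\<nu> x. seg_err a \<zeta> y)) + measure lebesgue \<Omega>' / L)"
        unfolding q_def by (rule C(2)[OF \<Omega>'(1,2) L])
      also have "\<dots> \<le> C * (L * (2 * k * p + M * \<eta>) + (p + \<eta>) / L)"
        using C(1) L E m\<Omega>' by (intro mult_left_mono add_mono divide_right_mono) auto
      also have "\<dots> = p * (C * L * (2 * k) + C / L) + (C * L * M + C / L) * \<eta>"
        by (simp add: algebra_simps add_divide_distrib)
      also have "\<dots> \<le> p * (th / (16 * Z) + th / (16 * Z)) + K * \<eta>"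
        using k2 CL p0 \<eta> by (intro add_mono mult_left_mono mult_right_mono) (auto simp: K_def)
      also have "\<dots> = p * (th / (8 * Z)) + e" using K by (simp add: \<eta>_def field_simps)
      finally show ?thesis .
    qed
    have "p * (th / (4 * Z)) \<le> p * (th / (8 * Z))" by (rule field_le_epsilon) (rule ineq)
    then have "p * (th / (8 * Z)) \<le> 0" using Z by (simp add: field_simps)
    moreover have "th / (8 * Z) > 0" using th Z by simp
    ultimately have "p \<le> 0" by (metis mult_le_0_iff not_le)
    then have "p = 0" using p0 by simp
    then show "P \<in> null_sets lebesgue"
      using Pm by (auto simp: p_def null_sets_def emeasure_eq_measure2)
  qed
qed

end

section \<open>Rigidity\<close>

lemma left_inverse_of_elliptic:
  fixes A :: "'d::finite \<Rightarrow> real^'m^'k"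
  assumes "\<zeta> \<noteq> 0" "\<zeta> \<notin> wave_cone A"
  obtains N :: "real^'d^'k" where "\<And>l i. (A l *v \<zeta>) \<bullet> (N *v axis i 1) = (if l = i then 1 else 0)"
proof -
  define M :: "real^'d^'k" where "M = (\<chi> i j. (A j *v \<zeta>) $ i)"
  have "M *v \<xi> = symbol A \<xi> *v \<zeta>" for \<xi>
  proof -
    have "(M *v \<xi>) $ i = (symbol A \<xi> *v \<zeta>) $ i" for i
    proof -
      have "(M *v \<xi>) $ i = (\<Sum>j\<in>UNIV. \<Sum>k\<in>UNIV. A j $ i $ k * \<zeta> $ k * \<xi> $ j)"
        by (simp add: M_def matrix_vector_mult_def sum_distrib_right)
      also have "\<dots> = (\<Sum>k\<in>UNIV. \<Sum>j\<in>UNIV. A j $ i $ k * \<zeta> $ k * \<xi> $ j)"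
        by (rule sum.swap)
      also have "\<dots> = (symbol A \<xi> *v \<zeta>) $ i"
        by (simp add: symbol_def matrix_vector_mult_def sum_distrib_right sum_distrib_left mult_ac)
      finally show ?thesis .
    qed
    then show ?thesis by (simp add: vec_eq_iff)
  qed
  then have "M *v \<xi> = 0 \<Longrightarrow> \<xi> = 0" for \<xi>
    using symbol_kernel_in_wave_cone[OF assms(1), of \<xi> A] assms(2) by auto
  then obtain B where B: "B ** M = mat 1"
    using matrix_left_invertible_ker[of M] by blast
  have Brow: "transpose B *v axis i 1 = B $ i" for i
    by (simp add: vec_eq_iff matrix_vector_mult_def transpose_def axis_def if_distrib cong: if_cong)
  show thesis
  proof (rule that[of "transpose B"])
    fix l i
    have "(A l *v \<zeta>) \<bullet> (transpose B *v axis i 1) = (\<Sum>k\<in>UNIV. B $ i $ k * M $ k $ l)"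
      unfolding Brow by (simp add: inner_vec_def M_def mult.commute)
    also have "\<dots> = (B ** M) $ i $ l" by (simp add: matrix_matrix_mult_def)
    also have "\<dots> = (if l = i then 1 else 0)" by (simp add: B mat_def)
    finally show "(A l *v \<zeta>) \<bullet> (transpose B *v axis i 1) = (if l = i then 1 else 0)" .
  qed
qed

lemma AE_const_imp_return:
  fixes M :: "'a::{t1_space} measure"
  assumes "prob_space M" and sets: "sets M = sets borel" and ae: "AE y in M. y = c"
  shows "M = return borel c"
proof (rule measure_eqI)
  show "sets M = sets (return borel c)" using sets by simp
  fix X assume X: "X \<in> sets M"
  interpret prob_space M by fact
  show "emeasure M X = emeasure (return borel c) X"
  proof (cases "c \<in> X")
    case True
    have "AE y in M. y \<in> X" using ae by eventually_elim (use True in simp)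
    then have "emeasure M X = 1" by (rule emeasure_eq_1_AE[OF X])
    then show ?thesis using True X sets by simp
  next
    case False
    have "AE y in M. y \<notin> X" using ae by eventually_elim (use False in simp)
    then have "emeasure M X = 0" using X by (simp add: AE_iff_measurable[OF X] sets.sets_into_space Int_absorb1 Collect_conj_eq)
    then show ?thesis using False X sets by simp
  qed
qed

lemma closed_segment_near:
  fixes a :: "'a::real_normed_vector"
  assumes "norm (x1 - a) \<le> k" "norm (x2 - (a + \<zeta>)) \<le> k" "y \<in> closed_segment x1 x2"
  shows "\<exists>t. 0 \<le> t \<and> t \<le> 1 \<and> norm (y - a - t *\<^sub>R \<zeta>) \<le> k"
proof -
  obtain u where u: "0 \<le> u" "u \<le> 1" "y = (1 - u) *\<^sub>R x1 + u *\<^sub>R x2"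
    using assms(3) by (auto simp: closed_segment_def)
  have "y - a - u *\<^sub>R \<zeta> = (1 - u) *\<^sub>R (x1 - a) + u *\<^sub>R (x2 - (a + \<zeta>))"
    by (simp add: u(3) algebra_simps)
  then have "norm (y - a - u *\<^sub>R \<zeta>) \<le> (1 - u) * norm (x1 - a) + u * norm (x2 - (a + \<zeta>))"
    using u norm_triangle_ineq[of "(1 - u) *\<^sub>R (x1 - a)" "u *\<^sub>R (x2 - (a + \<zeta>))"] by simp
  also have "\<dots> \<le> (1 - u) * k + u * k"
    using u assms by (intro add_mono mult_left_mono) auto
  also have "\<dots> = k" by (simp add: algebra_simps)
  finally show ?thesis using u(1,2) by blast
qed

context generated_young_measure
begin

definition barycenter :: "real^'d \<Rightarrow> real^'m" where
  "barycenter x = (\<chi> i. LINT y|\<nu> x. y $ i)"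

lemma coord_cont: "continuous_on UNIV (\<lambda>y::real^'m. y $ i)"
  by (intro continuous_intros)

lemma tot_var_0_imp:
  assumes x: "x \<in> \<Omega>" and 0: "tot_var x = 0"
  shows "\<nu> x = return borel (barycenter x)"
proof (rule AE_const_imp_return[OF prob[OF x] sets_\<nu>[OF x]])
  have "var (\<lambda>y. y $ i) x = 0" for i
    using 0 var_nonneg[OF x coord_cont] unfolding tot_var_def
    by (subst (asm) sum_nonneg_eq_0_iff) auto
  then have "(LINT y|\<nu> x. (y $ i - barycenter x $ i)\<^sup>2) = 0" for i
    using var_eq(2)[OF x coord_cont, of i "barycenter x $ i"] by (simp add: barycenter_def)
  then have "AE y in \<nu> x. (y $ i - barycenter x $ i)\<^sup>2 = 0" for i
    using integral_nonneg_eq_0_iff_AE[OF var_eq(1)[OF x coord_cont, of i "barycenter x $ i"]] by simp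
  then have "AE y in \<nu> x. \<forall>i\<in>UNIV. (y $ i - barycenter x $ i)\<^sup>2 = 0"
    by (intro AE_finite_allI) auto
  then show "AE y in \<nu> x. y = barycenter x"
    by eventually_elim (simp add: vec_eq_iff)
qed

lemma barycenter_integrable:
  assumes "S \<in> sets lebesgue" "S \<subseteq> \<Omega>"
  shows "set_integrable lebesgue S barycenter"
proof -
  have "indicator S x *\<^sub>R barycenter x = (\<Sum>i\<in>UNIV. (indicator S x * (1 * (LINT y|\<nu> x. y $ i))) *\<^sub>R axis i 1)" for x
    by (simp add: vec_eq_iff barycenter_def axis_def if_distrib cong: if_cong)
  moreover have "integrable lebesgue (\<lambda>x. \<Sum>i\<in>UNIV. (indicator S x * (1 * (LINT y|\<nu> x. y $ i))) *\<^sub>R axis i (1::real))"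
    by (intro Bochner_Integration.integrable_sum integrable_scaleR_left
         young_limit_sub(2)[OF assms integrable_indicator_sub(1)[OF assms, of 1] coord_cont])
  ultimately show ?thesis by (simp add: set_integrable_def)
qed

lemma tot_var_meas: "(\<lambda>x. indicator \<Omega> x * tot_var x) \<in> borel_measurable lebesgue"
proof -
  have "(\<lambda>x. \<Sum>i\<in>UNIV. indicator \<Omega> x * var (\<lambda>y. y $ i) x) \<in> borel_measurable lebesgue"
    using var_integrable(1)[OF \<Omega>_sets subset_refl coord_cont]
    by (intro borel_measurable_sum borel_measurable_integrable)
  then show ?thesis by (simp add: tot_var_def sum_distrib_left)
qed

lemma strong_convergence:
  assumes S: "S \<in> sets lebesgue" "S \<subseteq> \<Omega>" and 0: "AE x in lebesgue. x \<in> S \<longrightarrow> tot_var x = 0"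
  shows "(\<lambda>n. LINT x:S|lebesgue. norm (z n x - barycenter x)) \<longlonglongrightarrow> 0"
proof -
  have Sm: "S \<in> lmeasurable" by (rule integrable_indicator_sub(2)[OF S])
  let ?m = "\<lambda>i x. LINT y|\<nu> x. y $ i"
  let ?s = "\<lambda>n i x. indicator S x * (v n x $ i - ?m i x)\<^sup>2"
  have lim: "(\<lambda>n. LINT x|lebesgue. ?s n i x) \<longlonglongrightarrow> 0" for i
  proof -
    have "(LINT x|lebesgue. indicator S x * var (\<lambda>y. y $ i) x) = (LINT x::real^'d|lebesgue. 0)"
    proof (rule integral_cong_AE)
      show "AE x in lebesgue. indicator S x * var (\<lambda>y. y $ i) x = 0"
        using 0
      proof eventually_elim
        case (elim x)
        show ?case
        proof (cases "x \<in> S")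
          case True
          then have x: "x \<in> \<Omega>" "tot_var x = 0" using elim S(2) by auto
          have "\<forall>i\<in>UNIV. var (\<lambda>y. y $ i) x = 0"
            using x(2) var_nonneg[OF x(1) coord_cont] unfolding tot_var_def
            by (subst (asm) sum_nonneg_eq_0_iff) auto
          then show ?thesis by simp
        qed simp
      qed
      show "(\<lambda>x. indicator S x * var (\<lambda>y. y $ i) x) \<in> borel_measurable lebesgue"
        using var_integrable(1)[OF S coord_cont] by (rule borel_measurable_integrable)
    qed simp
    then show ?thesis using var_integrable(2)[OF S coord_cont, of i] by simp
  qed
  define d where "d = real CARD('m)"
  have d0: "d \<ge> 0" by (simp add: d_def)
  have bound: "(LINT x:S|lebesgue. norm (z n x - barycenter x)) \<le> (LINT x|lebesgue. indicator \<Omega> x * norm (z n x - v n x))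
     + (\<delta> * d * measure lebesgue S + (1 / \<delta>) * (\<Sum>i\<in>UNIV. LINT x|lebesgue. ?s n i x))" if \<delta>: "\<delta> > 0" for n \<delta>
  proof -
    have i1: "integrable lebesgue (\<lambda>x. \<delta> * d * indicator S x)"
      using Sm by (intro integrable_mult_right) (simp add: lmeasurable_iff_integrable)
    have i2: "integrable lebesgue (\<lambda>x. (1 / \<delta>) * (\<Sum>i\<in>UNIV. ?s n i x))"
      by (intro integrable_mult_right Bochner_Integration.integrable_sum var_integrable(3)[OF S coord_cont])
    have "(LINT x:S|lebesgue. norm (z n x - barycenter x)) \<le> (LINT x|lebesgue. indicator \<Omega> x * norm (z n x - v n x)
       + (\<delta> * d * indicator S x + (1 / \<delta>) * (\<Sum>i\<in>UNIV. ?s n i x)))"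
      unfolding set_lebesgue_integral_def
    proof (rule integral_mono_AE')
      show "integrable lebesgue (\<lambda>x. indicator \<Omega> x * norm (z n x - v n x) + (\<delta> * d * indicator S x + (1 / \<delta>) * (\<Sum>i\<in>UNIV. ?s n i x)))"
        by (intro Bochner_Integration.integrable_add z_minus_v_integrable i1 i2)
      have nn: "0 \<le> indicator \<Omega> x * norm (z n x - v n x) + (\<delta> * d * indicator S x + (1 / \<delta>) * (\<Sum>i\<in>UNIV. ?s n i x))" for x
        using \<delta> d0 by (intro add_nonneg_nonneg mult_nonneg_nonneg sum_nonneg) auto
      then show "AE x in lebesgue. 0 \<le> indicator \<Omega> x * norm (z n x - v n x) + (\<delta> * d * indicator S x + (1 / \<delta>) * (\<Sum>i\<in>UNIV. ?s n i x))"
        by simp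
      show "AE x in lebesgue. indicator S x *\<^sub>R norm (z n x - barycenter x)
         \<le> indicator \<Omega> x * norm (z n x - v n x) + (\<delta> * d * indicator S x + (1 / \<delta>) * (\<Sum>i\<in>UNIV. ?s n i x))"
      proof (rule AE_I2)
        fix x
        show "indicator S x *\<^sub>R norm (z n x - barycenter x)
         \<le> indicator \<Omega> x * norm (z n x - v n x) + (\<delta> * d * indicator S x + (1 / \<delta>) * (\<Sum>i\<in>UNIV. ?s n i x))"
        proof (cases "x \<in> S")
          case False
          then show ?thesis using nn[of x] by simp
        next
          case True
          have t: "\<bar>t\<bar> \<le> \<delta> + (1 / \<delta>) * t\<^sup>2" for t
          proof (cases "\<bar>t\<bar> \<le> \<delta>")
            case True
            have "(1 / \<delta>) * t\<^sup>2 \<ge> 0" using \<delta> by simp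
            then show ?thesis using True by linarith
          next
            case False
            then have "\<bar>t\<bar> * \<delta> \<le> \<bar>t\<bar> * \<bar>t\<bar>" by (intro mult_left_mono) auto
            then have "\<bar>t\<bar> \<le> (1 / \<delta>) * t\<^sup>2" using \<delta> by (simp add: field_simps power2_eq_square)
            then show ?thesis using \<delta> by linarith
          qed
          have "norm (v n x - barycenter x) \<le> (\<Sum>i\<in>UNIV. \<bar>(v n x - barycenter x) $ i\<bar>)" by (rule norm_le_l1_cart)
          also have "\<dots> \<le> (\<Sum>i\<in>UNIV. \<delta> + (1 / \<delta>) * (v n x $ i - ?m i x)\<^sup>2)"
            using t by (intro sum_mono) (simp add: barycenter_def)
          also have "\<dots> = \<delta> * d + (1 / \<delta>) * (\<Sum>i\<in>UNIV. ?s n i x)"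
            using True by (simp add: sum.distrib sum_distrib_left d_def mult.commute)
          finally have "norm (v n x - barycenter x) \<le> \<delta> * d + (1 / \<delta>) * (\<Sum>i\<in>UNIV. ?s n i x)" .
          moreover have "norm (z n x - barycenter x) \<le> norm (z n x - v n x) + norm (v n x - barycenter x)"
            using norm_triangle_ineq[of "z n x - v n x" "v n x - barycenter x"] by simp
          moreover have "x \<in> \<Omega>" using True S(2) by blast
          ultimately show ?thesis using True by simp
        qed
      qed
    qed
    also have "\<dots> = (LINT x|lebesgue. indicator \<Omega> x * norm (z n x - v n x))
       + (\<delta> * d * measure lebesgue S + (1 / \<delta>) * (\<Sum>i\<in>UNIV. LINT x|lebesgue. ?s n i x))"
    proof -
      have "(LINT x|lebesgue. (1 / \<delta>) * (\<Sum>i\<in>UNIV. ?s n i x)) = (1 / \<delta>) * (\<Sum>i\<in>UNIV. LINT x|lebesgue. ?s n i x)"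
        by (simp only: Bochner_Integration.integral_mult_right_zero
              Bochner_Integration.integral_sum[OF var_integrable(3)[OF S coord_cont]])
      moreover have "(LINT x|lebesgue. \<delta> * d * indicator S x) = \<delta> * d * measure lebesgue S" by simp
      ultimately show ?thesis
        by (simp only: Bochner_Integration.integral_add[OF z_minus_v_integrable Bochner_Integration.integrable_add[OF i1 i2]]
             Bochner_Integration.integral_add[OF i1 i2])
    qed
    finally show ?thesis .
  qed
  show ?thesis
  proof (rule tendstoI)
    fix e :: real assume e: "e > 0"
    define \<delta> where "\<delta> = e / (2 * (d * measure lebesgue S + 1))"
    have den: "d * measure lebesgue S + 1 > 0" using d0 by (simp add: add_nonneg_pos)
    have \<delta>: "\<delta> > 0" using e den by (simp add: \<delta>_def)
    have "\<delta> * d * measure lebesgue S = (e / 2) * ((d * measure lebesgue S) / (d * measure lebesgue S + 1))"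
      by (simp add: \<delta>_def)
    also have "\<dots> \<le> (e / 2) * 1" using e den d0 by (intro mult_left_mono) auto
    finally have \<delta>2: "\<delta> * d * measure lebesgue S \<le> e / 2" by simp
    have "(\<lambda>n. (LINT x|lebesgue. indicator \<Omega> x * norm (z n x - v n x))
       + (\<delta> * d * measure lebesgue S + (1 / \<delta>) * (\<Sum>i\<in>UNIV. LINT x|lebesgue. ?s n i x)))
       \<longlonglongrightarrow> 0 + (\<delta> * d * measure lebesgue S + (1 / \<delta>) * (\<Sum>i\<in>(UNIV::'m set). 0))"
      by (intro tendsto_intros z_minus_v_limit lim)
    moreover have "0 + (\<delta> * d * measure lebesgue S + (1 / \<delta>) * (\<Sum>i\<in>(UNIV::'m set). 0)) < e"
      using \<delta>2 e by simp
    ultimately have "\<forall>\<^sub>F n in sequentially. (LINT x|lebesgue. indicator \<Omega> x * norm (z n x - v n x))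
       + (\<delta> * d * measure lebesgue S + (1 / \<delta>) * (\<Sum>i\<in>UNIV. LINT x|lebesgue. ?s n i x)) < e"
      by (rule order_tendstoD(2))
    then show "\<forall>\<^sub>F n in sequentially. dist (LINT x:S|lebesgue. norm (z n x - barycenter x)) 0 < e"
    proof eventually_elim
      case (elim n)
      have "(LINT x:S|lebesgue. norm (z n x - barycenter x)) \<ge> 0"
        unfolding set_lebesgue_integral_def by (intro Bochner_Integration.integral_nonneg) auto
      then show ?case using elim bound[OF \<delta>, of n] by simp
    qed
  qed
qed

lemma tot_var_eq_0:
  fixes A :: "'d \<Rightarrow> real^'m^'k"
  assumes r: "r > 1" and W: "(\<lambda>n. Wm1_norm A \<Omega> r (z n)) \<longlonglongrightarrow> 0"
    and z12: "set_borel_measurable lebesgue \<Omega> z1" "set_borel_measurable lebesgue \<Omega> z2"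
    and S: "S \<in> sets lebesgue" "S \<subseteq> \<Omega>" and cone: "\<And>x. x \<in> S \<Longrightarrow> z2 x - z1 x \<notin> wave_cone A"
    and seg: "AE x in lebesgue. x \<in> \<Omega> \<longrightarrow> measure_support (\<nu> x) \<subseteq> closed_segment (z1 x) (z2 x)"
  shows "AE x in lebesgue. x \<in> S \<longrightarrow> tot_var x = 0"
proof -
  obtain N0 where N0: "N0 \<in> null_sets lebesgue" "{x \<in> space lebesgue. \<not> (x \<in> \<Omega> \<longrightarrow> measure_support (\<nu> x) \<subseteq> closed_segment (z1 x) (z2 x))} \<subseteq> N0"
    using seg unfolding eventually_ae_filter by blast
  have segAE: "AE y in \<nu> x. y \<in> closed_segment (z1 x) (z2 x)" if "x \<in> \<Omega>" "x \<notin> N0" for x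
    using AE_measure_support[OF sets_\<nu>[OF that(1)]]
  proof eventually_elim
    case (elim y)
    then show ?case using that N0(2) by auto
  qed
  define Bad where "Bad k = {x \<in> S - N0. 1 / real (Suc k) \<le> tot_var x}" for k
  have BadS: "Bad k \<in> sets lebesgue" for k
  proof -
    have "Bad k = (S - N0) \<inter> {x \<in> space lebesgue. 1 / real (Suc k) \<le> indicator \<Omega> x * tot_var x}"
      using S(2) by (auto simp: Bad_def subset_iff)
    moreover have "{x \<in> space lebesgue. 1 / real (Suc k) \<le> indicator \<Omega> x * tot_var x} \<in> sets lebesgue"
      using tot_var_meas by measurable
    ultimately show ?thesis using S(1) N0(1) by (auto dest: null_setsD2)
  qed
  have Bad\<Omega>: "Bad k \<subseteq> \<Omega>" for k using S(2) by (auto simp: Bad_def)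
  have zmeas: "(\<lambda>x. indicator \<Omega> x *\<^sub>R z1 x) \<in> borel_measurable lebesgue" "(\<lambda>x. indicator \<Omega> x *\<^sub>R z2 x) \<in> borel_measurable lebesgue"
    using z12 by (simp_all add: set_borel_measurable_def)
  have "Bad k \<in> null_sets lebesgue" for k
  proof -
    have local: "\<exists>e>0. {x \<in> Bad k. (z1 x, z2 x) \<in> ball (z1 x0) e \<times> ball (z2 x0) e} \<in> null_sets lebesgue"
      if x0: "x0 \<in> Bad k" for x0
    proof -
      define \<zeta> where "\<zeta> = z2 x0 - z1 x0"
      have x0\<Omega>: "x0 \<in> \<Omega>" "x0 \<notin> N0" "x0 \<in> S" using x0 S(2) by (auto simp: Bad_def)
      have pos: "1 / real (Suc k) > 0" by simp
      have "\<zeta> \<noteq> 0"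
      proof
        assume z0: "\<zeta> = 0"
        have "tot_var x0 \<le> (LINT y|\<nu> x0. (norm (y - z1 x0))\<^sup>2)" by (rule tot_var_le(2)[OF x0\<Omega>(1)])
        also have "\<dots> = (LINT y|\<nu> x0. 0)"
        proof (rule integral_cong_AE)
          show "(\<lambda>y. (norm (y - z1 x0))\<^sup>2) \<in> borel_measurable (\<nu> x0)"
            using tot_var_le(1)[OF x0\<Omega>(1)] by (rule borel_measurable_integrable)
          show "AE y in \<nu> x0. (norm (y - z1 x0))\<^sup>2 = 0"
            using segAE[OF x0\<Omega>(1,2)] by eventually_elim (use z0 in \<open>simp add: \<zeta>_def\<close>)
        qed simp
        finally have "tot_var x0 \<le> 0" by simp
        moreover have "1 / real (Suc k) \<le> tot_var x0" using x0 by (simp add: Bad_def)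
        ultimately show False using pos by linarith
      qed
      moreover have "\<zeta> \<notin> wave_cone A" using cone[OF x0\<Omega>(3)] by (simp add: \<zeta>_def)
      ultimately obtain N :: "real^'d^'k" where N: "\<And>l i. (A l *v \<zeta>) \<bullet> (N *v axis i 1) = (if l = i then 1 else 0)"
        by (rule left_inverse_of_elliptic) blast
      obtain e where e: "e > 0" "\<And>P. P \<in> sets lebesgue \<Longrightarrow> P \<subseteq> \<Omega> \<Longrightarrow>
        (\<And>x. x \<in> P \<Longrightarrow> AE y in \<nu> x. \<exists>t. 0 \<le> t \<and> t \<le> 1 \<and> norm (y - z1 x0 - t *\<^sub>R \<zeta>) \<le> e) \<Longrightarrow>
        (\<And>x. x \<in> P \<Longrightarrow> 1 / real (Suc k) \<le> tot_var x) \<Longrightarrow> P \<in> null_sets lebesgue"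
        using concentrated_null[OF N r W pos, of "z1 x0"] by blast
      let ?P = "{x \<in> Bad k. (z1 x, z2 x) \<in> ball (z1 x0) e \<times> ball (z2 x0) e}"
      have "?P \<in> null_sets lebesgue"
      proof (rule e(2))
        have preimage: "(\<lambda>x. indicator \<Omega> x *\<^sub>R z1 x) -` ball (z1 x0) e \<inter> space lebesgue \<in> sets lebesgue"
          "(\<lambda>x. indicator \<Omega> x *\<^sub>R z2 x) -` ball (z2 x0) e \<inter> space lebesgue \<in> sets lebesgue"
          using measurable_sets[OF zmeas(1), of "ball (z1 x0) e"] measurable_sets[OF zmeas(2), of "ball (z2 x0) e"]
          by simp_all
        have "?P = Bad k \<inter> ({x \<in> space lebesgue. indicator \<Omega> x *\<^sub>R z1 x \<in> ball (z1 x0) e} \<inter> {x \<in> space lebesgue. indicator \<Omega> x *\<^sub>R z2 x \<in> ball (z2 x0) e})"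
          using Bad\<Omega>[of k] by (auto simp: subset_iff indicator_def)
        moreover have "{x \<in> space lebesgue. indicator \<Omega> x *\<^sub>R z1 x \<in> ball (z1 x0) e} \<in> sets lebesgue"
          "{x \<in> space lebesgue. indicator \<Omega> x *\<^sub>R z2 x \<in> ball (z2 x0) e} \<in> sets lebesgue"
          using preimage by (simp_all add: vimage_def)
        ultimately show "?P \<in> sets lebesgue" using BadS[of k] by simp
        show "?P \<subseteq> \<Omega>" using Bad\<Omega>[of k] by blast
        fix x assume x: "x \<in> ?P"
        then show "1 / real (Suc k) \<le> tot_var x" by (simp add: Bad_def)
        have x\<Omega>: "x \<in> \<Omega>" "x \<notin> N0" using x S(2) by (auto simp: Bad_def)
        have near: "norm (z1 x - z1 x0) \<le> e" "norm (z2 x - (z1 x0 + \<zeta>)) \<le> e"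
          using x by (auto simp: \<zeta>_def dist_norm norm_minus_commute)
        show "AE y in \<nu> x. \<exists>t. 0 \<le> t \<and> t \<le> 1 \<and> norm (y - z1 x0 - t *\<^sub>R \<zeta>) \<le> e"
          using segAE[OF x\<Omega>] by eventually_elim (rule closed_segment_near[OF near])
      qed
      then show ?thesis using e(1) by blast
    qed
    define nice where "nice x0 e \<longleftrightarrow> e > 0 \<and> {x \<in> Bad k. (z1 x, z2 x) \<in> ball (z1 x0) e \<times> ball (z2 x0) e} \<in> null_sets lebesgue" for x0 e
    have "\<forall>x0\<in>Bad k. \<exists>e. nice x0 e" using local unfolding nice_def by (intro ballI)
    from bchoice[OF this] obtain e where "\<forall>x0\<in>Bad k. nice x0 (e x0)" by (elim exE)
    then have e: "\<And>x0. x0 \<in> Bad k \<Longrightarrow> e x0 > 0"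
      "\<And>x0. x0 \<in> Bad k \<Longrightarrow> {x \<in> Bad k. (z1 x, z2 x) \<in> ball (z1 x0) (e x0) \<times> ball (z2 x0) (e x0)} \<in> null_sets lebesgue"
      unfolding nice_def by simp_all
    define U where "U x0 = ball (z1 x0) (e x0) \<times> ball (z2 x0) (e x0)" for x0
    have "\<And>V. V \<in> U ` Bad k \<Longrightarrow> open V" by (auto simp: U_def open_Times)
    then obtain F where F: "F \<subseteq> U ` Bad k" "countable F" "\<Union> F = \<Union> (U ` Bad k)"
      by (rule Lindelof)
    have "(\<Union>V\<in>F. {x \<in> Bad k. (z1 x, z2 x) \<in> V}) \<in> null_sets lebesgue"
    proof (rule null_sets_UN'[OF F(2)])
      fix V assume "V \<in> F"
      then obtain x0 where "x0 \<in> Bad k" "V = U x0" using F(1) by blast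
      then show "{x \<in> Bad k. (z1 x, z2 x) \<in> V} \<in> null_sets lebesgue" using e(2) by (simp add: U_def)
    qed
    moreover have "Bad k = (\<Union>V\<in>F. {x \<in> Bad k. (z1 x, z2 x) \<in> V})"
    proof
      show "Bad k \<subseteq> (\<Union>V\<in>F. {x \<in> Bad k. (z1 x, z2 x) \<in> V})"
      proof
        fix x assume x: "x \<in> Bad k"
        then have "(z1 x, z2 x) \<in> U x" using e(1) by (simp add: U_def)
        then have "(z1 x, z2 x) \<in> \<Union> F" unfolding F(3) using x by blast
        then show "x \<in> (\<Union>V\<in>F. {x \<in> Bad k. (z1 x, z2 x) \<in> V})" using x by blast
      qed
    qed blast
    ultimately show ?thesis by simp
  qed
  then have "(\<Union>k. Bad k) \<in> null_sets lebesgue" by (intro null_sets_UN)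
  then have "AE x in lebesgue. x \<notin> (\<Union>k. Bad k)" by (rule AE_not_in)
  moreover have "AE x in lebesgue. x \<notin> N0" using N0(1) by (rule AE_not_in)
  ultimately show ?thesis
  proof eventually_elim
    case (elim x)
    show ?case
    proof
      assume x: "x \<in> S"
      have "tot_var x \<ge> 0"
        unfolding tot_var_def using x S(2) by (intro sum_nonneg var_nonneg coord_cont) auto
      moreover have "\<not> tot_var x > 0"
      proof
        assume "tot_var x > 0"
        then obtain k where k: "1 / real (Suc k) < tot_var x"
          using reals_Archimedean by (auto simp: inverse_eq_divide)
        have "x \<in> Bad k" using x elim(2) less_imp_le[OF k] unfolding Bad_def by blast
        then show False using elim(1) by blast
      qed
      ultimately show "tot_var x = 0" by simp
    qed
  qed
qed

end

theorem theorem3p3: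
  fixes \<Omega> :: "(real^'d) set"
    and A :: "'d \<Rightarrow> real^'m^'k"
    and p r c :: real
    and z1 z2 :: "real^'d \<Rightarrow> real^'m"
    and S :: "(real^'d) set"
    and z :: "nat \<Rightarrow> real^'d \<Rightarrow> real^'m"
    and \<nu> :: "real^'d \<Rightarrow> (real^'m) measure"
  assumes "open \<Omega>" and "bounded \<Omega>"
    and "constant_rank A" and "CARD('k) \<ge> CARD('d)"
    and "1 \<le> p"
    and "in_Linf \<Omega> z1" and "in_Linf \<Omega> z2"
    and "S \<subseteq> \<Omega>" and "S \<in> sets lebesgue" and "emeasure lebesgue S > 0"
    and "\<forall>x\<in>S. z2 x - z1 x \<notin> wave_cone A"
    and "equi_integrable \<Omega> z"
    and "\<forall>n. in_Lp p \<Omega> (z n)" and "\<forall>n. Lp_norm p \<Omega> (z n) \<le> c"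
    and "1 < r" and "real (CARD('d) - 1) * r < real CARD('d)"
    and "(\<lambda>n. Wm1_norm A \<Omega> r (z n)) \<longlonglongrightarrow> 0"
    and "generates \<Omega> z \<nu>" and "compactly_supported \<Omega> \<nu>"
    and "AE x in lebesgue. x \<in> \<Omega> \<longrightarrow> measure_support (\<nu> x) \<subseteq> closed_segment (z1 x) (z2 x)"
  shows "\<exists>w. set_integrable lebesgue S w \<and>
             (AE x in lebesgue. x \<in> S \<longrightarrow> \<nu> x = return borel (w x)) \<and>
             (\<lambda>n. LINT x:S|lebesgue. norm (z n x - w x)) \<longlonglongrightarrow> 0"
proof -
  have \<Omega>m: "\<Omega> \<in> lmeasurable" using assms(1,2) by (intro lmeasurable_open)
  obtain K where K: "compact K" "\<And>x. x \<in> \<Omega> \<Longrightarrow> measure_support (\<nu> x) \<subseteq> K"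
    using assms(19) unfolding compactly_supported_def by blast
  obtain \<rho> where \<rho>: "\<And>y. y \<in> K \<Longrightarrow> norm y \<le> \<rho>"
    using compact_imp_bounded[OF K(1)] unfolding bounded_iff by blast
  have zm: "set_borel_measurable lebesgue \<Omega> (z n)" for n
    using assms(13) unfolding in_Lp_def by blast
  interpret generated_young_measure \<Omega> z \<nu> \<rho>
  proof
    show "open \<Omega>" "bounded \<Omega>" "equi_integrable \<Omega> z" "generates \<Omega> z \<nu>" using assms by auto
    show "set_borel_measurable lebesgue \<Omega> (z n)" for n by (rule zm)
    show "measure_support (\<nu> x) \<subseteq> cball 0 \<rho>" if "x \<in> \<Omega>" for x using K(2)[OF that] \<rho> by auto
    show "set_integrable lebesgue \<Omega> (z n)" for n
      unfolding set_integrable_def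
    proof (rule Bochner_Integration.integrable_bound)
      have "set_integrable lebesgue \<Omega> (\<lambda>x. norm (z n x) powr p)"
        using assms(13) unfolding in_Lp_def by blast
      then show "integrable lebesgue (\<lambda>x. indicator \<Omega> x + indicator \<Omega> x *\<^sub>R norm (z n x) powr p)"
        using \<Omega>m unfolding set_integrable_def
        by (intro Bochner_Integration.integrable_add) (simp_all add: lmeasurable_iff_integrable)
      show "(\<lambda>x. indicator \<Omega> x *\<^sub>R z n x) \<in> borel_measurable lebesgue"
        using zm unfolding set_borel_measurable_def .
      have le: "s \<le> 1 + s powr p" if "s \<ge> 0" for s :: real
      proof (cases "s \<le> 1")
        case True
        then show ?thesis by (simp add: add_increasing2)
      next
        case False
        then have "s powr 1 \<le> s powr p" using assms(5) by (intro powr_mono) auto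
        then show ?thesis using False by simp
      qed
      show "AE x in lebesgue. norm (indicator \<Omega> x *\<^sub>R z n x) \<le> norm (indicator \<Omega> x + indicator \<Omega> x *\<^sub>R norm (z n x) powr p)"
      proof (rule AE_I2)
        fix x
        show "norm (indicator \<Omega> x *\<^sub>R z n x) \<le> norm (indicator \<Omega> x + indicator \<Omega> x *\<^sub>R norm (z n x) powr p)"
          using le[of "norm (z n x)"] by (simp add: indicator_def)
      qed
    qed
  qed
  have zero: "AE x in lebesgue. x \<in> S \<longrightarrow> tot_var x = 0"
    by (rule tot_var_eq_0[OF assms(15,17) _ _ assms(9,8) _ assms(20)])
       (use assms(6,7,11) in \<open>auto simp: in_Linf_def\<close>)
  have "AE x in lebesgue. x \<in> S \<longrightarrow> \<nu> x = return borel (barycenter x)"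
    using zero
  proof eventually_elim
    case (elim x)
    then show ?case using tot_var_0_imp assms(8) by blast
  qed
  then show ?thesis
    using barycenter_integrable[OF assms(9,8)] strong_convergence[OF assms(9,8) zero] by blast
qed

end
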